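(* Let $L$ be a continuous family of Lagrangian subspaces $L_{(\alpha,\beta,\theta)}\subset\mathcal H^{0+1+2}(T;\mathbf R i)$ parametrized by $\widetilde{\mathbf R}^2$. For each choice of sign, the family $$\mathcal P^{\pm}_{(\alpha,\beta,\theta)}(L):=(P^{\pm}_{\mathbf R i}\oplus L_{(\alpha,\beta,\theta)})\oplus(P^{\pm}_{(\alpha,\beta),\mathbf C j}\oplus K^{\pm}_{(\alpha,\beta,\theta)})$$ is a continuous family (in the gap topology) of Lagrangian subspaces of $L^2(\Omega^{0+1+2}(T;su(2)))$ parametrized by $\widetilde{\mathbf R}^2$.
   Context: $T=S^1\times S^1=\{(e^{im},e^{il})\}$ carries the product metric and the orientation $dm\wedge dl$. $SU(2)$ is the unit quaternions and $su(2)=\mathbf R i\oplus\mathbf C j$ (imaginary quaternions, $\mathbf C j=\mathbf R j\oplus\mathbf R k$). $\Omega^{0+1+2}(T;V)=\bigoplus_{p=0}^{2}\Omega^p(T)\otimes V$, with $L^2$ inner product $-\int_T\mathrm{tr}(\alpha\wedge *\beta)$. For a connection $a\in\Omega^1(T;su(2))$ set $d_a\phi=d\phi+[a,\phi]$ and $$S_a(\alpha,\beta,\gamma)=( *d_a\beta,\,-*d_a\alpha-d_a{*}\gamma,\,d_a{*}\beta),$$ a self-adjoint elliptic operator on $\Omega^{0+1+2}(T;su(2))$. $P^+_a$ (resp. $P^-_a$) is the closed $L^2$-span of eigenvectors of $S_a$ with positive (resp. negative) eigenvalue. The almost complex structure is $J(\alpha,\beta,\gamma)=(-*\gamma,*\beta,*\alpha)$;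 a closed subspace $\Lambda$ (of $L^2(\Omega^{0+1+2}(T;su(2)))$ or of a $J$-invariant subspace) is Lagrangian if $J\Lambda=\Lambda^\perp$. The gap topology is the norm topology on orthogonal projections. For $(\alpha,\beta)\in\mathbf R^2$ let $a_{\alpha,\beta}=-i\alpha\,dm-i\beta\,dl$, and index objects by $(\alpha,\beta)$ instead of $a_{\alpha,\beta}$. $S_{\alpha,\beta}$ preserves the $\mathbf R i$-valued and the $\mathbf C j$-valued forms; $P^\pm_{\mathbf R i}=P^\pm_{\alpha,\beta}\cap L^2(\Omega^{0+1+2}(T;\mathbf R i))$ (independent of $(\alpha,\beta)$) and $P^\pm_{(\alpha,\beta),\mathbf C j}=P^\pm_{\alpha,\beta}\cap L^2(\Omega^{0+1+2}(T;\mathbf C j))$. $\mathcal H^{0+1+2}(T;\mathbf R i)$ is the space of harmonic $\mathbf R i$-valued forms. $\widetilde{\mathbf R}^2:=\mathbf R^2\times S^1/\!\sim$, where $(\alpha,\beta,\theta)\sim(\alpha,\beta,1)$ if $(\alpha,\beta)\notin(\frac12\mathbf Z)^2$. Its topology is the one making the following bijection $h:\dot{\mathbf R}^2\to\widetilde{\mathbf R}^2$ a homeomorphism: $\dot{\mathbf R}^2$ is $\mathbf R^2$ with the open disks of radius $\frac18$ around all points of $(\frac12\mathbf Z)^2$ removed; $h$ is the identity away from the disks of radius $\frac14$ around half integer lattice points; around the origin, for $z\in\mathbf C=\mathbf R^2$ with $\frac18\le|z|\le\frac14$, $h(z)=(\eta(|z|)z,\,z/|z|)$, where $\eta:\mathbf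 R\to[0,1]$ is smooth, $0$ for $t\le\frac18$, $1$ for $t\ge\frac14$, and a homeomorphism $[\frac18,\frac14]\to[0,1]$; around the other half integer lattice points $h$ is defined by translation. $K^\pm_{(\alpha,\beta,\theta)}:=\big(\lim_{t\to0^+}P^\pm_{(\alpha,\beta)+t(\mathrm{Re}\,\theta,\mathrm{Im}\,\theta)}\big)/P^\pm_{(\alpha,\beta)}$, regarded as a subspace (orthogonal complement) of $\ker S_{\alpha,\beta}\cap\Omega^{0+1+2}(T;\mathbf C j)$. It is $0$ if $(\alpha,\beta)\notin(\frac12\mathbf Z)^2$; if $(\alpha,\beta)=\frac12(r,s)\in(\frac12\mathbf Z)^2$ it is the real span of $\psi_1^\pm j,\psi_2^\pm j,\psi_1^\pm k,\psi_2^\pm k$ with $\psi_1^\pm=e^{i(rm+sl)}(1\mp(i\,\mathrm{Im}\theta\,dm-i\,\mathrm{Re}\theta\,dl))$, $\psi_2^\pm=e^{i(rm+sl)}(dm\wedge dl\pm(i\,\mathrm{Re}\theta\,dm+i\,\mathrm{Im}\theta\,dl))$. *)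

theory Defs
  imports "HOL-Analysis.Analysis"
begin

section \<open>Quaternions and $su(2)$\<close>

text \<open>The pair \<open>(z, w)\<close> stands for the quaternion \<open>z + w j\<close>, where \<open>j z = cnj z j\<close>.\<close>

type_synonym quat = "complex \<times> complex"

definition quat_mult :: "quat \<Rightarrow> quat \<Rightarrow> quat" where
  "quat_mult p q =
     (fst p * fst q - snd p * cnj (snd q), fst p * snd q + snd p * cnj (fst q))"

text \<open>The trace of the matrix \<open>[[z, w], [- cnj w, cnj z]]\<close> representing \<open>z + w j\<close>.\<close>

definition quat_tr :: "quat \<Rightarrow> real" where
  "quat_tr q = 2 * Re (fst q)"

text \<open>The pair \<open>(t, w)\<close> stands for the imaginary quaternion \<open>t i + w j\<close>.\<close>

type_synonym su2 = "real \<times> complex"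

definition quat_of :: "su2 \<Rightarrow> quat" where
  "quat_of x = (\<i> * complex_of_real (fst x), snd x)"

definition im_part :: "quat \<Rightarrow> su2" where
  "im_part q = (Im (fst q), snd q)"

definition bracket :: "su2 \<Rightarrow> su2 \<Rightarrow> su2" where
  "bracket x y =
     im_part (quat_mult (quat_of x) (quat_of y) - quat_mult (quat_of y) (quat_of x))"

lemma quat_of_bracket:
  "quat_of (bracket x y) =
     quat_mult (quat_of x) (quat_of y) - quat_mult (quat_of y) (quat_of x)"
  by (auto simp: bracket_def quat_of_def im_part_def quat_mult_def complex_eq_iff)

definition su2_i :: su2 where
  "su2_i = (1, 0)"

definition Ri :: "su2 set" where
  "Ri = {x. snd x = 0}"

definition Cj :: "su2 set" where
  "Cj = {x. fst x = 0}"


section \<open>The torus and differential forms on it\<close>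

text \<open>
  Forms are written in the global frame \<open>1, dm, dl, dm \<and> dl\<close>: a 1-form \<open>p dm + q dl\<close> has
  value \<open>(p, q)\<close>, and a form of mixed degree has value \<open>(\<alpha>, (p, q), \<gamma>)\<close>, standing for
  \<open>\<alpha> + (p dm + q dl) + \<gamma> dm \<and> dl\<close>.  Only values at points of \<open>torus\<close> are relevant.
\<close>

type_synonym pt = "complex \<times> complex"
type_synonym fibre = "su2 \<times> (su2 \<times> su2) \<times> su2"
type_synonym form = "pt \<Rightarrow> fibre"

definition torus :: "pt set" where
  "torus = sphere 0 1 \<times> sphere 0 1"

text \<open>The volume measure \<open>dm dl\<close>, of total mass \<open>(2 * pi)\<^sup>2\<close>.\<close>

definition torus_measure :: "pt measure" where
  "torus_measure =
     distr (restrict_space lborel ({0..2*pi} \<times> {0..2*pi})) (restrict_space borel torus)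
       (\<lambda>u. (cis (fst u), cis (snd u)))"

text \<open>The vector fields \<open>\<partial>/\<partial>m\<close> and \<open>\<partial>/\<partial>l\<close> at the point \<open>(cis m, cis l)\<close>.\<close>

definition pd_m :: "(pt \<Rightarrow> 'b::real_normed_vector) \<Rightarrow> pt \<Rightarrow> 'b" where
  "pd_m f x = vector_derivative (\<lambda>t. f (cis t * fst x, snd x)) (at 0)"

definition pd_l :: "(pt \<Rightarrow> 'b::real_normed_vector) \<Rightarrow> pt \<Rightarrow> 'b" where
  "pd_l f x = vector_derivative (\<lambda>t. f (fst x, cis t * snd x)) (at 0)"

primrec Ck_torus :: "nat \<Rightarrow> (pt \<Rightarrow> 'b::real_normed_vector) \<Rightarrow> bool" where
  "Ck_torus 0 f \<longleftrightarrow> continuous_on torus f"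
| "Ck_torus (Suc n) f \<longleftrightarrow>
     continuous_on torus f \<and>
     (\<forall>x\<in>torus. (\<lambda>t. f (cis t * fst x, snd x)) differentiable (at 0) \<and>
                 (\<lambda>t. f (fst x, cis t * snd x)) differentiable (at 0)) \<and>
     Ck_torus n (pd_m f) \<and> Ck_torus n (pd_l f)"

definition smooth_torus :: "(pt \<Rightarrow> 'b::real_normed_vector) \<Rightarrow> bool" where
  "smooth_torus f \<longleftrightarrow> (\<forall>n. Ck_torus n f)"

text \<open>
  The Hodge star of the flat metric with orientation \<open>dm \<and> dl\<close>:
  \<open>* 1 = dm \<and> dl\<close>, \<open>* dm = dl\<close>, \<open>* dl = - dm\<close>, \<open>* (dm \<and> dl) = 1\<close>.
\<close>

definition star0 :: "su2 \<Rightarrow> su2" where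
  "star0 a = a"

definition star1 :: "su2 \<times> su2 \<Rightarrow> su2 \<times> su2" where
  "star1 b = (- snd b, fst b)"

definition star2 :: "su2 \<Rightarrow> su2" where
  "star2 c = c"

definition hodge :: "fibre \<Rightarrow> fibre" where
  "hodge = (\<lambda>(\<alpha>, \<beta>, \<gamma>). (star2 \<gamma>, star1 \<beta>, star0 \<alpha>))"

definition J_fibre :: "fibre \<Rightarrow> fibre" where
  "J_fibre = (\<lambda>(\<alpha>, \<beta>, \<gamma>). (- star2 \<gamma>, star1 \<beta>, star0 \<alpha>))"

text \<open>The trace of the \<open>dm \<and> dl\<close>-coefficient of the wedge product.\<close>

definition tr_wedge :: "fibre \<Rightarrow> fibre \<Rightarrow> real" where
  "tr_wedge = (\<lambda>(\<alpha>, \<beta>, \<gamma>) (\<alpha>', \<beta>', \<gamma>').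
     quat_tr (quat_mult (quat_of \<alpha>) (quat_of \<gamma>')
            + (quat_mult (quat_of (fst \<beta>)) (quat_of (snd \<beta>'))
             - quat_mult (quat_of (snd \<beta>)) (quat_of (fst \<beta>')))
            + quat_mult (quat_of \<gamma>) (quat_of \<alpha>')))"

lemma tr_wedge_hodge: "- tr_wedge u (hodge v) = 2 * (u \<bullet> v)"
  by (auto simp: tr_wedge_def hodge_def quat_tr_def quat_mult_def quat_of_def star0_def
      star1_def star2_def inner_prod_def inner_complex_def algebra_simps split: prod.splits)


section \<open>The operators $S_a$\<close>

definition ext_d0 :: "(pt \<Rightarrow> su2) \<Rightarrow> pt \<Rightarrow> su2 \<times> su2" where
  "ext_d0 \<alpha> x = (pd_m \<alpha> x, pd_l \<alpha> x)"

definition ext_d1 :: "(pt \<Rightarrow> su2 \<times> su2) \<Rightarrow> pt \<Rightarrow> su2" where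
  "ext_d1 \<beta> x = pd_m (\<lambda>y. snd (\<beta> y)) x - pd_l (\<lambda>y. fst (\<beta> y)) x"

definition cov_d0 :: "(pt \<Rightarrow> su2 \<times> su2) \<Rightarrow> (pt \<Rightarrow> su2) \<Rightarrow> pt \<Rightarrow> su2 \<times> su2" where
  "cov_d0 a \<alpha> x = ext_d0 \<alpha> x + (bracket (fst (a x)) (\<alpha> x), bracket (snd (a x)) (\<alpha> x))"

text \<open>For 1-forms, \<open>[a, \<beta>] = a \<and> \<beta> + \<beta> \<and> a\<close>.\<close>

definition cov_d1 :: "(pt \<Rightarrow> su2 \<times> su2) \<Rightarrow> (pt \<Rightarrow> su2 \<times> su2) \<Rightarrow> pt \<Rightarrow> su2" where
  "cov_d1 a \<beta> x =
     ext_d1 \<beta> x + (bracket (fst (a x)) (snd (\<beta> x)) - bracket (snd (a x)) (fst (\<beta> x)))"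

definition S_op :: "(pt \<Rightarrow> su2 \<times> su2) \<Rightarrow> form \<Rightarrow> form" where
  "S_op a \<omega> =
     (let \<alpha> = (\<lambda>x. fst (\<omega> x)); \<beta> = (\<lambda>x. fst (snd (\<omega> x))); \<gamma> = (\<lambda>x. snd (snd (\<omega> x)))
      in (\<lambda>x. (star2 (cov_d1 a \<beta> x),
               - star1 (cov_d0 a \<alpha> x) - cov_d0 a (\<lambda>y. star2 (\<gamma> y)) x,
               cov_d1 a (\<lambda>y. star1 (\<beta> y)) x)))"

definition eigenform :: "(pt \<Rightarrow> su2 \<times> su2) \<Rightarrow> real \<Rightarrow> form \<Rightarrow> bool" where
  "eigenform a \<mu> \<omega> \<longleftrightarrow>
     smooth_torus \<omega> \<and> (\<exists>x\<in>torus. \<omega> x \<noteq> 0) \<and> (\<forall>x\<in>torus. S_op a \<omega> x = \<mu> *\<^sub>R \<omega> x)"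

text \<open>
  A pair \<open>(\<alpha>, \<beta>)\<close> of real parameters is encoded as the complex number \<open>\<alpha> + \<i> \<beta>\<close>;
  \<open>conn p\<close> is the connection \<open>- i \<alpha> dm - i \<beta> dl\<close>.
\<close>

definition conn :: "complex \<Rightarrow> pt \<Rightarrow> su2 \<times> su2" where
  "conn p x = (- Re p *\<^sub>R su2_i, - Im p *\<^sub>R su2_i)"

definition ext_d :: "form \<Rightarrow> form" where
  "ext_d \<omega> x = (0, ext_d0 (\<lambda>y. fst (\<omega> y)) x, ext_d1 (\<lambda>y. fst (snd (\<omega> y))) x)"

definition codiff :: "form \<Rightarrow> form" where
  "codiff \<omega> x = - hodge (ext_d (\<lambda>y. hodge (\<omega> y)) x)"

definition laplacian :: "form \<Rightarrow> form" where
  "laplacian \<omega> x = ext_d (codiff \<omega>) x + codiff (ext_d \<omega>) x"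

definition valued_in :: "su2 set \<Rightarrow> fibre set" where
  "valued_in V = V \<times> (V \<times> V) \<times> V"


section \<open>The Hilbert space of $L^2$ forms\<close>

definition square_integrable :: "form \<Rightarrow> bool" where
  "square_integrable f \<longleftrightarrow>
     f \<in> borel_measurable torus_measure \<and> integrable torus_measure (\<lambda>x. (norm (f x))\<^sup>2)"

definition l2_rel :: "form \<Rightarrow> form \<Rightarrow> bool" where
  "l2_rel f g \<longleftrightarrow>
     square_integrable f \<and> square_integrable g \<and> (AE x in torus_measure. f x = g x)"

lemma square_integrable_zero: "square_integrable (\<lambda>x. 0)"
  by (simp add: square_integrable_def)

lemma square_integrable_add:
  assumes "square_integrable f" "square_integrable g"
  shows "square_integrable (\<lambda>x. f x + g x)"
proof -
  note [measurable] = assms[unfolded square_integrable_def, THEN conjunct1]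
  have "norm ((norm (f x + g x))\<^sup>2) \<le> norm (2 * (norm (f x))\<^sup>2 + 2 * (norm (g x))\<^sup>2)" for x
  proof -
    have "(norm (f x + g x))\<^sup>2 \<le> (norm (f x) + norm (g x))\<^sup>2"
      by (intro power_mono norm_triangle_ineq) auto
    also have "\<dots> \<le> 2 * (norm (f x))\<^sup>2 + 2 * (norm (g x))\<^sup>2"
      using sum_squares_bound[of "norm (f x)" "norm (g x)"] by (simp add: power2_sum)
    finally show ?thesis by simp
  qed
  moreover have "integrable torus_measure (\<lambda>x. 2 * (norm (f x))\<^sup>2 + 2 * (norm (g x))\<^sup>2)"
    using assms by (auto simp: square_integrable_def)
  ultimately have "integrable torus_measure (\<lambda>x. (norm (f x + g x))\<^sup>2)"
    by (intro Bochner_Integration.integrable_bound[where g = "\<lambda>x. (norm (f x + g x))\<^sup>2"]) auto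
  then show ?thesis
    by (simp add: square_integrable_def)
qed

lemma square_integrable_scaleR:
  "square_integrable f \<Longrightarrow> square_integrable (\<lambda>x. c *\<^sub>R f x)"
  by (auto simp: square_integrable_def power_mult_distrib)

lemma square_integrable_uminus:
  "square_integrable f \<Longrightarrow> square_integrable (\<lambda>x. - f x)"
  by (auto simp: square_integrable_def)

lemma square_integrable_diff:
  "square_integrable f \<Longrightarrow> square_integrable g \<Longrightarrow> square_integrable (\<lambda>x. f x - g x)"
  using square_integrable_add[of f "\<lambda>x. - g x"] square_integrable_uminus[of g] by simp

lemma J_fibre_norm: "norm (J_fibre u) = norm u"
  by (simp add: J_fibre_def star0_def star1_def star2_def norm_prod_def case_prod_beta add.commute
      add.left_commute)

lemma J_fibre_measurable: "J_fibre \<in> borel_measurable borel"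
proof (rule borel_measurable_continuous_onI)
  show "continuous_on UNIV J_fibre"
    unfolding J_fibre_def star0_def star1_def star2_def case_prod_beta
    by (intro continuous_intros)
qed

lemma square_integrable_J:
  assumes "square_integrable f"
  shows "square_integrable (\<lambda>x. J_fibre (f x))"
proof -
  have "(\<lambda>x. J_fibre (f x)) \<in> borel_measurable torus_measure"
    using assms unfolding square_integrable_def
    by (blast intro: measurable_compose[OF _ J_fibre_measurable])
  with assms show ?thesis
    by (simp add: square_integrable_def J_fibre_norm)
qed

lemma integrable_inner_l2:
  assumes "square_integrable f" "square_integrable g"
  shows "integrable torus_measure (\<lambda>x. f x \<bullet> g x)"
proof (rule Bochner_Integration.integrable_bound)
  note [measurable] = assms[unfolded square_integrable_def, THEN conjunct1]
  show "integrable torus_measure (\<lambda>x. (norm (f x))\<^sup>2 + (norm (g x))\<^sup>2)"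
    using assms unfolding square_integrable_def by (intro Bochner_Integration.integrable_add) simp_all
  show "(\<lambda>x. f x \<bullet> g x) \<in> borel_measurable torus_measure"
    by measurable
  have "norm (f x \<bullet> g x) \<le> norm ((norm (f x))\<^sup>2 + (norm (g x))\<^sup>2)" for x
  proof -
    have "norm (f x \<bullet> g x) \<le> norm (f x) * norm (g x)"
      by (simp add: Cauchy_Schwarz_ineq2)
    also have "\<dots> \<le> (norm (f x))\<^sup>2 + (norm (g x))\<^sup>2"
      using sum_squares_bound[of "norm (f x)" "norm (g x)"]
        mult_nonneg_nonneg[OF norm_ge_zero[of "f x"] norm_ge_zero[of "g x"]] by linarith
    finally show ?thesis by simp
  qed
  then show "AE x in torus_measure. norm (f x \<bullet> g x) \<le> norm ((norm (f x))\<^sup>2 + (norm (g x))\<^sup>2)"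
    by (rule AE_I2)
qed

quotient_type l2_form = form / partial: l2_rel
proof (rule part_equivpI)
  show "\<exists>f. l2_rel f f"
    by (rule exI[of _ "\<lambda>x. 0"]) (simp add: l2_rel_def square_integrable_zero)
  show "symp l2_rel"
    by (auto simp: symp_def l2_rel_def)
  show "transp l2_rel"
    by (auto simp: transp_def l2_rel_def elim: AE_mp)
qed

instantiation l2_form :: real_vector
begin

lift_definition zero_l2_form :: l2_form is "\<lambda>x. 0"
  by (simp add: l2_rel_def square_integrable_zero)

lift_definition plus_l2_form :: "l2_form \<Rightarrow> l2_form \<Rightarrow> l2_form" is "\<lambda>f g x. f x + g x"
  by (auto simp: l2_rel_def square_integrable_add)

lift_definition minus_l2_form :: "l2_form \<Rightarrow> l2_form \<Rightarrow> l2_form" is "\<lambda>f g x. f x - g x"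
  by (auto simp: l2_rel_def square_integrable_diff)

lift_definition uminus_l2_form :: "l2_form \<Rightarrow> l2_form" is "\<lambda>f x. - f x"
  by (auto simp: l2_rel_def square_integrable_uminus)

lift_definition scaleR_l2_form :: "real \<Rightarrow> l2_form \<Rightarrow> l2_form" is "\<lambda>c f x. c *\<^sub>R f x"
  by (auto simp: l2_rel_def square_integrable_scaleR)

instance
proof
  fix f g h :: l2_form and c d :: real
  show "f + g + h = f + (g + h)"
    by transfer (simp add: l2_rel_def square_integrable_add add.assoc)
  show "f + g = g + f"
    by transfer (simp add: l2_rel_def square_integrable_add add.commute)
  show "0 + f = f"
    by transfer (simp add: l2_rel_def)
  show "- f + f = 0"
    by transfer (simp add: l2_rel_def square_integrable_zero)
  show "f - g = f + - g"
    by transfer (auto simp: l2_rel_def intro: square_integrable_diff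
        dest: square_integrable_diff)
  show "c *\<^sub>R (f + g) = c *\<^sub>R f + c *\<^sub>R g"
    by transfer (auto simp: l2_rel_def scaleR_add_right
        intro!: square_integrable_scaleR square_integrable_add)
  show "(c + d) *\<^sub>R f = c *\<^sub>R f + d *\<^sub>R f"
    by transfer (auto simp: l2_rel_def scaleR_add_left
        intro!: square_integrable_scaleR square_integrable_add)
  show "c *\<^sub>R d *\<^sub>R f = (c * d) *\<^sub>R f"
    by transfer (auto simp: l2_rel_def intro!: square_integrable_scaleR)
  show "1 *\<^sub>R f = f"
    by transfer (simp add: l2_rel_def)
qed

end

instantiation l2_form :: real_inner
begin

lift_definition inner_l2_form :: "l2_form \<Rightarrow> l2_form \<Rightarrow> real"
  is "\<lambda>f g. - (\<integral>x. tr_wedge (f x) (hodge (g x)) \<partial>torus_measure)"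
proof -
  fix f f' g g' :: form
  assume "l2_rel f f'" "l2_rel g g'"
  then have sq: "square_integrable f" "square_integrable f'" "square_integrable g"
      "square_integrable g'" and ae: "AE x in torus_measure. f x = f' x"
      "AE x in torus_measure. g x = g' x"
    by (auto simp: l2_rel_def)
  have eq: "tr_wedge u (hodge v) = - 2 * (u \<bullet> v)" for u v
    using tr_wedge_hodge[of u v] by simp
  have "(\<integral>x. f x \<bullet> g x \<partial>torus_measure) = (\<integral>x. f' x \<bullet> g' x \<partial>torus_measure)"
    using ae integrable_inner_l2[OF sq(1,3)] integrable_inner_l2[OF sq(2,4)]
    by (intro integral_cong_AE) auto
  then show "- (\<integral>x. tr_wedge (f x) (hodge (g x)) \<partial>torus_measure) =
             - (\<integral>x. tr_wedge (f' x) (hodge (g' x)) \<partial>torus_measure)"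
    by (simp add: eq)
qed

definition norm_l2_form :: "l2_form \<Rightarrow> real" where
  "norm_l2_form f = sqrt (inner f f)"

definition dist_l2_form :: "l2_form \<Rightarrow> l2_form \<Rightarrow> real" where
  "dist_l2_form f g = norm (f - g)"

definition sgn_l2_form :: "l2_form \<Rightarrow> l2_form" where
  "sgn_l2_form f = f /\<^sub>R norm f"

definition uniformity_l2_form :: "(l2_form \<times> l2_form) filter" where
  "uniformity_l2_form = (INF e\<in>{0 <..}. principal {(x, y). dist x y < e})"

definition open_l2_form :: "l2_form set \<Rightarrow> bool" where
  "open_l2_form U = (\<forall>x\<in>U. \<forall>\<^sub>F (x', y) in uniformity. x' = x \<longrightarrow> y \<in> U)"

instance
proof
  have eq: "- (\<integral>x. tr_wedge (f x) (hodge (g x)) \<partial>torus_measure) =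
      2 * (\<integral>x. f x \<bullet> g x \<partial>torus_measure)" for f g :: form
  proof -
    have "tr_wedge u (hodge v) = - 2 * (u \<bullet> v)" for u v
      using tr_wedge_hodge[of u v] by simp
    then show ?thesis by simp
  qed
  fix f g h :: l2_form and c :: real
  show "dist f g = norm (f - g)"
    by (rule dist_l2_form_def)
  show "sgn f = f /\<^sub>R norm f"
    by (rule sgn_l2_form_def)
  show "uniformity = (INF e\<in>{0 <..}. principal {(x, y :: l2_form). dist x y < e})"
    by (rule uniformity_l2_form_def)
  show "open U = (\<forall>x\<in>U. \<forall>\<^sub>F (x', y) in uniformity. x' = x \<longrightarrow> y \<in> U)" for U :: "l2_form set"
    by (rule open_l2_form_def)
  show "f \<bullet> g = g \<bullet> f"
    by transfer (simp add: eq inner_commute)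
  show "(f + g) \<bullet> h = f \<bullet> h + g \<bullet> h"
    by transfer (simp add: eq l2_rel_def inner_add_left integrable_inner_l2 algebra_simps)
  show "(c *\<^sub>R f) \<bullet> g = c * (f \<bullet> g)"
    by transfer (simp add: eq)
  show "0 \<le> f \<bullet> f"
    by transfer (simp add: eq)
  show "f \<bullet> f = 0 \<longleftrightarrow> f = 0"
  proof transfer
    fix f :: form
    assume "l2_rel f f"
    then have sq: "square_integrable f" by (simp add: l2_rel_def)
    have "(\<integral>x. f x \<bullet> f x \<partial>torus_measure) = 0 \<longleftrightarrow> (AE x in torus_measure. f x \<bullet> f x = 0)"
      by (intro integral_nonneg_eq_0_iff_AE integrable_inner_l2 sq) auto
    then show "- (\<integral>x. tr_wedge (f x) (hodge (f x)) \<partial>torus_measure) = 0 \<longleftrightarrow> l2_rel f (\<lambda>x. 0)"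
      using sq by (simp add: eq l2_rel_def square_integrable_zero)
  qed
  show "norm f = sqrt (f \<bullet> f)"
    by (rule norm_l2_form_def)
qed

end

lift_definition J_l2 :: "l2_form \<Rightarrow> l2_form" is "\<lambda>f x. J_fibre (f x)"
  by (auto simp: l2_rel_def square_integrable_J)

lift_definition l2_valued :: "su2 set \<Rightarrow> l2_form \<Rightarrow> bool"
  is "\<lambda>V f. AE x in torus_measure. f x \<in> valued_in V"
proof -
  fix V and f g :: form
  assume "l2_rel f g"
  then have ae: "AE x in torus_measure. f x = g x"
    by (simp add: l2_rel_def)
  then show "(AE x in torus_measure. f x \<in> valued_in V) = (AE x in torus_measure. g x \<in> valued_in V)"
    by (intro AE_cong_simp refl iffI) (auto elim: AE_mp)
qed


section \<open>Lagrangians and the gap topology\<close>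

definition lagrangian_in :: "l2_form set \<Rightarrow> l2_form set \<Rightarrow> bool" where
  "lagrangian_in V \<Lambda> \<longleftrightarrow>
     subspace \<Lambda> \<and> closed \<Lambda> \<and> \<Lambda> \<subseteq> V \<and> J_l2 ` \<Lambda> = V \<inter> \<Lambda>\<^sup>\<bottom>"

definition orth_proj :: "l2_form set \<Rightarrow> l2_form \<Rightarrow>\<^sub>L l2_form" where
  "orth_proj \<Lambda> = (THE P. \<forall>x. blinfun_apply P x \<in> \<Lambda> \<and> x - blinfun_apply P x \<in> \<Lambda>\<^sup>\<bottom>)"

text \<open>The limit of closed subspaces: the range of the norm limit of the projections.\<close>

definition gap_Lim :: "'t filter \<Rightarrow> ('t \<Rightarrow> l2_form set) \<Rightarrow> l2_form set" where
  "gap_Lim F \<Lambda> = range (blinfun_apply (Lim F (\<lambda>t. orth_proj (\<Lambda> t))))"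

definition lagrangian_family ::
    "'p topology \<Rightarrow> l2_form set \<Rightarrow> ('p \<Rightarrow> l2_form set) \<Rightarrow> bool" where
  "lagrangian_family X V \<Lambda> \<longleftrightarrow>
     (\<forall>x. lagrangian_in V (\<Lambda> x)) \<and> continuous_map X euclidean (\<lambda>x. orth_proj (\<Lambda> x))"

definition dsum :: "l2_form set \<Rightarrow> l2_form set \<Rightarrow> l2_form set"  (infixl \<open>\<oplus>\<^sub>L\<close> 65) where
  "A \<oplus>\<^sub>L B = {a + b | a b. a \<in> A \<and> b \<in> B}"


section \<open>Spectral subspaces\<close>

datatype sign = Plus | Minus

fun has_sign :: "sign \<Rightarrow> real \<Rightarrow> bool" where
  "has_sign Plus \<mu> \<longleftrightarrow> \<mu> > 0"
| "has_sign Minus \<mu> \<longleftrightarrow> \<mu> < 0"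

definition P_spec :: "sign \<Rightarrow> complex \<Rightarrow> l2_form set" where
  "P_spec s p = closure (span {abs_l2_form \<omega> | \<omega> \<mu>. has_sign s \<mu> \<and> eigenform (conn p) \<mu> \<omega>})"

definition P_spec_Ri :: "sign \<Rightarrow> complex \<Rightarrow> l2_form set" where
  "P_spec_Ri s p = P_spec s p \<inter> {u. l2_valued Ri u}"

definition P_spec_Cj :: "sign \<Rightarrow> complex \<Rightarrow> l2_form set" where
  "P_spec_Cj s p = P_spec s p \<inter> {u. l2_valued Cj u}"

definition harmonic_Ri :: "l2_form set" where
  "harmonic_Ri = {abs_l2_form \<omega> | \<omega>. smooth_torus \<omega> \<and>
     (\<forall>x\<in>torus. \<omega> x \<in> valued_in Ri \<and> laplacian \<omega> x = 0)}"

text \<open>The quotient of the limit by \<open>P_spec s p\<close>, realised as the orthogonal complement.\<close>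

definition K_spec :: "sign \<Rightarrow> complex \<Rightarrow> complex \<Rightarrow> l2_form set" where
  "K_spec s p \<theta> = gap_Lim (at_right 0) (\<lambda>t. P_spec s (p + of_real t * \<theta>)) \<inter> (P_spec s p)\<^sup>\<bottom>"


section \<open>The parameter space\<close>

definition half_lattice :: "complex set" where
  "half_lattice = {c. 2 * Re c \<in> \<int> \<and> 2 * Im c \<in> \<int>}"

definition blowup_rel :: "complex \<times> complex \<Rightarrow> complex \<times> complex \<Rightarrow> bool" where
  "blowup_rel u v \<longleftrightarrow>
     norm (snd u) = 1 \<and> norm (snd v) = 1 \<and> fst u = fst v \<and>
     (fst u \<in> half_lattice \<longrightarrow> snd u = snd v)"

quotient_type blowup = "complex \<times> complex" / partial: blowup_rel
proof (rule part_equivpI)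
  show "\<exists>u. blowup_rel u u"
    by (rule exI[of _ "(0, 1)"]) (simp add: blowup_rel_def)
  show "symp blowup_rel"
    by (auto simp: symp_def blowup_rel_def)
  show "transp blowup_rel"
    by (auto simp: transp_def blowup_rel_def)
qed

definition dotted_plane :: "complex set" where
  "dotted_plane = {z. \<forall>c\<in>half_lattice. dist z c \<ge> 1/8}"

definition smooth_cutoff :: "(real \<Rightarrow> real) \<Rightarrow> bool" where
  "smooth_cutoff \<eta> \<longleftrightarrow>
     (\<forall>k t. ((deriv ^^ k) \<eta>) differentiable (at t)) \<and>
     (\<forall>t. 0 \<le> \<eta> t \<and> \<eta> t \<le> 1) \<and> (\<forall>t\<le>1/8. \<eta> t = 0) \<and> (\<forall>t\<ge>1/4. \<eta> t = 1) \<and>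
     (\<exists>g. homeomorphism {1/8..1/4} {0..1} \<eta> g)"

text \<open>
  The open disks of radius \<open>1/4\<close> around half lattice points are disjoint.  On their boundary
  circles both branches give the class of \<open>(z, 1)\<close>.
\<close>

definition h_map :: "(real \<Rightarrow> real) \<Rightarrow> complex \<Rightarrow> blowup" where
  "h_map \<eta> z =
     (if \<exists>c\<in>half_lattice. dist z c < 1/4 then
        let c = (THE c. c \<in> half_lattice \<and> dist z c < 1/4); y = z - c
        in abs_blowup (c + of_real (\<eta> (norm y)) * y, y / of_real (norm y))
      else abs_blowup (z, 1))"

text \<open>The topology making the bijection \<open>h_map \<eta>\<close> from \<open>dotted_plane\<close> a homeomorphism.\<close>

definition blowup_topology :: "(real \<Rightarrow> real) \<Rightarrow> blowup topology" where
  "blowup_topology \<eta> =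
     topology (\<lambda>U. openin (top_of_set dotted_plane) {z \<in> dotted_plane. h_map \<eta> z \<in> U})"

lemma openin_blowup_topology:
  "openin (blowup_topology \<eta>) U \<longleftrightarrow>
     openin (top_of_set dotted_plane) {z \<in> dotted_plane. h_map \<eta> z \<in> U}"
proof -
  have "istopology (\<lambda>U. openin (top_of_set dotted_plane) {z \<in> dotted_plane. h_map \<eta> z \<in> U})"
    unfolding istopology_def
  proof (intro conjI allI impI)
    fix U V
    assume "openin (top_of_set dotted_plane) {z \<in> dotted_plane. h_map \<eta> z \<in> U}"
      "openin (top_of_set dotted_plane) {z \<in> dotted_plane. h_map \<eta> z \<in> V}"
    from openin_Int[OF this]
    show "openin (top_of_set dotted_plane) {z \<in> dotted_plane. h_map \<eta> z \<in> U \<inter> V}"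
      by (rule back_subst[of "openin _"]) auto
  next
    fix \<K>
    assume "\<forall>U\<in>\<K>. openin (top_of_set dotted_plane) {z \<in> dotted_plane. h_map \<eta> z \<in> U}"
    then have "openin (top_of_set dotted_plane)
        (\<Union>U\<in>\<K>. {z \<in> dotted_plane. h_map \<eta> z \<in> U})"
      by (intro openin_Union) auto
    then show "openin (top_of_set dotted_plane) {z \<in> dotted_plane. h_map \<eta> z \<in> \<Union>\<K>}"
      by (rule back_subst[of "openin _"]) auto
  qed
  then show ?thesis
    by (simp add: blowup_topology_def)
qed

text \<open>
  The family is evaluated at a representative \<open>(p, \<theta>)\<close> of the class.  Off the half lattice the
  choice of \<open>\<theta>\<close> is immaterial because there \<open>K_spec s p \<theta> = {0}\<close>; on it, \<open>\<theta>\<close> is determined.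
\<close>

definition curly_P :: "sign \<Rightarrow> (blowup \<Rightarrow> l2_form set) \<Rightarrow> blowup \<Rightarrow> l2_form set" where
  "curly_P s L x =
     (let (p, \<theta>) = rep_blowup x
      in (P_spec_Ri s p \<oplus>\<^sub>L L x) \<oplus>\<^sub>L (P_spec_Cj s p \<oplus>\<^sub>L K_spec s p \<theta>))"

end

theory Submission
  imports Defs
begin

text \<open>
  Fourier modes reduce the theorem to linear algebra in the fibre.  On the mode with frequency
  \<open>k\<close> the operator acts by its symbol at \<open>\<xi> = k\<close> (diagonal part) or \<open>\<xi> = k - 2 p\<close> (off-diagonal
  part).  The symbol is \<open>\<bar>\<xi>\<bar>\<close> times an involution that depends linearly on the direction
  \<open>\<xi> / \<bar>\<xi>\<bar>\<close> and anticommutes with \<open>J\<close>.  Hence the spectral projection acts on every mode with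
  \<open>\<xi> \<noteq> 0\<close> as the eigenprojection \<open>pol\<close> of that direction (\<open>P_spec_proj_mode\<close>), and the parameter
  enters only through the directions of the vectors \<open>k - 2 p\<close>.

  One of these vectors vanishes exactly when \<open>p\<close> is a half lattice point.  Approaching such a
  point along \<open>\<theta>\<close>, the vanishing vector has constant direction \<open>- \<theta>\<close> while the others stay
  away from \<open>0\<close>, so the projections converge in norm (\<open>P_spec_radial_limit\<close>).  The limit exceeds
  the spectral subspace by the eigenspace of that one mode, which is therefore \<open>K_spec\<close>
  (\<open>K_spec_eq_corner\<close>).  Consequently \<open>curly_P\<close> is the sum of the radial limit and \<open>L\<close>
  (\<open>curly_P_eq\<close>).

  A closed subspace with projection \<open>Q\<close> is Lagrangian as soon as \<open>Q - J Q J = 1\<close>.  For the radial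
  limit this identity holds on every mode except the constant diagonal ones, because \<open>J\<close>
  exchanges the two eigenspaces of the symbol.  The constant diagonal modes are the harmonic
  forms, and there the Lagrangian \<open>L\<close> supplies the missing part (\<open>lagrangian_limit_space_plus\<close>).

  For continuity, the gap distance of two limits is at most the supremum over \<open>k\<close> of the change
  of direction (\<open>limit_proj_diff_le\<close>).  In the coordinate \<open>z\<close> of the dotted plane the direction
  belonging to \<open>k\<close> is that of a vector of length at least \<open>1/8\<close>: the vector from \<open>k / 2\<close> to \<open>z\<close>
  inside the disk around \<open>k / 2\<close>, and to the image of \<open>z\<close> in the plane elsewhere
  (\<open>direction_eq_sight\<close>).  These vectors vary continuously, uniformly in \<open>k\<close>.

  The analytic foundation consists of the completeness of the space of square integrable forms,
  the symmetry of the operator (integration by parts), and the completeness of the Fourier modes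
  (Weierstrass approximation), by which identities between bounded operators may be checked on
  modes.
\<close>


section \<open>Orthogonal projections in Hilbert spaces\<close>

lemma norm_diff_sq_parallelogram:
  fixes x y z :: "'a::real_inner"
  shows "(norm (y - z))\<^sup>2 = 2 * (norm (x - y))\<^sup>2 + 2 * (norm (x - z))\<^sup>2 - 4 * (norm (x - (y + z) /\<^sub>R 2))\<^sup>2"
  by (simp add: power2_norm_eq_inner algebra_simps inner_commute)

text \<open>
  A minimising sequence is Cauchy by the parallelogram identity, and the first variation at its
  limit gives orthogonality.
\<close>

lemma Hilbert_projection_exists:
  fixes S :: "'a::{real_inner, complete_space} set"
  assumes S: "subspace S" "closed S"
  shows "\<exists>y\<in>S. x - y \<in> S\<^sup>\<bottom>"
proof -
  define N where "N = (\<lambda>y. (norm (x - y))\<^sup>2) ` S"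
  define d where "d = Inf N"
  have ne: "N \<noteq> {}" using subspace_0[OF S(1)] by (auto simp: N_def)
  have bdd: "bdd_below N" by (rule bdd_belowI[of _ 0]) (auto simp: N_def)
  have d_le: "d \<le> (norm (x - y))\<^sup>2" if "y \<in> S" for y
    unfolding d_def by (rule cInf_lower[OF _ bdd]) (use that in \<open>auto simp: N_def\<close>)
  have "\<exists>y\<in>S. (norm (x - y))\<^sup>2 < d + 1 / real (Suc n)" for n
    using cInf_lessD[OF ne, of "d + 1 / real (Suc n)"] unfolding d_def[symmetric] by (auto simp: N_def)
  then obtain y where y: "\<And>n. y n \<in> S" "\<And>n. (norm (x - y n))\<^sup>2 < d + 1 / real (Suc n)"
    by metis
  have bound: "(norm (y m - y n))\<^sup>2 \<le> 2 / real (Suc m) + 2 / real (Suc n)" for m n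
  proof -
    have "(y m + y n) /\<^sub>R 2 \<in> S" using y(1) S(1) by (simp add: subspace_add subspace_scale)
    from d_le[OF this] norm_diff_sq_parallelogram[of "y m" "y n" x] y(2)[of m] y(2)[of n]
    have "(norm (y m - y n))\<^sup>2 \<le> 2 * (1 / real (Suc m)) + 2 * (1 / real (Suc n))" by linarith
    then show ?thesis by simp
  qed
  have "Cauchy y"
  proof (rule metric_CauchyI)
    fix e :: real assume e: "e > 0"
    obtain M where M: "1 / real (Suc M) < e\<^sup>2 / 4"
      using nat_approx_posE[of "e\<^sup>2 / 4"] e by auto
    have "dist (y m) (y n) < e" if "m \<ge> M" "n \<ge> M" for m n
    proof -
      have "1 / real (Suc m) \<le> 1 / real (Suc M)" "1 / real (Suc n) \<le> 1 / real (Suc M)"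
        using that by (auto simp: frac_le)
      then have "(norm (y m - y n))\<^sup>2 < e\<^sup>2" using bound[of m n] M by simp
      then show ?thesis using e by (simp add: dist_norm power_less_imp_less_base)
    qed
    then show "\<exists>M. \<forall>m\<ge>M. \<forall>n\<ge>M. dist (y m) (y n) < e" by blast
  qed
  then obtain z where z: "y \<longlonglongrightarrow> z" using Cauchy_convergent_iff convergent_def by blast
  have zS: "z \<in> S" using closed_sequentially[OF S(2)] y(1) z by blast
  have "(norm (x - z))\<^sup>2 \<le> d"
  proof (rule LIMSEQ_le)
    show "(\<lambda>n. (norm (x - y n))\<^sup>2) \<longlonglongrightarrow> (norm (x - z))\<^sup>2"
      by (intro tendsto_intros z)
    show "(\<lambda>n. d + 1 / real (Suc n)) \<longlonglongrightarrow> d"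
      using tendsto_add[OF tendsto_const[of d] LIMSEQ_inverse_real_of_nat] by (simp add: inverse_eq_divide)
  qed (use y(2) less_imp_le in blast)
  have "(x - z) \<bullet> s = 0" if s: "s \<in> S" for s
  proof (cases "s = 0")
    case False
    define t where "t = (x - z) \<bullet> s / (s \<bullet> s)"
    have "z + t *\<^sub>R s \<in> S" using zS s S(1) by (simp add: subspace_add subspace_scale)
    then have "(norm (x - z))\<^sup>2 \<le> (norm (x - (z + t *\<^sub>R s)))\<^sup>2"
      using order_trans[OF \<open>(norm (x - z))\<^sup>2 \<le> d\<close> d_le] by blast
    then have "2 * t * ((x - z) \<bullet> s) \<le> t\<^sup>2 * (s \<bullet> s)"
      unfolding power2_norm_eq_inner
      by (simp add: algebra_simps inner_commute power2_eq_square)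
    moreover have "t\<^sup>2 * (s \<bullet> s) = t * ((x - z) \<bullet> s)"
      using False by (simp add: t_def power2_eq_square)
    ultimately have "t * ((x - z) \<bullet> s) \<le> 0" by simp
    then have "((x - z) \<bullet> s)\<^sup>2 / (s \<bullet> s) \<le> 0" by (simp add: t_def power2_eq_square)
    then show ?thesis using False inner_gt_zero_iff[of s] by (auto simp: divide_le_0_iff not_le[symmetric])
  qed simp
  then show ?thesis
    by (intro bexI[OF _ zS]) (auto simp: orthogonal_comp_def orthogonal_def inner_commute)
qed

text \<open>Elements of an algebraic span decompose along an orthogonal family of subspaces.\<close>

lemma span_Union_subspaces_finite_sum:
  assumes "\<And>i. subspace (E i)" and "x \<in> span (\<Union>i. E i)"
  shows "\<exists>F y. finite F \<and> (\<forall>i. y i \<in> E i) \<and> x = (\<Sum>i\<in>F. y i)"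
  using assms(2)
proof (induction rule: span_induct_alt)
  case base
  then show ?case
    using subspace_0[OF assms(1)] by (intro exI[of _ "{}"] exI[of _ "\<lambda>_. 0"]) simp
next
  case (step c x y)
  then obtain F f where f: "finite F" "\<forall>i. f i \<in> E i" "y = sum f F" by blast
  obtain j where j: "x \<in> E j" using step by blast
  define g where "g i = (if i \<in> F then f i else 0) + (if i = j then c *\<^sub>R x else 0)" for i
  have "g i \<in> E i" for i
    using f(2) j assms(1)[of i] by (auto simp: g_def intro!: subspace_add subspace_scale subspace_0)
  moreover have "(\<Sum>i\<in>insert j F. g i) = c *\<^sub>R x + y"
  proof -
    have "(\<Sum>i\<in>insert j F. if i \<in> F then f i else 0) = sum f F"
      by (rule sum.mono_neutral_cong_right) (use f in auto)
    then show ?thesis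
      using f(1) by (simp add: g_def sum.distrib f(3) del: sum.insert)
  qed
  ultimately show ?case using f(1) by (intro exI[of _ "insert j F"] exI[of _ g]) auto
qed

text \<open>
  An operator that respects an orthogonal decomposition is as large as its largest block.
\<close>

lemma block_operator_norm_le:
  fixes T :: "'a::real_inner \<Rightarrow>\<^sub>L 'a" and E :: "'i \<Rightarrow> 'a set"
  assumes sub: "\<And>i. subspace (E i)"
    and orth: "\<And>i j x y. i \<noteq> j \<Longrightarrow> x \<in> E i \<Longrightarrow> y \<in> E j \<Longrightarrow> x \<bullet> y = 0"
    and dense: "closure (span (\<Union>i. E i)) = UNIV"
    and inv: "\<And>i x. x \<in> E i \<Longrightarrow> blinfun_apply T x \<in> E i"
    and bound: "\<And>i x. x \<in> E i \<Longrightarrow> norm (blinfun_apply T x) \<le> \<delta> * norm x"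
    and \<delta>: "\<delta> \<ge> 0"
  shows "norm T \<le> \<delta>"
proof (rule norm_blinfun_bound[OF \<delta>])
  fix x
  have on_span: "norm (blinfun_apply T x) \<le> \<delta> * norm x" if span: "x \<in> span (\<Union>i. E i)" for x
  proof -
    obtain F y where y: "finite F" "\<And>i. y i \<in> E i" "x = sum y F"
      using span_Union_subspaces_finite_sum[OF sub span] by blast
    have "(norm (blinfun_apply T x))\<^sup>2 = (\<Sum>i\<in>F. (norm (blinfun_apply T (y i)))\<^sup>2)"
      unfolding y(3) blinfun.sum_right
      by (rule norm_sum_Pythagorean[OF y(1)])
        (use orth[OF _ inv[OF y(2)] inv[OF y(2)]] in \<open>auto simp: pairwise_def orthogonal_def\<close>)
    also have "\<dots> \<le> (\<Sum>i\<in>F. (\<delta> * norm (y i))\<^sup>2)"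
      by (intro sum_mono power_mono bound[OF y(2)]) auto
    also have "\<dots> = \<delta>\<^sup>2 * (norm x)\<^sup>2"
    proof -
      have "(norm x)\<^sup>2 = (\<Sum>i\<in>F. (norm (y i))\<^sup>2)"
        unfolding y(3)
        by (rule norm_sum_Pythagorean[OF y(1)])
          (use orth[OF _ y(2) y(2)] in \<open>auto simp: pairwise_def orthogonal_def\<close>)
      then show ?thesis by (simp add: power_mult_distrib sum_distrib_left)
    qed
    finally have "(norm (blinfun_apply T x))\<^sup>2 \<le> (\<delta> * norm x)\<^sup>2" by (simp add: power_mult_distrib)
    then show ?thesis by (rule power2_le_imp_le) (use \<delta> in simp)
  qed
  have "closed {x. norm (blinfun_apply T x) \<le> \<delta> * norm x}"
    by (intro closed_Collect_le continuous_intros)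
  then have "closure (span (\<Union>i. E i)) \<subseteq> {x. norm (blinfun_apply T x) \<le> \<delta> * norm x}"
    by (intro closure_minimal) (use on_span in auto)
  then show "norm (blinfun_apply T x) \<le> \<delta> * norm x"
    using dense by auto
qed

lemma subspace_closure:
  fixes S :: "'a::real_normed_vector set"
  assumes S: "subspace S"
  shows "subspace (closure S)"
proof (rule subspaceI)
  show "0 \<in> closure S" using subspace_0[OF S] closure_subset by blast
next
  fix x y assume "x \<in> closure S" "y \<in> closure S"
  then obtain a b where "\<forall>n. a n \<in> S" "a \<longlonglongrightarrow> x" "\<forall>n. b n \<in> S" "b \<longlonglongrightarrow> y"
    unfolding closure_sequential by blast
  then show "x + y \<in> closure S"
    unfolding closure_sequential
    by (intro exI[of _ "\<lambda>n. a n + b n"]) (auto intro: tendsto_add subspace_add[OF S])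
next
  fix c x assume "x \<in> closure S"
  then obtain a where "\<forall>n. a n \<in> S" "a \<longlonglongrightarrow> x"
    unfolding closure_sequential by blast
  then show "c *\<^sub>R x \<in> closure S"
    unfolding closure_sequential
    by (intro exI[of _ "\<lambda>n. c *\<^sub>R a n"]) (auto intro: tendsto_scaleR subspace_scale[OF S])
qed

definition is_orth_proj :: "('a::real_inner \<Rightarrow>\<^sub>L 'a) \<Rightarrow> 'a set \<Rightarrow> bool" where
  "is_orth_proj Q S \<longleftrightarrow> (\<forall>x. blinfun_apply Q x \<in> S \<and> x - blinfun_apply Q x \<in> S\<^sup>\<bottom>)"

lemma orthogonal_comp_iff: "x \<in> S\<^sup>\<bottom> \<longleftrightarrow> (\<forall>y\<in>S. y \<bullet> x = 0)"
  by (auto simp: orthogonal_comp_def orthogonal_def)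

lemma orthogonal_decomposition_unique:
  assumes "subspace S" "y \<in> S" "x - y \<in> S\<^sup>\<bottom>" "z \<in> S" "x - z \<in> S\<^sup>\<bottom>"
  shows "y = z"
proof -
  have "y - z \<in> S" using assms by (simp add: subspace_diff)
  then have "(y - z) \<bullet> (x - z) = 0" "(y - z) \<bullet> (x - y) = 0"
    using assms(3,5) by (auto simp: orthogonal_comp_iff)
  then have "(y - z) \<bullet> (y - z) = 0" by (simp add: inner_diff_right)
  then show ?thesis by simp
qed

lemma is_orth_proj_apply:
  assumes "is_orth_proj Q S" "subspace S" "y \<in> S" "x - y \<in> S\<^sup>\<bottom>"
  shows "blinfun_apply Q x = y"
  using assms orthogonal_decomposition_unique[OF assms(2)] unfolding is_orth_proj_def by blast

lemma is_orth_proj_fixes: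
  assumes "is_orth_proj Q S" "subspace S"
  shows "blinfun_apply Q x = x \<longleftrightarrow> x \<in> S"
  using is_orth_proj_apply[OF assms, of x x] assms
  by (auto simp: is_orth_proj_def subspace_0 subspace_orthogonal_comp) metis

lemma is_orth_proj_kernel:
  assumes "is_orth_proj Q S" "subspace S"
  shows "blinfun_apply Q x = 0 \<longleftrightarrow> x \<in> S\<^sup>\<bottom>"
  using is_orth_proj_apply[OF assms, of 0 x] assms
  by (auto simp: is_orth_proj_def subspace_0) (metis diff_zero)

lemma is_orth_proj_range:
  assumes "is_orth_proj Q S" "subspace S"
  shows "range (blinfun_apply Q) = S"
  using is_orth_proj_fixes[OF assms] assms(1) unfolding is_orth_proj_def
  by (metis image_subset_iff rangeI subsetI subset_antisym)

lemma is_orth_proj_closed: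
  assumes "is_orth_proj Q S" "subspace S"
  shows "closed S"
proof -
  have "S = {x. blinfun_apply Q x = x}" using is_orth_proj_fixes[OF assms] by auto
  also have "closed \<dots>" by (intro closed_Collect_eq continuous_intros)
  finally show ?thesis .
qed

lemma is_orth_proj_exists:
  fixes S :: "'a::{real_inner, complete_space} set"
  assumes S: "subspace S" "closed S"
  shows "\<exists>Q. is_orth_proj Q S"
proof -
  obtain f where f: "\<And>x. f x \<in> S" "\<And>x. x - f x \<in> S\<^sup>\<bottom>"
    using Hilbert_projection_exists[OF S] by metis
  note unique = orthogonal_decomposition_unique[OF S(1) f(1) f(2)]
  have "bounded_linear f"
  proof (rule bounded_linear_intro[where K = 1])
    fix x y and c :: real
    show "f (x + y) = f x + f y"
    proof (rule unique)
      show "f x + f y \<in> S" using f S by (simp add: subspace_add)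
      have "(x - f x) + (y - f y) \<in> S\<^sup>\<bottom>" using f by (simp add: subspace_add subspace_orthogonal_comp)
      then show "(x + y) - (f x + f y) \<in> S\<^sup>\<bottom>" by (simp add: algebra_simps)
    qed
    show "f (c *\<^sub>R x) = c *\<^sub>R f x"
    proof (rule unique)
      show "c *\<^sub>R f x \<in> S" using f S by (simp add: subspace_scale)
      have "c *\<^sub>R (x - f x) \<in> S\<^sup>\<bottom>" using f by (simp add: subspace_scale subspace_orthogonal_comp)
      then show "c *\<^sub>R x - c *\<^sub>R f x \<in> S\<^sup>\<bottom>" by (simp add: algebra_simps)
    qed
    have "f x \<bullet> (x - f x) = 0" using f by (simp add: orthogonal_comp_iff)
    then have "(norm (f x))\<^sup>2 = f x \<bullet> x" by (simp add: power2_norm_eq_inner inner_diff_right)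
    also have "\<dots> \<le> norm (f x) * norm x" by (rule norm_cauchy_schwarz)
    finally show "norm (f x) \<le> norm x * 1"
      by (cases "f x = 0") (auto simp: power2_eq_square)
  qed
  then have "is_orth_proj (Blinfun f) S"
    using f by (simp add: is_orth_proj_def bounded_linear_Blinfun_apply)
  then show ?thesis ..
qed

lemma is_orth_proj_sum:
  assumes P: "is_orth_proj P A" "subspace A" and Q: "is_orth_proj Q B" "subspace B"
    and orth: "\<And>a b. a \<in> A \<Longrightarrow> b \<in> B \<Longrightarrow> a \<bullet> b = 0"
  shows "is_orth_proj (P + Q) {a + b | a b. a \<in> A \<and> b \<in> B}"
  unfolding is_orth_proj_def
proof (intro allI conjI)
  fix x
  show "blinfun_apply (P + Q) x \<in> {a + b | a b. a \<in> A \<and> b \<in> B}"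
    using P(1) Q(1) by (auto simp: is_orth_proj_def plus_blinfun.rep_eq)
  have "a \<bullet> blinfun_apply P x = a \<bullet> x" if "a \<in> A" for a
  proof -
    have "a \<bullet> (x - blinfun_apply P x) = 0"
      using P(1) that unfolding is_orth_proj_def orthogonal_comp_iff by blast
    then show ?thesis by (simp add: inner_diff_right)
  qed
  moreover have "b \<bullet> blinfun_apply Q x = b \<bullet> x" if "b \<in> B" for b
  proof -
    have "b \<bullet> (x - blinfun_apply Q x) = 0"
      using Q(1) that unfolding is_orth_proj_def orthogonal_comp_iff by blast
    then show ?thesis by (simp add: inner_diff_right)
  qed
  moreover have "a \<bullet> blinfun_apply Q x = 0" if "a \<in> A" for a
    using Q(1) that orth unfolding is_orth_proj_def by blast
  moreover have "b \<bullet> blinfun_apply P x = 0" if "b \<in> B" for b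
    using P(1) that orth unfolding is_orth_proj_def by (subst inner_commute) blast
  ultimately show "x - blinfun_apply (P + Q) x \<in> {a + b | a b. a \<in> A \<and> b \<in> B}\<^sup>\<bottom>"
    by (auto simp: orthogonal_comp_iff plus_blinfun.rep_eq inner_diff_right inner_add_left inner_add_right)
qed

lemma subspace_dsum: "subspace A \<Longrightarrow> subspace B \<Longrightarrow> subspace (A \<oplus>\<^sub>L B)"
  unfolding dsum_def by (rule subspace_sums)

lemma orth_proj_eq:
  assumes "is_orth_proj Q S" "subspace S"
  shows "orth_proj S = Q"
  unfolding orth_proj_def
proof (rule the_equality)
  show "\<forall>x. blinfun_apply Q x \<in> S \<and> x - blinfun_apply Q x \<in> S\<^sup>\<bottom>"
    using assms(1) by (simp add: is_orth_proj_def)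
  show "P = Q" if "\<forall>x. blinfun_apply P x \<in> S \<and> x - blinfun_apply P x \<in> S\<^sup>\<bottom>" for P
    using that is_orth_proj_apply[OF assms] by (intro blinfun_eqI) metis
qed


section \<open>Completeness of the space of square integrable forms\<close>

lemma space_torus_measure [simp]: "space torus_measure = torus"
  by (simp add: torus_measure_def space_restrict_space)

lemma sets_torus_measure: "sets torus_measure = sets (restrict_space borel torus)"
  by (simp add: torus_measure_def)

definition torus_param :: "real \<times> real \<Rightarrow> pt" where
  "torus_param u = (cis (fst u), cis (snd u))"

definition torus_square :: "(real \<times> real) set" where
  "torus_square = {0..2*pi} \<times> {0..2*pi}"

lemma torus_measure_alt:
  "torus_measure = distr (restrict_space lborel torus_square) (restrict_space borel torus) torus_param"
  unfolding torus_measure_def torus_square_def torus_param_def ..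

lemma continuous_on_torus_param: "continuous_on A torus_param"
  unfolding torus_param_def by (intro continuous_intros)

lemma torus_param_in_torus [simp]: "torus_param u \<in> torus"
  by (simp add: torus_param_def torus_def dist_norm)

lemma torus_square_sets [measurable, simp]: "torus_square \<in> sets borel"
  unfolding torus_square_def by (intro borel_closed closed_Times) auto

lemma measurable_torus_param [measurable]:
  "torus_param \<in> measurable (restrict_space lborel torus_square) (restrict_space borel torus)"
proof (rule measurable_restrict_space2)
  have "torus_param \<in> borel_measurable borel"
    by (intro borel_measurable_continuous_onI continuous_on_torus_param)
  then show "torus_param \<in> borel_measurable (restrict_space lborel torus_square)"
    by (intro measurable_restrict_space1) simp
qed auto

lemma emeasure_torus_square: "emeasure lborel torus_square = ennreal ((2 * pi)\<^sup>2)"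
proof -
  have "torus_square = cbox (0, 0) (2 * pi, 2 * pi)"
    by (simp add: torus_square_def cbox_Pair_eq)
  then have "emeasure lborel torus_square = emeasure lborel (cbox (0::real, 0::real) (2 * pi, 2 * pi))"
    by (rule arg_cong)
  also have "\<dots> = ennreal (\<Prod>b\<in>Basis. ((2 * pi, 2 * pi) - (0::real, 0::real)) \<bullet> b)"
    by (rule emeasure_lborel_cbox) (auto simp: Basis_prod_def)
  also have "(\<Prod>b\<in>Basis. ((2 * pi, 2 * pi) - (0::real, 0::real)) \<bullet> b) = (2 * pi)\<^sup>2"
    by (simp add: Basis_prod_def power2_eq_square)
  finally show ?thesis .
qed

lemma emeasure_torus: "emeasure torus_measure torus = ennreal ((2 * pi)\<^sup>2)"
proof -
  have "torus_param -` torus \<inter> space (restrict_space lborel torus_square) = torus_square"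
    by (auto simp: space_restrict_space)
  then show ?thesis
    unfolding torus_measure_alt
    by (subst emeasure_distr)
      (auto simp: emeasure_restrict_space emeasure_torus_square sets_restrict_space)
qed

interpretation torus_measure: finite_measure torus_measure
  by (rule finite_measureI) (simp add: emeasure_torus)

lemma measure_torus: "measure torus_measure torus = (2 * pi)\<^sup>2"
  by (simp add: measure_def emeasure_torus)

lemma borel_measurable_torusI:
  fixes f :: "pt \<Rightarrow> 'b::{second_countable_topology, real_normed_vector}"
  assumes "continuous_on torus f"
  shows "f \<in> borel_measurable torus_measure"
proof -
  have "f \<in> borel_measurable (restrict_space borel torus)"
    by (rule borel_measurable_continuous_on_restrict[OF assms])
  then show ?thesis
    using measurable_cong_sets[OF sets_torus_measure refl] by blast
qed

lemma compact_torus: "compact torus"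
  unfolding torus_def by (intro compact_Times compact_sphere)

lemma integrable_torusI:
  fixes f :: "pt \<Rightarrow> 'b::{second_countable_topology, real_normed_vector, banach}"
  assumes "continuous_on torus f"
  shows "integrable torus_measure f"
proof -
  obtain B where "\<And>x. x \<in> torus \<Longrightarrow> norm (f x) \<le> B"
    using compact_imp_bounded[OF compact_continuous_image[OF assms compact_torus]]
    by (auto simp: bounded_iff)
  then show ?thesis
    by (intro torus_measure.integrable_const_bound[where B = B] borel_measurable_torusI assms) auto
qed

lemma square_integrable_continuous: "continuous_on torus f \<Longrightarrow> square_integrable f"
  unfolding square_integrable_def
  by (intro conjI borel_measurable_torusI integrable_torusI continuous_intros)

lemma l2_form_cases:
  obtains f where "square_integrable f" "u = abs_l2_form f"
  using that[of "rep_l2_form u"] Quotient_abs_rep[OF Quotient_l2_form, of u]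
    Quotient_rep_reflp[OF Quotient_l2_form, of u]
  by (auto simp: l2_rel_def)

lemma l2_rel_refl: "square_integrable f \<Longrightarrow> l2_rel f f"
  by (simp add: l2_rel_def)

lemma abs_l2_form_eq_iff:
  assumes "square_integrable f" "square_integrable g"
  shows "abs_l2_form f = abs_l2_form g \<longleftrightarrow> (AE x in torus_measure. f x = g x)"
  using Quotient_rel[OF Quotient_l2_form, of f g] assms by (auto simp: l2_rel_def)

lemma abs_l2_form_add:
  "square_integrable f \<Longrightarrow> square_integrable g \<Longrightarrow>
    abs_l2_form f + abs_l2_form g = abs_l2_form (\<lambda>x. f x + g x)"
  by (intro plus_l2_form.abs_eq l2_rel_refl)

lemma abs_l2_form_diff:
  "square_integrable f \<Longrightarrow> square_integrable g \<Longrightarrow>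
    abs_l2_form f - abs_l2_form g = abs_l2_form (\<lambda>x. f x - g x)"
  by (intro minus_l2_form.abs_eq l2_rel_refl)

lemma abs_l2_form_scaleR:
  "square_integrable f \<Longrightarrow> c *\<^sub>R abs_l2_form f = abs_l2_form (\<lambda>x. c *\<^sub>R f x)"
  by (intro scaleR_l2_form.abs_eq l2_rel_refl)

lemma abs_l2_form_J: "square_integrable f \<Longrightarrow> J_l2 (abs_l2_form f) = abs_l2_form (\<lambda>x. J_fibre (f x))"
  by (intro J_l2.abs_eq l2_rel_refl)

lemma inner_abs_l2_form:
  assumes "square_integrable f" "square_integrable g"
  shows "abs_l2_form f \<bullet> abs_l2_form g = 2 * (\<integral>x. f x \<bullet> g x \<partial>torus_measure)"
proof -
  have "tr_wedge u (hodge v) = - 2 * (u \<bullet> v)" for u v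
    using tr_wedge_hodge[of u v] by simp
  then show ?thesis
    by (subst inner_l2_form.abs_eq) (auto intro: l2_rel_refl assms)
qed

lemma norm_abs_l2_form:
  assumes "square_integrable f"
  shows "(norm (abs_l2_form f))\<^sup>2 = 2 * (\<integral>x. (norm (f x))\<^sup>2 \<partial>torus_measure)"
  using inner_abs_l2_form[OF assms assms] by (simp add: power2_norm_eq_inner)

lemma Cauchy_fast_subseq:
  fixes X :: "nat \<Rightarrow> 'a::metric_space"
  assumes "Cauchy X"
  obtains r where "strict_mono r" "\<And>k. dist (X (r (Suc k))) (X (r k)) < (1/2)^k"
proof -
  have "\<exists>N. \<forall>m\<ge>N. \<forall>n\<ge>N. dist (X m) (X n) < (1/2)^k" for k
    using metric_CauchyD[OF assms, of "(1/2)^k"] by auto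
  then obtain N where N: "\<And>k m n. m \<ge> N k \<Longrightarrow> n \<ge> N k \<Longrightarrow> dist (X m) (X n) < (1/2)^k"
    by metis
  define r where "r k = (\<Sum>i\<le>k. N i) + k" for k
  have "strict_mono r" by (rule strict_monoI_Suc) (simp add: r_def)
  moreover have "N k \<le> r k" "N k \<le> r (Suc k)" for k
    using member_le_sum[of k "{..k}" N] by (auto simp: r_def)
  ultimately show ?thesis using that N by blast
qed

text \<open>
  Since \<open>t \<le> e + t\<^sup>2 / e\<close> and the torus has finite volume, rapid decay of the increments in mean
  square gives summable increments in the mean, and then absolute convergence of the telescoping
  series almost everywhere.
\<close>

lemma AE_convergent_of_fast_L2_Cauchy:
  fixes f :: "nat \<Rightarrow> form"
  assumes f: "\<And>k. square_integrable (f k)"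
    and fast: "\<And>k. (\<integral>x. (norm (f (Suc k) x - f k x))\<^sup>2 \<partial>torus_measure) \<le> ((1/2)^k)\<^sup>2"
  shows "AE x in torus_measure. convergent (\<lambda>k. f k x)"
proof -
  have [measurable]: "f k \<in> borel_measurable torus_measure" for k
    using f by (simp add: square_integrable_def)
  define g where "g k x = norm (f (Suc k) x - f k x)" for k x
  have [measurable]: "g k \<in> borel_measurable torus_measure" for k
    unfolding g_def by measurable
  define V where "V = (2 * pi)\<^sup>2"
  \<comment> \<open>The choice \<open>e = (1/2)^k\<close> balances the two terms of \<open>e + t\<^sup>2 / e\<close>.\<close>
  have le: "(\<integral>\<^sup>+x. ennreal (g k x) \<partial>torus_measure) \<le> ennreal ((V + 1) * (1/2)^k)" for k
  proof -
    let ?e = "(1/2::real)^k"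
    have int: "integrable torus_measure (\<lambda>x. ?e + (g k x)\<^sup>2 / ?e)"
      using square_integrable_diff[OF f[of "Suc k"] f[of k]]
      unfolding square_integrable_def g_def by (intro Bochner_Integration.integrable_add) auto
    have "t \<le> ?e + t\<^sup>2 / ?e" if "t \<ge> 0" for t :: real
    proof (cases "t \<le> ?e")
      case False
      then have "t * ?e \<le> t * t" using that by (intro mult_left_mono) auto
      then have "t \<le> t\<^sup>2 / ?e" by (simp add: field_simps power2_eq_square)
      then show ?thesis by (simp add: add_increasing)
    qed (simp add: add_increasing2)
    then have "(\<integral>\<^sup>+x. ennreal (g k x) \<partial>torus_measure) \<le> (\<integral>\<^sup>+x. ennreal (?e + (g k x)\<^sup>2 / ?e) \<partial>torus_measure)"
      by (intro nn_integral_mono ennreal_leI) (auto simp: g_def)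
    also have "\<dots> = ennreal (\<integral>x. ?e + (g k x)\<^sup>2 / ?e \<partial>torus_measure)"
      by (rule nn_integral_eq_integral[OF int]) (auto intro!: AE_I2 add_nonneg_nonneg)
    also have "(\<integral>x. ?e + (g k x)\<^sup>2 / ?e \<partial>torus_measure) = ?e * V + (\<integral>x. (g k x)\<^sup>2 \<partial>torus_measure) / ?e"
      using square_integrable_diff[OF f[of "Suc k"] f[of k]]
      unfolding square_integrable_def g_def V_def
      by (subst Bochner_Integration.integral_add) (auto simp: measure_torus)
    also have "\<dots> \<le> ?e * V + ?e\<^sup>2 / ?e"
      unfolding g_def by (intro add_left_mono divide_right_mono fast) auto
    also have "\<dots> = (V + 1) * ?e" by (simp add: power2_eq_square algebra_simps)
    finally show ?thesis by (simp add: ennreal_leI)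
  qed
  have "(\<integral>\<^sup>+x. (\<Sum>k. ennreal (g k x)) \<partial>torus_measure) = (\<Sum>k. \<integral>\<^sup>+x. ennreal (g k x) \<partial>torus_measure)"
    by (rule nn_integral_suminf) measurable
  also have "\<dots> \<le> (\<Sum>k. ennreal ((V + 1) * (1/2)^k))"
    by (intro suminf_le le) auto
  also have "\<dots> = ennreal (\<Sum>k. (V + 1) * (1/2)^k)"
    by (rule suminf_ennreal2) (auto simp: V_def intro!: summable_mult summable_geometric)
  also have "\<dots> < \<infinity>" by simp
  finally have "AE x in torus_measure. (\<Sum>k. ennreal (g k x)) \<noteq> \<infinity>"
    by (intro nn_integral_PInf_AE) auto
  then show ?thesis
  proof (rule AE_mp, intro AE_I2 impI)
    fix x assume "(\<Sum>k. ennreal (g k x)) \<noteq> \<infinity>"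
    then have "summable (\<lambda>k. g k x)"
      by (intro summable_suminf_not_top) (auto simp: g_def)
    then have "summable (\<lambda>k. f (Suc k) x - f k x)"
      unfolding g_def by (rule summable_norm_cancel)
    then have "convergent (\<lambda>n. \<Sum>k<n. f (Suc k) x - f k x)"
      by (simp add: summable_iff_convergent)
    then have "convergent (\<lambda>n. f n x - f 0 x)" using sum_lessThan_telescope[of "\<lambda>k. f k x"] by simp
    then have "convergent (\<lambda>n. (f n x - f 0 x) + f 0 x)"
      by (rule convergent_add) (rule convergent_const)
    then show "convergent (\<lambda>k. f k x)" by simp
  qed
qed

lemma l2_Fatou:
  fixes f :: "nat \<Rightarrow> form"
  assumes f: "\<And>k. square_integrable (f k)" and g: "square_integrable g"
    and F: "F \<in> borel_measurable torus_measure" "AE x in torus_measure. (\<lambda>k. f k x) \<longlonglongrightarrow> F x"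
    and bound: "\<forall>\<^sub>F k in sequentially. (\<integral>x. (norm (g x - f k x))\<^sup>2 \<partial>torus_measure) \<le> C"
  shows "square_integrable F" "(\<integral>x. (norm (g x - F x))\<^sup>2 \<partial>torus_measure) \<le> C"
proof -
  note [measurable] = F(1) f[unfolded square_integrable_def, THEN conjunct1]
    g[unfolded square_integrable_def, THEN conjunct1]
  obtain k0 where "(\<integral>x. (norm (g x - f k0 x))\<^sup>2 \<partial>torus_measure) \<le> C"
    using eventually_happens[OF bound] by auto
  then have C0: "C \<ge> 0" by (rule order_trans[rotated]) auto
  have "(\<integral>\<^sup>+x. ennreal ((norm (g x - F x))\<^sup>2) \<partial>torus_measure)
      = (\<integral>\<^sup>+x. liminf (\<lambda>k. ennreal ((norm (g x - f k x))\<^sup>2)) \<partial>torus_measure)"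
  proof (rule nn_integral_cong_AE, rule AE_mp[OF F(2)], intro AE_I2 impI)
    fix x assume "(\<lambda>k. f k x) \<longlonglongrightarrow> F x"
    then have "(\<lambda>k. ennreal ((norm (g x - f k x))\<^sup>2)) \<longlonglongrightarrow> ennreal ((norm (g x - F x))\<^sup>2)"
      by (intro tendsto_intros)
    then show "ennreal ((norm (g x - F x))\<^sup>2) = liminf (\<lambda>k. ennreal ((norm (g x - f k x))\<^sup>2))"
      by (rule lim_imp_Liminf[symmetric, rotated]) simp
  qed
  also have "\<dots> \<le> liminf (\<lambda>k. \<integral>\<^sup>+x. ennreal ((norm (g x - f k x))\<^sup>2) \<partial>torus_measure)"
    by (rule nn_integral_liminf) measurable
  also have "\<dots> \<le> limsup (\<lambda>k. \<integral>\<^sup>+x. ennreal ((norm (g x - f k x))\<^sup>2) \<partial>torus_measure)"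
    by (rule Liminf_le_Limsup) simp
  also have "\<dots> \<le> ennreal C"
  proof (rule Limsup_bounded, rule eventually_mono[OF bound])
    fix k assume "(\<integral>x. (norm (g x - f k x))\<^sup>2 \<partial>torus_measure) \<le> C"
    moreover have "integrable torus_measure (\<lambda>x. (norm (g x - f k x))\<^sup>2)"
      using square_integrable_diff[OF g f[of k]] by (simp add: square_integrable_def)
    ultimately show "(\<integral>\<^sup>+x. ennreal ((norm (g x - f k x))\<^sup>2) \<partial>torus_measure) \<le> ennreal C"
      by (subst nn_integral_eq_integral) (auto intro: ennreal_leI)
  qed
  finally have le: "(\<integral>\<^sup>+x. ennreal ((norm (g x - F x))\<^sup>2) \<partial>torus_measure) \<le> ennreal C" .
  have int: "integrable torus_measure (\<lambda>x. (norm (g x - F x))\<^sup>2)"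
    by (rule integrableI_bounded) (use le in \<open>auto intro: le_less_trans\<close>)
  then have "square_integrable (\<lambda>x. g x - F x)"
    by (simp add: square_integrable_def)
  from square_integrable_diff[OF g this] show "square_integrable F" by simp
  show "(\<integral>x. (norm (g x - F x))\<^sup>2 \<partial>torus_measure) \<le> C"
    using le C0 by (subst (asm) nn_integral_eq_integral[OF int]) auto
qed

text \<open>
  Riesz--Fischer: a rapidly Cauchy subsequence converges almost everywhere, and Fatou's lemma
  turns this into convergence in the mean.
\<close>

instance l2_form :: complete_space
proof
  fix X :: "nat \<Rightarrow> l2_form"
  assume X: "Cauchy X"
  obtain r where r: "strict_mono r" "\<And>k. dist (X (r (Suc k))) (X (r k)) < (1/2)^k"
    using Cauchy_fast_subseq[OF X] by blast
  have "\<exists>f. square_integrable f \<and> X (r k) = abs_l2_form f" for k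
    using l2_form_cases by metis
  then obtain f where f: "\<And>k. square_integrable (f k)" "\<And>k. X (r k) = abs_l2_form (f k)"
    by metis
  have dist: "2 * (\<integral>x. (norm (f m x - f n x))\<^sup>2 \<partial>torus_measure) = (dist (X (r m)) (X (r n)))\<^sup>2" for m n
    by (simp add: f dist_norm abs_l2_form_diff norm_abs_l2_form square_integrable_diff)
  have "AE x in torus_measure. convergent (\<lambda>k. f k x)"
  proof (rule AE_convergent_of_fast_L2_Cauchy[OF f(1)])
    fix k
    have "(dist (X (r (Suc k))) (X (r k)))\<^sup>2 \<le> ((1/2)^k)\<^sup>2"
      by (rule power_mono[OF less_imp_le[OF r(2)]]) simp
    moreover have "(\<integral>x. (norm (f (Suc k) x - f k x))\<^sup>2 \<partial>torus_measure) \<ge> 0" by simp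
    ultimately show "(\<integral>x. (norm (f (Suc k) x - f k x))\<^sup>2 \<partial>torus_measure) \<le> ((1/2)^k)\<^sup>2"
      using dist[of "Suc k" k] by linarith
  qed
  define F where "F x = lim (\<lambda>k. f k x)" for x
  have F: "F \<in> borel_measurable torus_measure"
    unfolding F_def by (rule borel_measurable_lim_metric) (use f in \<open>simp add: square_integrable_def\<close>)
  have lim: "AE x in torus_measure. (\<lambda>k. f k x) \<longlonglongrightarrow> F x"
    using \<open>AE x in torus_measure. convergent (\<lambda>k. f k x)\<close>
    by (rule AE_mp) (auto simp: F_def convergent_LIMSEQ_iff intro!: AE_I2)
  have XrC: "Cauchy (X \<circ> r)" using X r(1) by (rule Cauchy_subseq_Cauchy)
  have main: "\<exists>N. \<forall>n\<ge>N. square_integrable F \<and> (\<integral>x. (norm (f n x - F x))\<^sup>2 \<partial>torus_measure) \<le> e\<^sup>2 / 2"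
    if e: "e > 0" for e :: real
  proof -
    obtain N where N: "\<And>m n. m \<ge> N \<Longrightarrow> n \<ge> N \<Longrightarrow> dist (X (r m)) (X (r n)) < e"
      using metric_CauchyD[OF XrC e] by auto
    have "square_integrable F \<and> (\<integral>x. (norm (f n x - F x))\<^sup>2 \<partial>torus_measure) \<le> e\<^sup>2 / 2" if "n \<ge> N" for n
    proof -
      have "\<forall>\<^sub>F k in sequentially. (\<integral>x. (norm (f n x - f k x))\<^sup>2 \<partial>torus_measure) \<le> e\<^sup>2 / 2"
      proof (rule eventually_sequentiallyI[of N])
        fix k assume "N \<le> k"
        then have "(dist (X (r n)) (X (r k)))\<^sup>2 \<le> e\<^sup>2"
          using N[OF that] by (intro power_mono) (auto intro: less_imp_le)
        then show "(\<integral>x. (norm (f n x - f k x))\<^sup>2 \<partial>torus_measure) \<le> e\<^sup>2 / 2"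
          using dist[of n k] by linarith
      qed
      from l2_Fatou[OF f(1) f(1) F lim this] show ?thesis by blast
    qed
    then show ?thesis by blast
  qed
  have sqF: "square_integrable F" using main[of 1] by auto
  have "(X \<circ> r) \<longlonglongrightarrow> abs_l2_form F"
  proof (rule metric_LIMSEQ_I)
    fix e :: real assume e: "e > 0"
    obtain N where N: "\<And>n. n \<ge> N \<Longrightarrow> (\<integral>x. (norm (f n x - F x))\<^sup>2 \<partial>torus_measure) \<le> (e/2)\<^sup>2 / 2"
      using main[of "e/2"] e by auto
    have "dist ((X \<circ> r) n) (abs_l2_form F) < e" if "n \<ge> N" for n
    proof -
      have "(norm (X (r n) - abs_l2_form F))\<^sup>2 \<le> (e/2)\<^sup>2"
        using N[OF that]
        by (simp add: f abs_l2_form_diff norm_abs_l2_form square_integrable_diff sqF)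
      then have "norm (X (r n) - abs_l2_form F) \<le> e/2"
        by (rule power2_le_imp_le) (use e in simp)
      then show ?thesis using e by (simp add: dist_norm)
    qed
    then show "\<exists>N. \<forall>n\<ge>N. dist ((X \<circ> r) n) (abs_l2_form F) < e" by blast
  qed
  then have "X \<longlonglongrightarrow> abs_l2_form F"
    using Cauchy_converges_subseq[OF X r(1)] by blast
  then show "convergent X" by (auto simp: convergent_def)
qed

instance l2_form :: banach ..


section \<open>Calculus on the torus\<close>

lemma torus_iff: "x \<in> torus \<longleftrightarrow> norm (fst x) = 1 \<and> norm (snd x) = 1"
  by (cases x) (auto simp: torus_def)

lemma rotation_in_torus [simp]:
  "x \<in> torus \<Longrightarrow> (cis t * fst x, snd x) \<in> torus" "x \<in> torus \<Longrightarrow> (fst x, cis t * snd x) \<in> torus"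
  by (auto simp: torus_iff norm_mult)

abbreviation C1_torus :: "(pt \<Rightarrow> 'b::real_normed_vector) \<Rightarrow> bool" where
  "C1_torus \<equiv> Ck_torus (Suc 0)"

lemma smooth_torus_C1: "smooth_torus f \<Longrightarrow> C1_torus f"
  unfolding smooth_torus_def by blast

lemma C1_continuous: "C1_torus f \<Longrightarrow> continuous_on torus f"
  by simp

lemma C1_has_pd:
  assumes "C1_torus f" "x \<in> torus"
  shows "((\<lambda>t. f (cis t * fst x, snd x)) has_vector_derivative pd_m f x) (at 0)"
    and "((\<lambda>t. f (fst x, cis t * snd x)) has_vector_derivative pd_l f x) (at 0)"
  using assms by (auto simp: pd_m_def pd_l_def vector_derivative_works[symmetric])

text \<open>
  The candidates \<open>f1\<close> and \<open>f2\<close> agree with the partial derivatives on the torus only, so continuity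
  has to be transferred along that agreement.
\<close>

lemma C1_torusI:
  assumes "continuous_on torus f" "continuous_on torus f1" "continuous_on torus f2"
    and m: "\<And>x. x \<in> torus \<Longrightarrow> ((\<lambda>t. f (cis t * fst x, snd x)) has_vector_derivative f1 x) (at 0)"
    and l: "\<And>x. x \<in> torus \<Longrightarrow> ((\<lambda>t. f (fst x, cis t * snd x)) has_vector_derivative f2 x) (at 0)"
  shows "C1_torus f" "\<And>x. x \<in> torus \<Longrightarrow> pd_m f x = f1 x" "\<And>x. x \<in> torus \<Longrightarrow> pd_l f x = f2 x"
proof -
  show *: "pd_m f x = f1 x" "pd_l f x = f2 x" if "x \<in> torus" for x
    using m[OF that] l[OF that] by (auto simp: pd_m_def pd_l_def intro: vector_derivative_at)
  have "continuous_on torus (pd_m f)" "continuous_on torus (pd_l f)"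
    using assms(2,3) * by (metis continuous_on_cong)+
  then show "C1_torus f"
    using assms(1) differentiableI_vector[OF m] differentiableI_vector[OF l] by simp
qed

lemma integral_torus:
  fixes g :: "pt \<Rightarrow> real"
  assumes "g \<in> borel_measurable torus_measure"
  shows "(\<integral>x. g x \<partial>torus_measure)
    = (\<integral>u. indicator torus_square u *\<^sub>R g (torus_param u) \<partial>lborel)"
    and "integrable torus_measure g \<longleftrightarrow>
      integrable lborel (\<lambda>u. indicator torus_square u *\<^sub>R g (torus_param u))"
proof -
  have g: "g \<in> borel_measurable (restrict_space borel torus)"
    using assms measurable_cong_sets[OF sets_torus_measure refl] by blast
  show "(\<integral>x. g x \<partial>torus_measure)
    = (\<integral>u. indicator torus_square u *\<^sub>R g (torus_param u) \<partial>lborel)"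
    unfolding torus_measure_alt
    by (subst integral_distr[OF measurable_torus_param g], subst integral_restrict_space) auto
  show "integrable torus_measure g \<longleftrightarrow>
      integrable lborel (\<lambda>u. indicator torus_square u *\<^sub>R g (torus_param u))"
    unfolding torus_measure_alt
    by (subst integrable_distr_eq[OF measurable_torus_param g], subst integrable_restrict_space) auto
qed

lemma integral_derivative_period:
  fixes F :: "real \<Rightarrow> real"
  assumes F: "\<And>x. (F has_real_derivative f x) (at x)" and f: "continuous_on {0..2*pi} f"
    and per: "F (2 * pi) = F 0"
  shows "(\<integral>x. indicator {0..2*pi} x * f x \<partial>lborel) = 0"
proof -
  have "(\<integral>x. indicator {0..2*pi} x *\<^sub>R f x \<partial>lborel) = F (2 * pi) - F 0"
  proof (rule integral_FTC_atLeastAtMost[OF _ _ f])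
    show "(F has_vector_derivative f x) (at x within {0..2*pi})" for x
      using F[of x] unfolding has_real_derivative_iff_has_vector_derivative
      by (rule has_vector_derivative_at_within)
  qed simp
  then show ?thesis using per by simp
qed

text \<open>
  Fubini reduces the integral to circles, on which the derivative of a periodic function has
  integral zero.
\<close>

lemma integral_pd:
  fixes f :: "pt \<Rightarrow> real"
  assumes f: "C1_torus f"
  shows "(\<integral>x. pd_m f x \<partial>torus_measure) = 0" "(\<integral>x. pd_l f x \<partial>torus_measure) = 0"
proof -
  have cont: "continuous_on torus (pd_m f)" "continuous_on torus (pd_l f)" using f by auto
  have mem: "(cis a, cis b) \<in> torus" for a b
    using torus_param_in_torus[of "(a, b)"] by (simp add: torus_param_def)
  have int: "integrable (lborel \<Otimes>\<^sub>M lborel) (\<lambda>u. indicator torus_square u *\<^sub>R g (torus_param u))"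
    if "continuous_on torus g" for g :: "pt \<Rightarrow> real"
    unfolding lborel_prod
    using integral_torus(2)[OF borel_measurable_torusI[OF that]] integrable_torusI[OF that] by simp
  have ind: "indicator torus_square (a, b) = (indicator {0..2*pi} a * indicator {0..2*pi} b :: real)" for a b
    by (auto simp: torus_square_def indicator_def)
  have cis2pi: "cis (2 * pi) = 1" by (simp add: complex_eq_iff)
  have 1: "(\<integral>a. indicator {0..2*pi} a * pd_m f (cis a, cis b) \<partial>lborel) = 0" for b
  proof (rule integral_derivative_period)
    show "((\<lambda>a. f (cis a, cis b)) has_real_derivative pd_m f (cis a, cis b)) (at a)" for a
      using C1_has_pd(1)[OF f mem[of a b]] DERIV_shift[of "\<lambda>a. f (cis a, cis b)" _ 0 a]
      by (simp add: has_real_derivative_iff_has_vector_derivative cis_mult)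
    show "continuous_on {0..2 * pi} (\<lambda>a. pd_m f (cis a, cis b))"
      by (rule continuous_on_compose2[OF cont(1)]) (use mem in \<open>auto intro!: continuous_intros\<close>)
  qed (use cis2pi in simp)
  have 2: "(\<integral>b. indicator {0..2*pi} b * pd_l f (cis a, cis b) \<partial>lborel) = 0" for a
  proof (rule integral_derivative_period)
    show "((\<lambda>b. f (cis a, cis b)) has_real_derivative pd_l f (cis a, cis b)) (at b)" for b
      using C1_has_pd(2)[OF f mem[of a b]] DERIV_shift[of "\<lambda>b. f (cis a, cis b)" _ 0 b]
      by (simp add: has_real_derivative_iff_has_vector_derivative cis_mult)
    show "continuous_on {0..2 * pi} (\<lambda>b. pd_l f (cis a, cis b))"
      by (rule continuous_on_compose2[OF cont(2)]) (use mem in \<open>auto intro!: continuous_intros\<close>)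
  qed (use cis2pi in simp)
  have "(\<integral>x. pd_m f x \<partial>torus_measure)
      = (\<integral>u. indicator torus_square u *\<^sub>R pd_m f (torus_param u) \<partial>(lborel \<Otimes>\<^sub>M lborel))"
    unfolding lborel_prod by (rule integral_torus(1)[OF borel_measurable_torusI[OF cont(1)]])
  also have "\<dots> = (\<integral>b. \<integral>a. indicator torus_square (a, b) *\<^sub>R pd_m f (torus_param (a, b)) \<partial>lborel \<partial>lborel)"
    by (subst lborel_pair.integral_snd) (use int[OF cont(1)] in \<open>simp_all add: case_prod_unfold\<close>)
  also have "\<dots> = (\<integral>b. indicator {0..2*pi} b * (\<integral>a. indicator {0..2*pi} a * pd_m f (cis a, cis b) \<partial>lborel) \<partial>lborel)"
  proof (rule Bochner_Integration.integral_cong[OF refl])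
    fix b :: real
    have "(\<integral>a. indicator torus_square (a, b) *\<^sub>R pd_m f (torus_param (a, b)) \<partial>lborel)
        = (\<integral>a. indicator {0..2*pi} b * (indicator {0..2*pi} a * pd_m f (cis a, cis b)) \<partial>lborel)"
      by (rule Bochner_Integration.integral_cong[OF refl]) (simp add: ind torus_param_def)
    then show "(\<integral>a. indicator torus_square (a, b) *\<^sub>R pd_m f (torus_param (a, b)) \<partial>lborel)
        = indicator {0..2*pi} b * (\<integral>a. indicator {0..2*pi} a * pd_m f (cis a, cis b) \<partial>lborel)"
      by simp
  qed
  finally show "(\<integral>x. pd_m f x \<partial>torus_measure) = 0" by (simp add: 1)
  have "(\<integral>x. pd_l f x \<partial>torus_measure)
      = (\<integral>u. indicator torus_square u *\<^sub>R pd_l f (torus_param u) \<partial>(lborel \<Otimes>\<^sub>M lborel))"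
    unfolding lborel_prod by (rule integral_torus(1)[OF borel_measurable_torusI[OF cont(2)]])
  also have "\<dots> = (\<integral>a. \<integral>b. indicator torus_square (a, b) *\<^sub>R pd_l f (torus_param (a, b)) \<partial>lborel \<partial>lborel)"
    by (subst lborel_pair.integral_fst'[OF int[OF cont(2)]]) simp
  also have "\<dots> = (\<integral>a. indicator {0..2*pi} a * (\<integral>b. indicator {0..2*pi} b * pd_l f (cis a, cis b) \<partial>lborel) \<partial>lborel)"
    by (simp add: ind torus_param_def mult.assoc)
  finally show "(\<integral>x. pd_l f x \<partial>torus_measure) = 0" by (simp add: 2)
qed

lemma C1_inner_linear:
  fixes f :: "pt \<Rightarrow> 'a::euclidean_space" and g :: "pt \<Rightarrow> 'b::euclidean_space"
  assumes A: "bounded_linear A" and f: "C1_torus f" and g: "C1_torus g"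
  shows "C1_torus (\<lambda>x. A (f x) \<bullet> g x)"
    and "x \<in> torus \<Longrightarrow> pd_m (\<lambda>x. A (f x) \<bullet> g x) x = A (f x) \<bullet> pd_m g x + A (pd_m f x) \<bullet> g x"
    and "x \<in> torus \<Longrightarrow> pd_l (\<lambda>x. A (f x) \<bullet> g x) x = A (f x) \<bullet> pd_l g x + A (pd_l f x) \<bullet> g x"
proof -
  note cont = bounded_linear.continuous_on[OF A]
  have c: "continuous_on torus f" "continuous_on torus g" "continuous_on torus (pd_m f)"
    "continuous_on torus (pd_l f)" "continuous_on torus (pd_m g)" "continuous_on torus (pd_l g)"
    using f g by auto
  have m: "((\<lambda>t. A (f (cis t * fst x, snd x)) \<bullet> g (cis t * fst x, snd x)) has_vector_derivative
      A (f x) \<bullet> pd_m g x + A (pd_m f x) \<bullet> g x) (at 0)" if "x \<in> torus" for x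
    using bounded_bilinear.has_vector_derivative[OF bounded_bilinear_inner
        bounded_linear.has_vector_derivative[OF A C1_has_pd(1)[OF f that]] C1_has_pd(1)[OF g that]]
    by simp
  have l: "((\<lambda>t. A (f (fst x, cis t * snd x)) \<bullet> g (fst x, cis t * snd x)) has_vector_derivative
      A (f x) \<bullet> pd_l g x + A (pd_l f x) \<bullet> g x) (at 0)" if "x \<in> torus" for x
    using bounded_bilinear.has_vector_derivative[OF bounded_bilinear_inner
        bounded_linear.has_vector_derivative[OF A C1_has_pd(2)[OF f that]] C1_has_pd(2)[OF g that]]
    by simp
  note I = C1_torusI[of "\<lambda>x. A (f x) \<bullet> g x" "\<lambda>x. A (f x) \<bullet> pd_m g x + A (pd_m f x) \<bullet> g x"
      "\<lambda>x. A (f x) \<bullet> pd_l g x + A (pd_l f x) \<bullet> g x", OF _ _ _ m l]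
  show "C1_torus (\<lambda>x. A (f x) \<bullet> g x)"
    by (rule I) (intro continuous_intros cont c | assumption)+
  show "x \<in> torus \<Longrightarrow> pd_m (\<lambda>x. A (f x) \<bullet> g x) x = A (f x) \<bullet> pd_m g x + A (pd_m f x) \<bullet> g x"
    by (rule I) (intro continuous_intros cont c | assumption)+
  show "x \<in> torus \<Longrightarrow> pd_l (\<lambda>x. A (f x) \<bullet> g x) x = A (f x) \<bullet> pd_l g x + A (pd_l f x) \<bullet> g x"
    by (rule I) (intro continuous_intros cont c | assumption)+
qed

lemma integration_by_parts:
  fixes f :: "pt \<Rightarrow> 'a::euclidean_space" and g :: "pt \<Rightarrow> 'b::euclidean_space"
  assumes A: "bounded_linear A" and f: "C1_torus f" and g: "C1_torus g"
  shows "(\<integral>x. A (pd_m f x) \<bullet> g x \<partial>torus_measure) = - (\<integral>x. A (f x) \<bullet> pd_m g x \<partial>torus_measure)"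
    and "(\<integral>x. A (pd_l f x) \<bullet> g x \<partial>torus_measure) = - (\<integral>x. A (f x) \<bullet> pd_l g x \<partial>torus_measure)"
proof -
  note cont = bounded_linear.continuous_on[OF A]
  have c: "continuous_on torus f" "continuous_on torus g" "continuous_on torus (pd_m f)"
    "continuous_on torus (pd_l f)" "continuous_on torus (pd_m g)" "continuous_on torus (pd_l g)"
    using f g by auto
  have "0 = (\<integral>x. A (f x) \<bullet> pd_m g x + A (pd_m f x) \<bullet> g x \<partial>torus_measure)"
    by (subst integral_pd(1)[OF C1_inner_linear(1)[OF A f g], symmetric])
      (rule Bochner_Integration.integral_cong[OF refl], use C1_inner_linear(2)[OF A f g] in simp)
  also have "\<dots> = (\<integral>x. A (f x) \<bullet> pd_m g x \<partial>torus_measure) + (\<integral>x. A (pd_m f x) \<bullet> g x \<partial>torus_measure)"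
    by (intro Bochner_Integration.integral_add integrable_torusI continuous_intros cont c)
  finally show "(\<integral>x. A (pd_m f x) \<bullet> g x \<partial>torus_measure) = - (\<integral>x. A (f x) \<bullet> pd_m g x \<partial>torus_measure)"
    by simp
  have "0 = (\<integral>x. A (f x) \<bullet> pd_l g x + A (pd_l f x) \<bullet> g x \<partial>torus_measure)"
    by (subst integral_pd(2)[OF C1_inner_linear(1)[OF A f g], symmetric])
      (rule Bochner_Integration.integral_cong[OF refl], use C1_inner_linear(3)[OF A f g] in simp)
  also have "\<dots> = (\<integral>x. A (f x) \<bullet> pd_l g x \<partial>torus_measure) + (\<integral>x. A (pd_l f x) \<bullet> g x \<partial>torus_measure)"
    by (intro Bochner_Integration.integral_add integrable_torusI continuous_intros cont c)
  finally show "(\<integral>x. A (pd_l f x) \<bullet> g x \<partial>torus_measure) = - (\<integral>x. A (f x) \<bullet> pd_l g x \<partial>torus_measure)"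
    by simp
qed

lemma pd_linear:
  assumes f: "C1_torus f" and x: "x \<in> torus" and A: "bounded_linear A"
  shows "pd_m (\<lambda>y. A (f y)) x = A (pd_m f x)" "pd_l (\<lambda>y. A (f y)) x = A (pd_l f x)"
  using bounded_linear.has_vector_derivative[OF A C1_has_pd(1)[OF f x]]
    bounded_linear.has_vector_derivative[OF A C1_has_pd(2)[OF f x]]
  by (auto simp: pd_m_def pd_l_def intro: vector_derivative_at)

lemma C1_torus_cong:
  assumes g: "C1_torus g" and eq: "\<And>x. x \<in> torus \<Longrightarrow> f x = g x"
  shows "C1_torus f" "\<And>x. x \<in> torus \<Longrightarrow> pd_m f x = pd_m g x" "\<And>x. x \<in> torus \<Longrightarrow> pd_l f x = pd_l g x"
proof -
  have c: "continuous_on torus f" using C1_continuous[OF g] eq by (simp cong: continuous_on_cong)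
  have d: "continuous_on torus (pd_m g)" "continuous_on torus (pd_l g)" using g by auto
  have m: "((\<lambda>t. f (cis t * fst x, snd x)) has_vector_derivative pd_m g x) (at 0)"
    and l: "((\<lambda>t. f (fst x, cis t * snd x)) has_vector_derivative pd_l g x) (at 0)" if "x \<in> torus" for x
    using C1_has_pd[OF g that] that by (simp_all add: eq)
  show "C1_torus f" "\<And>x. x \<in> torus \<Longrightarrow> pd_m f x = pd_m g x" "\<And>x. x \<in> torus \<Longrightarrow> pd_l f x = pd_l g x"
    by (rule C1_torusI[OF c d m l]; assumption)+
qed

lemma C1_torus_zero:
  assumes "\<And>x. x \<in> torus \<Longrightarrow> f x = 0"
  shows "C1_torus f" "\<And>x. x \<in> torus \<Longrightarrow> pd_m f x = 0" "\<And>x. x \<in> torus \<Longrightarrow> pd_l f x = 0"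
proof -
  have c: "continuous_on torus f" using assms by (simp cong: continuous_on_cong)
  have m: "((\<lambda>t. f (cis t * fst x, snd x)) has_vector_derivative 0) (at 0)"
    and l: "((\<lambda>t. f (fst x, cis t * snd x)) has_vector_derivative 0) (at 0)" if "x \<in> torus" for x
    using that by (simp_all add: assms)
  show "C1_torus f" "\<And>x. x \<in> torus \<Longrightarrow> pd_m f x = 0" "\<And>x. x \<in> torus \<Longrightarrow> pd_l f x = 0"
    by (rule C1_torusI[OF c continuous_on_const continuous_on_const m l]; assumption)+
qed

lemma C1_torus_linear_combination:
  assumes A: "bounded_linear A" and B: "bounded_linear B" and f: "C1_torus f" and g: "C1_torus g"
  shows "C1_torus (\<lambda>x. A (f x) + B (g x))"
proof -
  note cA = bounded_linear.continuous_on[OF A] and cB = bounded_linear.continuous_on[OF B]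
  have c: "continuous_on torus f" "continuous_on torus g" "continuous_on torus (pd_m f)"
    "continuous_on torus (pd_l f)" "continuous_on torus (pd_m g)" "continuous_on torus (pd_l g)"
    using f g by auto
  note L = has_vector_derivative_add[OF bounded_linear.has_vector_derivative[OF A] bounded_linear.has_vector_derivative[OF B]]
  show ?thesis
    by (rule C1_torusI(1)[where ?f1.0 = "\<lambda>x. A (pd_m f x) + B (pd_m g x)" and ?f2.0 = "\<lambda>x. A (pd_l f x) + B (pd_l g x)"])
      (intro continuous_intros cA cB c L C1_has_pd f g; assumption)+
qed

section \<open>The operators in matrix form\<close>

text \<open>
  Every operator in sight is a constant coefficient combination of the two partial derivatives
  of the \<open>fibre\<close>-valued function.  For \<open>S_op\<close> the matrices are antisymmetric, which
  is why \<open>S_op\<close> is symmetric.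
\<close>

definition S_mat_m :: "fibre \<Rightarrow> fibre" where
  "S_mat_m w = (case w of (\<alpha>, (u, v), \<gamma>) \<Rightarrow> (v, (- \<gamma>, - \<alpha>), u))"

definition S_mat_l :: "fibre \<Rightarrow> fibre" where
  "S_mat_l w = (case w of (\<alpha>, (u, v), \<gamma>) \<Rightarrow> (- u, (\<alpha>, - \<gamma>), v))"

definition d_mat_m :: "fibre \<Rightarrow> fibre" where
  "d_mat_m w = (case w of (\<alpha>, (u, v), \<gamma>) \<Rightarrow> (0, (\<alpha>, 0), v))"

definition d_mat_l :: "fibre \<Rightarrow> fibre" where
  "d_mat_l w = (case w of (\<alpha>, (u, v), \<gamma>) \<Rightarrow> (0, (0, \<alpha>), - u))"

definition d_adj_m :: "fibre \<Rightarrow> fibre" where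
  "d_adj_m w = (case w of (\<alpha>, (u, v), \<gamma>) \<Rightarrow> (u, (0, \<gamma>), 0))"

definition d_adj_l :: "fibre \<Rightarrow> fibre" where
  "d_adj_l w = (case w of (\<alpha>, (u, v), \<gamma>) \<Rightarrow> (v, (- \<gamma>, 0), 0))"

lemmas mat_defs = S_mat_m_def S_mat_l_def d_mat_m_def d_mat_l_def d_adj_m_def d_adj_l_def

definition ad_fibre :: "real \<Rightarrow> fibre \<Rightarrow> fibre" where
  "ad_fibre t w = (case w of (\<alpha>, (u, v), \<gamma>) \<Rightarrow>
     (bracket (t *\<^sub>R su2_i) \<alpha>, (bracket (t *\<^sub>R su2_i) u, bracket (t *\<^sub>R su2_i) v), bracket (t *\<^sub>R su2_i) \<gamma>))"

lemma bracket_su2_i: "bracket (t *\<^sub>R su2_i) w = (0, 2 * of_real t * \<i> * snd w)"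
  by (simp add: bracket_def im_part_def quat_mult_def quat_of_def su2_i_def)

lemma bracket_su2_i_antisym:
  "bracket (t *\<^sub>R su2_i) w \<bullet> w' = - (w \<bullet> bracket (t *\<^sub>R su2_i) w')"
  by (simp add: bracket_su2_i inner_prod_def inner_complex_def algebra_simps)

lemma linear_mats:
  "bounded_linear S_mat_m" "bounded_linear S_mat_l" "bounded_linear d_mat_m"
  "bounded_linear d_mat_l" "bounded_linear d_adj_m" "bounded_linear d_adj_l"
  by (rule linear_conv_bounded_linear[THEN iffD1], rule linearI,
      auto simp: mat_defs split: prod.splits)+

lemma linear_ad_fibre: "bounded_linear (ad_fibre t)"
  by (rule linear_conv_bounded_linear[THEN iffD1], rule linearI)
    (auto simp: ad_fibre_def bracket_su2_i algebra_simps split: prod.splits)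

lemma S_mat_antisym:
  "S_mat_m w \<bullet> w' = - (w \<bullet> S_mat_m w')" "S_mat_l w \<bullet> w' = - (w \<bullet> S_mat_l w')"
  by (auto simp: mat_defs inner_prod_def algebra_simps inner_commute split: prod.splits)

lemma d_mat_adjoint:
  "d_mat_m w \<bullet> w' = w \<bullet> d_adj_m w'" "d_mat_l w \<bullet> w' = w \<bullet> d_adj_l w'"
  by (auto simp: mat_defs inner_prod_def algebra_simps inner_commute split: prod.splits)

lemma ad_fibre_antisym: "ad_fibre t w \<bullet> w' = - (w \<bullet> ad_fibre t w')"
  by (auto simp: ad_fibre_def bracket_su2_i_antisym inner_Pair split: prod.splits)

lemma S_mat_ad_commute:
  "S_mat_m (ad_fibre t w) = ad_fibre t (S_mat_m w)" "S_mat_l (ad_fibre t w) = ad_fibre t (S_mat_l w)"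
  by (auto simp: mat_defs ad_fibre_def bracket_su2_i split: prod.splits)

lemma pd_components:
  assumes "C1_torus (\<omega> :: form)" "x \<in> torus"
  shows "pd_m (\<lambda>y. fst (\<omega> y)) x = fst (pd_m \<omega> x)"
    "pd_m (\<lambda>y. fst (fst (snd (\<omega> y)))) x = fst (fst (snd (pd_m \<omega> x)))"
    "pd_m (\<lambda>y. snd (fst (snd (\<omega> y)))) x = snd (fst (snd (pd_m \<omega> x)))"
    "pd_m (\<lambda>y. snd (snd (\<omega> y))) x = snd (snd (pd_m \<omega> x))"
    "pd_m (\<lambda>y. - snd (fst (snd (\<omega> y)))) x = - snd (fst (snd (pd_m \<omega> x)))"
    "pd_l (\<lambda>y. fst (\<omega> y)) x = fst (pd_l \<omega> x)"
    "pd_l (\<lambda>y. fst (fst (snd (\<omega> y)))) x = fst (fst (snd (pd_l \<omega> x)))"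
    "pd_l (\<lambda>y. snd (fst (snd (\<omega> y)))) x = snd (fst (snd (pd_l \<omega> x)))"
    "pd_l (\<lambda>y. snd (snd (\<omega> y))) x = snd (snd (pd_l \<omega> x))"
    "pd_l (\<lambda>y. - snd (fst (snd (\<omega> y)))) x = - snd (fst (snd (pd_l \<omega> x)))"
  by (rule pd_linear[OF assms], intro bounded_linear_minus bounded_linear_fst_comp
      bounded_linear_snd_comp bounded_linear_ident)+

lemma S_op_matrix:
  assumes "C1_torus \<omega>" "x \<in> torus"
  shows "S_op (conn p) \<omega> x = S_mat_m (pd_m \<omega> x + ad_fibre (- Re p) (\<omega> x))
    + S_mat_l (pd_l \<omega> x + ad_fibre (- Im p) (\<omega> x))"
  unfolding S_op_def Let_def cov_d1_def cov_d0_def ext_d1_def ext_d0_def star0_def star1_def star2_def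
    conn_def
  by (simp add: pd_components[OF assms] mat_defs ad_fibre_def bracket_su2_i split_beta prod_eq_iff
      del: scaleR_minus_left)

lemma ext_d_matrix:
  assumes "C1_torus \<omega>" "x \<in> torus"
  shows "ext_d \<omega> x = d_mat_m (pd_m \<omega> x) + d_mat_l (pd_l \<omega> x)"
  unfolding ext_d_def ext_d1_def ext_d0_def
  by (simp add: pd_components[OF assms] mat_defs split_beta prod_eq_iff)

lemma codiff_matrix:
  assumes "C1_torus \<omega>" "x \<in> torus"
  shows "codiff \<omega> x = - d_adj_m (pd_m \<omega> x) - d_adj_l (pd_l \<omega> x)"
  unfolding codiff_def ext_d_def ext_d1_def ext_d0_def hodge_def star0_def star1_def star2_def
  by (simp add: pd_components[OF assms] mat_defs split_beta prod_eq_iff)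

text \<open>
  Integration by parts moves both derivatives across; the zero order terms agree pointwise
  because the antisymmetric matrices commute with the antisymmetric bracket.
\<close>

lemma S_op_symmetric:
  assumes f: "C1_torus f" and g: "C1_torus g"
  shows "(\<integral>x. S_op (conn p) f x \<bullet> g x \<partial>torus_measure) = (\<integral>x. f x \<bullet> S_op (conn p) g x \<partial>torus_measure)"
proof -
  note lin = linear_mats(1,2) linear_ad_fibre
  note cont = lin[THEN bounded_linear.continuous_on]
  have c: "continuous_on torus f" "continuous_on torus g" "continuous_on torus (pd_m f)"
    "continuous_on torus (pd_l f)" "continuous_on torus (pd_m g)" "continuous_on torus (pd_l g)"
    using f g by auto
  note add = lin[THEN bounded_linear.linear, THEN linear_add]
  define Z where "Z w = S_mat_m (ad_fibre (- Re p) w) + S_mat_l (ad_fibre (- Im p) w)" for w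
  have Zc: "continuous_on torus (\<lambda>x. Z (h x))" if "continuous_on torus h" for h
    unfolding Z_def by (intro continuous_intros cont that)
  have Zsym: "Z w \<bullet> w' = w \<bullet> Z w'" for w w'
    by (simp add: Z_def inner_add_left inner_add_right S_mat_antisym ad_fibre_antisym S_mat_ad_commute)
  have ibp: "(\<integral>x. S_mat_m (pd_m f x) \<bullet> g x \<partial>torus_measure) = (\<integral>x. f x \<bullet> S_mat_m (pd_m g x) \<partial>torus_measure)"
     "(\<integral>x. S_mat_l (pd_l f x) \<bullet> g x \<partial>torus_measure) = (\<integral>x. f x \<bullet> S_mat_l (pd_l g x) \<partial>torus_measure)"
    using integration_by_parts(1)[OF lin(1) f g] integration_by_parts(2)[OF lin(2) f g]
    by (simp_all add: S_mat_antisym)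
  have int: "integrable torus_measure (\<lambda>x. S_mat_m (pd_m f x) \<bullet> g x)"
    "integrable torus_measure (\<lambda>x. S_mat_l (pd_l f x) \<bullet> g x)"
    "integrable torus_measure (\<lambda>x. Z (f x) \<bullet> g x)"
    "integrable torus_measure (\<lambda>x. f x \<bullet> S_mat_m (pd_m g x))"
    "integrable torus_measure (\<lambda>x. f x \<bullet> S_mat_l (pd_l g x))"
    "integrable torus_measure (\<lambda>x. f x \<bullet> Z (g x))"
    by (intro integrable_torusI continuous_intros cont c Zc)+
  have "(\<integral>x. S_op (conn p) f x \<bullet> g x \<partial>torus_measure)
      = (\<integral>x. (S_mat_m (pd_m f x) \<bullet> g x + S_mat_l (pd_l f x) \<bullet> g x) + Z (f x) \<bullet> g x \<partial>torus_measure)"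
    by (rule Bochner_Integration.integral_cong[OF refl])
      (simp add: S_op_matrix[OF f] add Z_def inner_add_left)
  also have "\<dots> = (\<integral>x. S_mat_m (pd_m f x) \<bullet> g x \<partial>torus_measure)
      + (\<integral>x. S_mat_l (pd_l f x) \<bullet> g x \<partial>torus_measure) + (\<integral>x. Z (f x) \<bullet> g x \<partial>torus_measure)"
    by (simp add: int)
  also have "\<dots> = (\<integral>x. f x \<bullet> S_mat_m (pd_m g x) \<partial>torus_measure)
      + (\<integral>x. f x \<bullet> S_mat_l (pd_l g x) \<partial>torus_measure) + (\<integral>x. f x \<bullet> Z (g x) \<partial>torus_measure)"
    by (simp add: ibp Zsym)
  also have "\<dots> = (\<integral>x. (f x \<bullet> S_mat_m (pd_m g x) + f x \<bullet> S_mat_l (pd_l g x)) + f x \<bullet> Z (g x) \<partial>torus_measure)"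
    by (simp add: int)
  also have "\<dots> = (\<integral>x. f x \<bullet> S_op (conn p) g x \<partial>torus_measure)"
    by (rule Bochner_Integration.integral_cong[OF refl])
      (simp add: S_op_matrix[OF g] add Z_def inner_add_right)
  finally show ?thesis .
qed

lemma ext_d_codiff_adjoint:
  assumes f: "C1_torus f" and g: "C1_torus g"
  shows "(\<integral>x. ext_d f x \<bullet> g x \<partial>torus_measure) = (\<integral>x. f x \<bullet> codiff g x \<partial>torus_measure)"
proof -
  note lin = linear_mats(3-6)
  note cont = lin[THEN bounded_linear.continuous_on]
  have c: "continuous_on torus f" "continuous_on torus g" "continuous_on torus (pd_m f)"
    "continuous_on torus (pd_l f)" "continuous_on torus (pd_m g)" "continuous_on torus (pd_l g)"
    using f g by auto
  have "(\<integral>x. ext_d f x \<bullet> g x \<partial>torus_measure)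
      = (\<integral>x. d_mat_m (pd_m f x) \<bullet> g x + d_mat_l (pd_l f x) \<bullet> g x \<partial>torus_measure)"
    by (rule Bochner_Integration.integral_cong[OF refl]) (simp add: ext_d_matrix[OF f] inner_add_left)
  also have "\<dots> = (\<integral>x. d_mat_m (pd_m f x) \<bullet> g x \<partial>torus_measure) + (\<integral>x. d_mat_l (pd_l f x) \<bullet> g x \<partial>torus_measure)"
    by (intro Bochner_Integration.integral_add integrable_torusI continuous_intros cont c)
  also have "\<dots> = (\<integral>x. - (f x \<bullet> d_adj_m (pd_m g x)) \<partial>torus_measure) + (\<integral>x. - (f x \<bullet> d_adj_l (pd_l g x)) \<partial>torus_measure)"
    using integration_by_parts(1)[OF lin(1) f g] integration_by_parts(2)[OF lin(2) f g]
    by (simp add: d_mat_adjoint)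
  also have "\<dots> = (\<integral>x. - (f x \<bullet> d_adj_m (pd_m g x)) + - (f x \<bullet> d_adj_l (pd_l g x)) \<partial>torus_measure)"
    by (intro Bochner_Integration.integral_add[symmetric] integrable_torusI continuous_intros cont c)
  also have "\<dots> = (\<integral>x. f x \<bullet> codiff g x \<partial>torus_measure)"
    by (rule Bochner_Integration.integral_cong[OF refl]) (simp add: codiff_matrix[OF g] inner_diff_right)
  finally show ?thesis .
qed


section \<open>Fourier modes and the symbol of the operator\<close>

type_synonym cfibre = "complex \<times> (complex \<times> complex) \<times> complex"

definition cscale :: "complex \<Rightarrow> cfibre \<Rightarrow> cfibre" where
  "cscale c v = (case v of (\<alpha>, (u, w), \<gamma>) \<Rightarrow> (c * \<alpha>, (c * u, c * w), c * \<gamma>))"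

text \<open>
  One family of modes serves both parts of the Lie algebra: a complex amplitude enters \<open>Cj\<close>
  unchanged and \<open>Ri\<close> through its real part.  In the latter case the frequencies \<open>k\<close> and \<open>- k\<close> give the
  same forms, so diagonal modes are never used as independent vectors.
\<close>

definition slot :: "bool \<Rightarrow> complex \<Rightarrow> su2" where
  "slot b z = (if b then (0, z) else (Re z, 0))"

definition slot_fibre :: "bool \<Rightarrow> cfibre \<Rightarrow> fibre" where
  "slot_fibre b v = (case v of (\<alpha>, (u, w), \<gamma>) \<Rightarrow> (slot b \<alpha>, (slot b u, slot b w), slot b \<gamma>))"

definition wave :: "int \<times> int \<Rightarrow> pt \<Rightarrow> complex" where
  "wave k x = (fst x) powi (fst k) * (snd x) powi (snd k)"

definition mode :: "bool \<Rightarrow> int \<times> int \<Rightarrow> cfibre \<Rightarrow> form" where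
  "mode b k v x = slot_fibre b (cscale (wave k x) v)"

definition mode_l2 :: "bool \<Rightarrow> int \<times> int \<Rightarrow> cfibre \<Rightarrow> l2_form" where
  "mode_l2 b k v = abs_l2_form (mode b k v)"

definition lattice_pt :: "int \<times> int \<Rightarrow> complex" where
  "lattice_pt k = Complex (of_int (fst k)) (of_int (snd k))"

text \<open>
  The bracket with the diagonal connection is multiplication by \<open>2 \<i> t\<close> on \<open>Cj\<close> and zero on \<open>Ri\<close>,
  which shifts the frequencies of the off-diagonal part only.
\<close>

definition freq :: "bool \<Rightarrow> complex \<Rightarrow> int \<times> int \<Rightarrow> complex" where
  "freq b p k = lattice_pt k - (if b then 2 * p else 0)"

text \<open>
  The operator with the two covariant derivatives replaced by multiplication with \<open>\<i> Re \<xi>\<close> and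
  \<open>\<i> Im \<xi>\<close>.
\<close>

definition symb :: "complex \<Rightarrow> cfibre \<Rightarrow> cfibre" where
  "symb \<xi> v = (case v of (\<alpha>, (u, w), \<gamma>) \<Rightarrow>
     (let x = \<i> * of_real (Re \<xi>); y = \<i> * of_real (Im \<xi>)
      in (x * w - y * u, (y * \<alpha> - x * \<gamma>, - x * \<alpha> - y * \<gamma>), x * u + y * w)))"

definition J_cfibre :: "cfibre \<Rightarrow> cfibre" where
  "J_cfibre v = (case v of (\<alpha>, (u, w), \<gamma>) \<Rightarrow> (- \<gamma>, (- w, u), \<alpha>))"

definition sgn_of :: "sign \<Rightarrow> real" where
  "sgn_of s = (case s of Plus \<Rightarrow> 1 | Minus \<Rightarrow> - 1)"

definition flip :: "sign \<Rightarrow> sign" where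
  "flip s = (case s of Plus \<Rightarrow> Minus | Minus \<Rightarrow> Plus)"

text \<open>
  For \<open>norm d = 1\<close> this is the orthogonal projection onto the eigenspace of the involution
  \<open>symb d\<close> with eigenvalue \<open>sgn_of s\<close>.
\<close>

definition pol :: "sign \<Rightarrow> complex \<Rightarrow> cfibre \<Rightarrow> cfibre" where
  "pol s d v = (1/2) *\<^sub>R (v + sgn_of s *\<^sub>R symb d v)"

lemmas cf_defs = cscale_def symb_def J_cfibre_def Let_def split_beta prod_eq_iff

lemma linear_symb: "linear (symb d)"
  by (rule linearI) (auto simp: cf_defs complex_eq_iff algebra_simps)

lemma linear_cscale: "linear (cscale c)"
  by (rule linearI) (auto simp: cf_defs complex_eq_iff algebra_simps)

lemma linear_pol: "linear (pol s d)"
  by (rule linearI) (auto simp: pol_def linear_add[OF linear_symb] linear_scale[OF linear_symb] algebra_simps)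

lemma symb_diff: "symb c v - symb d v = symb (c - d) v"
  by (auto simp: cf_defs complex_eq_iff algebra_simps)

lemma symb_scaleR: "symb (of_real r * d) v = r *\<^sub>R symb d v"
  by (auto simp: cf_defs complex_eq_iff algebra_simps)

lemma symb_squared: "symb d (symb d v) = (norm d)\<^sup>2 *\<^sub>R v"
  unfolding cmod_power2
  by (auto simp: cf_defs complex_eq_iff algebra_simps power2_eq_square)

lemma symb_symmetric: "symb d v \<bullet> w = v \<bullet> symb d w"
  by (auto simp: cf_defs inner_prod_def inner_complex_def algebra_simps)

lemma norm_symb: "norm (symb d v) = norm d * norm v"
proof -
  have "(norm (symb d v))\<^sup>2 = (norm d * norm v)\<^sup>2"
    by (simp add: power2_norm_eq_inner symb_symmetric[of d v] symb_squared power_mult_distrib)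
  then show ?thesis by (simp add: power2_eq_iff_nonneg)
qed

lemma J_symb: "J_cfibre (symb d v) = - symb d (J_cfibre v)"
  by (auto simp: cf_defs complex_eq_iff algebra_simps)

lemma J_J_cfibre: "J_cfibre (J_cfibre v) = - v"
  by (auto simp: cf_defs)

lemma linear_J_cfibre: "linear J_cfibre"
  by (rule linearI) (auto simp: cf_defs)

lemma sgn_of_simps [simp]:
  "sgn_of s * sgn_of s = 1" "sgn_of (flip s) = - sgn_of s" "\<bar>sgn_of s\<bar> = 1" "flip (flip s) = s"
  by (cases s; simp add: sgn_of_def flip_def)+

lemma has_sign_sgn_of: "r > 0 \<Longrightarrow> has_sign s (sgn_of s * r)" "r > 0 \<Longrightarrow> \<not> has_sign s (- (sgn_of s * r))"
  "\<not> has_sign s 0"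
  by (cases s; simp add: sgn_of_def)+

lemma pol_flip_add: "pol s d v + pol (flip s) d v = v"
  by (simp add: pol_def scaleR_add_right[symmetric])

lemma symb_pol:
  assumes "norm d = 1"
  shows "symb d (pol s d v) = sgn_of s *\<^sub>R pol s d v"
  using assms
  by (simp add: pol_def linear_add[OF linear_symb] linear_scale[OF linear_symb] symb_squared
      scaleR_add_right mult.commute)

lemma J_pol: "J_cfibre (pol s d v) = pol (flip s) d (J_cfibre v)"
  by (simp add: pol_def linear_add[OF linear_J_cfibre] linear_scale[OF linear_J_cfibre] J_symb)

lemma pol_orthogonal:
  assumes "norm d = 1"
  shows "pol s d v \<bullet> pol (flip s) d w = 0"
proof -
  have "sgn_of s * (pol s d v \<bullet> pol (flip s) d w) = - (sgn_of s * (pol s d v \<bullet> pol (flip s) d w))"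
    using symb_symmetric[of d "pol s d v" "pol (flip s) d w"] by (simp add: symb_pol[OF assms])
  moreover have "sgn_of s \<noteq> 0" by (cases s) (auto simp: sgn_of_def)
  ultimately show ?thesis by simp
qed

lemma norm_pol_diff: "norm (pol s c v - pol s d v) = norm (c - d) * norm v / 2"
proof -
  have "pol s c v - pol s d v = (sgn_of s / 2) *\<^sub>R symb (c - d) v"
    by (simp add: pol_def symb_diff[symmetric] algebra_simps)
  then show ?thesis by (simp add: norm_symb)
qed

lemma linear_slot_fibre: "linear (slot_fibre b)"
  by (rule linearI) (auto simp: slot_fibre_def slot_def split_beta)

lemma linear_mode: "linear (\<lambda>v. mode b k v x)"
  unfolding mode_def
  by (intro linear_compose[OF linear_cscale linear_slot_fibre, unfolded comp_def])

lemma J_mode: "J_fibre (mode b k v x) = mode b k (J_cfibre v) x"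
  by (auto simp: mode_def slot_fibre_def slot_def cf_defs J_fibre_def star0_def star1_def star2_def
      split: prod.splits)

text \<open>Differentiating a mode multiplies its amplitude by the corresponding imaginary frequency.\<close>

lemma wave_derivative:
  "((\<lambda>t. wave k (cis t * fst x, snd x)) has_vector_derivative \<i> * of_int (fst k) * wave k x) (at 0)"
  "((\<lambda>t. wave k (fst x, cis t * snd x)) has_vector_derivative \<i> * of_int (snd k) * wave k x) (at 0)"
proof -
  have cis: "((\<lambda>t. cis (of_int n * t)) has_vector_derivative \<i> * of_int n) (at 0)" for n
    unfolding has_vector_derivative_def
    by (rule has_derivative_eq_rhs, rule has_derivative_cis, rule has_derivative_mult_right,
        rule has_derivative_ident) (auto simp: scaleR_conv_of_real)
  note m = has_vector_derivative_mult_left[OF cis]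
  show "((\<lambda>t. wave k (cis t * fst x, snd x)) has_vector_derivative \<i> * of_int (fst k) * wave k x) (at 0)"
    using m[of "fst k" "wave k x"]
    by (simp add: wave_def power_int_mult_distrib cis_power_int mult.assoc)
  show "((\<lambda>t. wave k (fst x, cis t * snd x)) has_vector_derivative \<i> * of_int (snd k) * wave k x) (at 0)"
    using m[of "snd k" "wave k x"]
    by (simp add: wave_def power_int_mult_distrib cis_power_int mult.assoc mult.left_commute)
qed

lemma bounded_linear_cscale_slot: "bounded_linear (\<lambda>z. slot_fibre b (cscale z v))"
  by (rule linear_conv_bounded_linear[THEN iffD1], rule linearI)
    (auto simp: slot_fibre_def slot_def cscale_def split_beta algebra_simps)

lemma cscale_cscale: "cscale c (cscale d v) = cscale (c * d) v"
  by (auto simp: cscale_def split: prod.splits)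

lemma mode_derivative:
  "((\<lambda>t. mode b k v (cis t * fst x, snd x)) has_vector_derivative
      mode b k (cscale (\<i> * of_int (fst k)) v) x) (at 0)"
  "((\<lambda>t. mode b k v (fst x, cis t * snd x)) has_vector_derivative
      mode b k (cscale (\<i> * of_int (snd k)) v) x) (at 0)"
  using bounded_linear.has_vector_derivative[OF bounded_linear_cscale_slot[of b v] wave_derivative(1)[of k x]]
    bounded_linear.has_vector_derivative[OF bounded_linear_cscale_slot[of b v] wave_derivative(2)[of k x]]
  by (simp_all add: mode_def cscale_cscale mult.commute)

lemma pd_mode:
  "pd_m (mode b k v) = mode b k (cscale (\<i> * of_int (fst k)) v)"
  "pd_l (mode b k v) = mode b k (cscale (\<i> * of_int (snd k)) v)"
  using mode_derivative[of b k v] by (auto simp: pd_m_def pd_l_def intro!: ext vector_derivative_at)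

lemma continuous_on_wave: "continuous_on torus (wave k)"
  unfolding wave_def by (intro continuous_intros) (auto simp: torus_iff)

lemma continuous_on_mode: "continuous_on torus (mode b k v)"
  unfolding mode_def
  by (rule bounded_linear.continuous_on[OF bounded_linear_cscale_slot continuous_on_wave])

lemma smooth_mode: "smooth_torus (mode b k v)"
proof -
  have "Ck_torus n (mode b k v)" for n
    by (induction n arbitrary: v)
      (auto simp: continuous_on_mode pd_mode intro!: differentiableI_vector
        mode_derivative(1)[of b k _ "(_, _)", simplified] mode_derivative(2)[of b k _ "(_, _)", simplified])
  then show ?thesis by (simp add: smooth_torus_def)
qed

lemma square_integrable_mode: "square_integrable (mode b k v)"
  by (rule square_integrable_continuous[OF continuous_on_mode])

lemma ad_mode: "ad_fibre t (mode b k v x) = mode b k (cscale (if b then 2 * of_real t * \<i> else 0) v) x"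
  by (auto simp: mode_def ad_fibre_def bracket_su2_i slot_fibre_def slot_def cscale_def split: prod.splits)

lemma S_op_mode:
  assumes "x \<in> torus"
  shows "S_op (conn p) (mode b k v) x = mode b k (symb (freq b p k) v) x"
proof -
  have add: "mode b k v x + mode b k w x = mode b k (v + w) x" for v w
    by (simp add: linear_add[OF linear_mode])
  have cadd: "cscale c v + cscale d v = cscale (c + d) v" for c d
    by (auto simp: cscale_def split_beta algebra_simps)
  have m: "S_mat_m (mode b k (cscale c v) x) = mode b k (case v of (\<alpha>, (u, w), \<gamma>) \<Rightarrow> cscale c (w, (- \<gamma>, - \<alpha>), u)) x" for c
    by (auto simp: mat_defs mode_def slot_fibre_def slot_def cscale_def split: prod.splits)
  have l: "S_mat_l (mode b k (cscale c v) x) = mode b k (case v of (\<alpha>, (u, w), \<gamma>) \<Rightarrow> cscale c (- u, (\<alpha>, - \<gamma>), w)) x" for c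
    by (auto simp: mat_defs mode_def slot_fibre_def slot_def cscale_def split: prod.splits)
  have c: "\<i> * of_int (fst k) + (if b then 2 * complex_of_real (- Re p) * \<i> else 0) = \<i> * of_real (Re (freq b p k))"
    "\<i> * of_int (snd k) + (if b then 2 * complex_of_real (- Im p) * \<i> else 0) = \<i> * of_real (Im (freq b p k))"
    by (auto simp: freq_def lattice_pt_def algebra_simps complex_eq_iff)
  show ?thesis
    unfolding S_op_matrix[OF smooth_torus_C1[OF smooth_mode] assms] pd_mode ad_mode add cadd m l c
    by (rule arg_cong[of _ _ "\<lambda>v. mode b k v x"]) (auto simp: cf_defs split: prod.splits)
qed

lemma mode_l2_linear: "linear (mode_l2 b k)"
proof (rule linearI)
  show "mode_l2 b k (v + w) = mode_l2 b k v + mode_l2 b k w" for v w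
    by (simp add: mode_l2_def abs_l2_form_add square_integrable_mode linear_add[OF linear_mode])
       (simp add: linear_add[OF linear_mode, symmetric])
  show "mode_l2 b k (r *\<^sub>R v) = r *\<^sub>R mode_l2 b k v" for r v
    by (simp add: mode_l2_def abs_l2_form_scaleR square_integrable_mode linear_scale[OF linear_mode])
      (simp add: linear_scale[OF linear_mode, symmetric])
qed

lemma J_mode_l2: "J_l2 (mode_l2 b k v) = mode_l2 b k (J_cfibre v)"
  by (simp add: mode_l2_def abs_l2_form_J square_integrable_mode J_mode)

lemma norm_wave: "x \<in> torus \<Longrightarrow> norm (wave k x) = 1"
  by (simp add: wave_def torus_iff norm_mult norm_power_int)

lemma norm_mode_True: "x \<in> torus \<Longrightarrow> norm (mode True k v x) = norm v"
  by (auto simp: mode_def slot_fibre_def slot_def cscale_def norm_Pair norm_mult norm_wave split: prod.splits)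

lemma mode_False_constant: "x \<in> torus \<Longrightarrow> mode False (0, 0) v x = slot_fibre False v"
  by (auto simp: mode_def wave_def cscale_def)

lemma norm_mode_l2_True: "norm (mode_l2 True k v) = sqrt 2 * (2 * pi) * norm v"
proof -
  have "(\<integral>x. (norm (mode True k v x))\<^sup>2 \<partial>torus_measure) = (\<integral>x. (norm v)\<^sup>2 \<partial>torus_measure)"
    by (rule Bochner_Integration.integral_cong[OF refl]) (simp add: norm_mode_True)
  then have "(norm (mode_l2 True k v))\<^sup>2 = (sqrt 2 * (2 * pi) * norm v)\<^sup>2"
    by (simp add: mode_l2_def norm_abs_l2_form square_integrable_mode measure_torus power_mult_distrib)
  then show ?thesis by (rule power2_eq_imp_eq) auto
qed

lemma pointwise_orthogonal_l2:
  assumes "square_integrable f" "square_integrable g" "\<And>x. x \<in> torus \<Longrightarrow> f x \<bullet> g x = 0"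
  shows "abs_l2_form f \<bullet> abs_l2_form g = 0"
proof -
  have "(\<integral>x. f x \<bullet> g x \<partial>torus_measure) = (\<integral>x. 0 \<partial>torus_measure)"
    by (rule Bochner_Integration.integral_cong[OF refl]) (simp add: assms)
  then show ?thesis by (simp add: inner_abs_l2_form assms)
qed

lemma mode_l2_slots_orthogonal: "b \<noteq> c \<Longrightarrow> mode_l2 b k v \<bullet> mode_l2 c l w = 0"
  unfolding mode_l2_def
  by (rule pointwise_orthogonal_l2)
    (auto simp: square_integrable_mode mode_def slot_fibre_def slot_def split: prod.splits)

text \<open>
  Symmetry makes eigenvectors with distinct eigenvalues orthogonal.  The equations are only
  assumed almost everywhere because the vanishing of a harmonic form under the operator comes out
  of an integral.
\<close>

lemma S_eigen_orthogonal:
  assumes f: "smooth_torus f" and g: "smooth_torus g"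
    and Sf: "AE x in torus_measure. S_op (conn p) f x = \<mu> *\<^sub>R f x"
    and Sg: "AE x in torus_measure. S_op (conn p) g x = \<nu> *\<^sub>R g x"
    and ne: "\<mu> \<noteq> \<nu>"
  shows "abs_l2_form f \<bullet> abs_l2_form g = 0"
proof -
  note C = smooth_torus_C1[OF f] smooth_torus_C1[OF g]
  have Scont: "continuous_on torus (S_op (conn p) h)" if "C1_torus h" for h
  proof -
    have "continuous_on torus (\<lambda>x. S_mat_m (pd_m h x + ad_fibre (- Re p) (h x))
        + S_mat_l (pd_l h x + ad_fibre (- Im p) (h x)))"
      using that by (intro continuous_intros linear_mats[THEN bounded_linear.continuous_on]
          linear_ad_fibre[THEN bounded_linear.continuous_on]) auto
    then show ?thesis using S_op_matrix[OF that] by (simp cong: continuous_on_cong)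
  qed
  note c = C1_continuous[OF C(1)] C1_continuous[OF C(2)] Scont[OF C(1)] Scont[OF C(2)]
  have "\<mu> * (\<integral>x. f x \<bullet> g x \<partial>torus_measure) = (\<integral>x. (\<mu> *\<^sub>R f x) \<bullet> g x \<partial>torus_measure)" by simp
  also have "\<dots> = (\<integral>x. S_op (conn p) f x \<bullet> g x \<partial>torus_measure)"
    by (rule integral_cong_AE) (use c Sf in \<open>auto intro!: borel_measurable_torusI continuous_intros elim: AE_mp\<close>)
  also have "\<dots> = (\<integral>x. f x \<bullet> S_op (conn p) g x \<partial>torus_measure)" by (rule S_op_symmetric[OF C])
  also have "\<dots> = (\<integral>x. f x \<bullet> (\<nu> *\<^sub>R g x) \<partial>torus_measure)"
    by (rule integral_cong_AE) (use c Sg in \<open>auto intro!: borel_measurable_torusI continuous_intros elim: AE_mp\<close>)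
  finally have "(\<mu> - \<nu>) * (\<integral>x. f x \<bullet> g x \<partial>torus_measure) = 0" by (simp add: algebra_simps)
  then show ?thesis
    using ne c by (simp add: inner_abs_l2_form square_integrable_continuous)
qed

text \<open>
  The amplitude is an eigenvector of the symbol at the unit vector \<open>sgn \<xi>\<close>, and rescaling to \<open>\<xi>\<close>
  multiplies the eigenvalue by \<open>norm \<xi>\<close>.
\<close>

lemma mode_eigen:
  assumes "x \<in> torus"
  shows "freq b p k \<noteq> 0 \<Longrightarrow> S_op (conn p) (mode b k (pol s (sgn (freq b p k)) v)) x
      = (sgn_of s * norm (freq b p k)) *\<^sub>R mode b k (pol s (sgn (freq b p k)) v) x"
    and "freq b p k = 0 \<Longrightarrow> S_op (conn p) (mode b k v) x = 0"
proof -
  let ?\<xi> = "freq b p k"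
  assume "?\<xi> \<noteq> 0"
  then have "norm (sgn ?\<xi>) = 1" "?\<xi> = of_real (norm ?\<xi>) * sgn ?\<xi>"
    by (simp_all add: norm_sgn) (simp add: sgn_eq)
  then show "S_op (conn p) (mode b k (pol s (sgn ?\<xi>) v)) x
      = (sgn_of s * norm ?\<xi>) *\<^sub>R mode b k (pol s (sgn ?\<xi>) v) x"
    using symb_scaleR[of "norm ?\<xi>" "sgn ?\<xi>" "pol s (sgn ?\<xi>) v"]
    by (simp add: S_op_mode[OF assms] symb_pol linear_scale[OF linear_mode] mult.commute)
next
  have "symb 0 v = 0" by (auto simp: cf_defs zero_prod_def)
  then show "freq b p k = 0 \<Longrightarrow> S_op (conn p) (mode b k v) x = 0"
    by (simp add: S_op_mode[OF assms] linear_0[OF linear_mode])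
qed


section \<open>Completeness of the Fourier modes\<close>

lemma integrable_mult_continuous:
  fixes f h :: "pt \<Rightarrow> 'b::{second_countable_topology, real_normed_field, banach}"
  assumes h: "continuous_on torus h" and f: "integrable torus_measure f"
  shows "integrable torus_measure (\<lambda>x. h x * f x)"
proof -
  obtain B where B: "\<And>x. x \<in> torus \<Longrightarrow> norm (h x) \<le> B"
    using compact_imp_bounded[OF compact_continuous_image[OF h compact_torus]]
    by (auto simp: bounded_iff)
  have "integrable torus_measure (\<lambda>x. B * norm (f x))" using f by simp
  then show ?thesis
  proof (rule Bochner_Integration.integrable_bound)
    show "(\<lambda>x. h x * f x) \<in> borel_measurable torus_measure"
      using borel_measurable_torusI[OF h] f by measurable
    show "AE x in torus_measure. norm (h x * f x) \<le> norm (B * norm (f x))"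
      using B by (intro AE_I2) (auto simp: norm_mult intro!: mult_right_mono order_trans[OF _ abs_ge_self])
  qed
qed

lemma borel_Int_torus: "B \<in> sets borel \<Longrightarrow> B \<inter> torus \<in> sets torus_measure"
  by (auto simp: sets_torus_measure sets_restrict_space)

text \<open>
  Continuous functions separate integrable densities: closed sets are decreasing limits of
  continuous functions, and they generate the Borel sets.
\<close>

lemma AE_zero_if_orthogonal_to_continuous:
  fixes r :: "pt \<Rightarrow> real"
  assumes r: "integrable torus_measure r"
    and orth: "\<And>g. continuous_on UNIV g \<Longrightarrow> (\<integral>x. g x * r x \<partial>torus_measure) = 0"
  shows "AE x in torus_measure. r x = 0"
proof -
  have sint: "set_integrable torus_measure (B \<inter> torus) r" if "B \<in> sets borel" for B
    unfolding set_integrable_def using borel_Int_torus[OF that] r by (rule integrable_mult_indicator)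
  have closed: "(LINT x:(A \<inter> torus)|torus_measure. r x) = 0" if A: "closed A" for A
  proof (cases "A = {}")
    case False
    define g where "g n x = max 0 (1 - real n * infdist x A)" for n and x :: pt
    have "(\<lambda>n. \<integral>x. g n x * r x \<partial>torus_measure) \<longlonglongrightarrow> (\<integral>x. indicator (A \<inter> torus) x * r x \<partial>torus_measure)"
    proof (rule integral_dominated_convergence[where w = "\<lambda>x. norm (r x)"])
      show "(\<lambda>x. indicator (A \<inter> torus) x * r x) \<in> borel_measurable torus_measure"
        using borel_Int_torus[OF borel_closed[OF A]] r by measurable
      show "(\<lambda>x. g n x * r x) \<in> borel_measurable torus_measure" for n
      proof -
        have "continuous_on torus (g n)" unfolding g_def by (intro continuous_intros)
        from integrable_mult_continuous[OF this r] show ?thesis by simp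
      qed
      show "AE x in torus_measure. norm (g n x * r x) \<le> norm (r x)" for n
        by (intro AE_I2) (auto simp: g_def abs_mult infdist_nonneg intro!: mult_left_le_one_le)
      have "(\<lambda>n. g n x) \<longlonglongrightarrow> indicator (A \<inter> torus) x" if "x \<in> torus" for x
      proof (cases "x \<in> A")
        case True
        then show ?thesis using that by (simp add: g_def)
      next
        case F: False
        then have pos: "infdist x A > 0" using infdist_pos_not_in_closed[OF A False] by blast
        obtain N where N: "real N * infdist x A > 1" using reals_Archimedean3[OF pos] by blast
        have "\<forall>\<^sub>F n in sequentially. g n x = 0"
        proof (rule eventually_sequentiallyI[of N])
          fix n assume "N \<le> n"
          then have "real N * infdist x A \<le> real n * infdist x A" using pos by simp
          then show "g n x = 0" using N by (simp add: g_def)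
        qed
        then show ?thesis using F by (simp add: tendsto_eventually)
      qed
      then show "AE x in torus_measure. (\<lambda>n. g n x * r x) \<longlonglongrightarrow> indicator (A \<inter> torus) x * r x"
        by (intro AE_I2 tendsto_mult_right) auto
    qed (use r in simp)
    moreover have "(\<integral>x. g n x * r x \<partial>torus_measure) = 0" for n
      by (rule orth) (auto simp: g_def intro!: continuous_intros)
    ultimately show ?thesis
      by (simp add: set_lebesgue_integral_def LIMSEQ_const_iff)
  qed (simp add: set_lebesgue_integral_def)
  have borel: "(LINT x:(B \<inter> torus)|torus_measure. r x) = 0" if "B \<in> sets borel" for B
  proof -
    have "Int_stable (Collect (closed :: pt set \<Rightarrow> bool))" by (auto simp: Int_stable_def)
    moreover have "Collect (closed :: pt set \<Rightarrow> bool) \<subseteq> Pow UNIV" by simp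
    moreover have "B \<in> sigma_sets UNIV (Collect closed)"
      using that by (simp add: borel_eq_closed)
    ultimately show ?thesis
    proof (induction B rule: sigma_sets_induct_disjoint)
      case (compl B)
      then have B: "B \<in> sets borel" by (simp add: borel_eq_closed)
      have "(UNIV - B) \<inter> torus = torus - (B \<inter> torus)" by auto
      then have "(LINT x:((B \<inter> torus) \<union> ((UNIV - B) \<inter> torus))|torus_measure. r x)
          = (LINT x:(B \<inter> torus)|torus_measure. r x) + (LINT x:((UNIV - B) \<inter> torus)|torus_measure. r x)"
        using B by (intro set_integral_Un sint) auto
      moreover have "(B \<inter> torus) \<union> ((UNIV - B) \<inter> torus) = UNIV \<inter> torus" by auto
      ultimately show ?case using compl(2) closed[of UNIV] by simp
    next
      case (union A)
      then have A: "A i \<in> sets borel" for i by (auto simp: borel_eq_closed)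
      have sum: "(LINT x:(\<Union>i. A i \<inter> torus)|torus_measure. r x) = (\<Sum>i. LINT x:(A i \<inter> torus)|torus_measure. r x)"
      proof (rule lebesgue_integral_countable_add)
        show "A i \<inter> torus \<in> sets torus_measure" for i using A by (rule borel_Int_torus)
        show "(A i \<inter> torus) \<inter> (A j \<inter> torus) = {}" if "i \<noteq> j" for i j
          using union(1) that by (auto simp: disjoint_family_on_def)
        have "(\<Union>i. A i \<inter> torus) = (\<Union>i. A i) \<inter> torus" by auto
        then show "set_integrable torus_measure (\<Union>i. A i \<inter> torus) r"
          using sint[of "\<Union>i. A i"] A by auto
      qed
      have Un: "(\<Union>i. A i) \<inter> torus = (\<Union>i. A i \<inter> torus)" by auto
      show ?case unfolding Un sum union(3) by (rule suminf_zero)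
    next
      case (basic A)
      then show ?case using closed by blast
    next
      case empty
      then show ?case by (simp add: set_lebesgue_integral_def)
    qed
  qed
  have nonneg: "AE x in torus_measure. q x \<le> 0"
    if q: "integrable torus_measure q"
      and q0: "\<And>B. B \<in> sets borel \<Longrightarrow> (LINT x:(B \<inter> torus)|torus_measure. q x) = 0" for q :: "pt \<Rightarrow> real"
  proof -
    have "q -` {0<..} \<inter> space torus_measure \<in> sets torus_measure"
      using q by (intro measurable_sets[of _ _ borel]) auto
    then obtain B where B: "B \<in> sets borel" "{x \<in> torus. q x > 0} = B \<inter> torus"
      by (auto simp: sets_torus_measure sets_restrict_space vimage_def Int_def conj_commute)
    have "(\<integral>x. max 0 (q x) \<partial>torus_measure) = (LINT x:(B \<inter> torus)|torus_measure. q x)"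
      unfolding set_lebesgue_integral_def B(2)[symmetric]
      by (rule Bochner_Integration.integral_cong) (auto simp: indicator_def)
    then have "(\<integral>x. max 0 (q x) \<partial>torus_measure) = 0" using q0[OF B(1)] by simp
    then have "AE x in torus_measure. max 0 (q x) = 0"
      using q by (subst (asm) integral_nonneg_eq_0_iff_AE) auto
    then show ?thesis by (rule AE_mp) (auto intro!: AE_I2)
  qed
  have "AE x in torus_measure. r x \<le> 0" by (rule nonneg[OF r borel])
  moreover have "AE x in torus_measure. - r x \<le> 0"
    by (rule nonneg) (use r borel in \<open>auto simp: set_lebesgue_integral_def\<close>)
  ultimately show ?thesis by (auto elim!: AE_mp)
qed

lemma wave_add: "x \<in> torus \<Longrightarrow> wave k x * wave l x = wave (fst k + fst l, snd k + snd l) x"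
proof -
  assume "x \<in> torus"
  then have "fst x \<noteq> 0" "snd x \<noteq> 0" by (auto simp: torus_iff)
  then show ?thesis by (simp add: wave_def power_int_add mult_ac)
qed

lemma linear_functional_waves:
  fixes q :: "pt \<Rightarrow> real"
  assumes q: "linear q"
  obtains A B where "\<And>x. x \<in> torus \<Longrightarrow> of_real (q x) = A * wave (1, 0) x + cnj A * wave (- 1, 0) x
    + B * wave (0, 1) x + cnj B * wave (0, - 1) x"
proof
  let ?A = "Complex (q (1, 0) / 2) (- q (\<i>, 0) / 2)" and ?B = "Complex (q (0, 1) / 2) (- q (0, \<i>) / 2)"
  fix x assume x: "x \<in> torus"
  have "x = Re (fst x) *\<^sub>R (1, 0) + Im (fst x) *\<^sub>R (\<i>, 0) + Re (snd x) *\<^sub>R (0, 1) + Im (snd x) *\<^sub>R (0, \<i>)"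
    by (auto simp: prod_eq_iff complex_eq_iff)
  then have "q x = Re (fst x) * q (1, 0) + Im (fst x) * q (\<i>, 0) + Re (snd x) * q (0, 1) + Im (snd x) * q (0, \<i>)"
    using linear_add[OF q] linear_scale[OF q] by (metis real_scaleR_def)
  moreover have "inverse z = cnj z" if "norm z = 1" for z :: complex
    using complex_norm_square[of z] that by (intro inverse_unique) simp
  ultimately show "of_real (q x) = ?A * wave (1, 0) x + cnj ?A * wave (- 1, 0) x
    + ?B * wave (0, 1) x + cnj ?B * wave (0, - 1) x"
    using x by (simp add: wave_def torus_iff power_int_minus complex_eq_iff algebra_simps)
qed

text \<open>
  Multiplication by a coordinate function shifts the frequencies by one, so it preserves the
  vanishing of all Fourier coefficients; the density is generalized because a product is treated
  by applying the hypothesis to the density times one factor.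
\<close>

lemma integral_wave_mult_polynomial:
  fixes f :: "pt \<Rightarrow> complex"
  assumes "real_polynomial_function q" "integrable torus_measure f"
    and "\<And>k. (\<integral>x. wave k x * f x \<partial>torus_measure) = 0"
  shows "(\<integral>x. wave k x * (of_real (q x) * f x) \<partial>torus_measure) = 0"
  using assms
proof (induction arbitrary: f k rule: real_polynomial_function.induct)
  case (linear q)
  obtain A B where AB: "\<And>x. x \<in> torus \<Longrightarrow> of_real (q x) = A * wave (1, 0) x + cnj A * wave (- 1, 0) x
      + B * wave (0, 1) x + cnj B * wave (0, - 1) x"
    using linear_functional_waves[OF bounded_linear.linear[OF linear(1)]] by blast
  let ?w = "\<lambda>a b x. wave (fst k + a, snd k + b) x * f x"
  have int: "integrable torus_measure (\<lambda>x. wave l x * f x)" for l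
    by (rule integrable_mult_continuous[OF continuous_on_wave linear(2)])
  have "(\<integral>x. wave k x * (of_real (q x) * f x) \<partial>torus_measure)
      = (\<integral>x. A * ?w 1 0 x + cnj A * ?w (- 1) 0 x + B * ?w 0 1 x + cnj B * ?w 0 (- 1) x \<partial>torus_measure)"
  proof (rule Bochner_Integration.integral_cong[OF refl])
    fix x assume "x \<in> space torus_measure"
    then have x: "x \<in> torus" by simp
    have "wave k x * (of_real (q x) * f x) = A * (wave k x * wave (1, 0) x * f x)
        + cnj A * (wave k x * wave (- 1, 0) x * f x) + B * (wave k x * wave (0, 1) x * f x)
        + cnj B * (wave k x * wave (0, - 1) x * f x)"
      unfolding AB[OF x] by (simp add: algebra_simps)
    then show "wave k x * (of_real (q x) * f x)
        = A * ?w 1 0 x + cnj A * ?w (- 1) 0 x + B * ?w 0 1 x + cnj B * ?w 0 (- 1) x"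
      by (simp add: wave_add[OF x])
  qed
  then show ?case by (simp add: int linear(3))
next
  case (const c)
  have "(\<integral>x. wave k x * (of_real c * f x) \<partial>torus_measure) = (\<integral>x. of_real c * (wave k x * f x) \<partial>torus_measure)"
    by (simp add: mult.left_commute)
  then show ?case using const by simp
next
  case (add q1 q2)
  have int: "integrable torus_measure (\<lambda>x. wave k x * (of_real (q x) * f x))" if "real_polynomial_function q" for q
    by (intro integrable_mult_continuous[OF continuous_on_wave] integrable_mult_continuous add(5)
        continuous_intros continuous_on_subset[OF continuous_on_polymonial_function]) (use that in \<open>auto simp: real_polynomial_function_eq\<close>)
  have "(\<integral>x. wave k x * (of_real (q1 x + q2 x) * f x) \<partial>torus_measure)
      = (\<integral>x. wave k x * (of_real (q1 x) * f x) + wave k x * (of_real (q2 x) * f x) \<partial>torus_measure)"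
    by (simp add: algebra_simps)
  then show ?case using add by (simp add: int)
next
  case (mult q1 q2)
  have int: "integrable torus_measure (\<lambda>x. of_real (q2 x) * f x)"
    by (intro integrable_mult_continuous mult(5)
        continuous_intros continuous_on_subset[OF continuous_on_polymonial_function]) (use mult(2) in \<open>auto simp: real_polynomial_function_eq\<close>)
  have "(\<integral>x. wave k x * (of_real (q1 x) * (of_real (q2 x) * f x)) \<partial>torus_measure) = 0" for k
    by (rule mult.IH(1)[OF int mult.IH(2)[OF mult(5) mult(6)]])
  then show ?case by (simp add: mult.assoc)
qed

text \<open>By Weierstrass, a density whose Fourier coefficients vanish is orthogonal to all continuous functions.\<close>

lemma Fourier_uniqueness:
  fixes f :: "pt \<Rightarrow> complex"
  assumes f: "integrable torus_measure f"
    and coeff: "\<And>k. (\<integral>x. wave k x * f x \<partial>torus_measure) = 0"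
  shows "AE x in torus_measure. f x = 0"
proof -
  have cont0: "(\<integral>x. of_real (g x) * f x \<partial>torus_measure) = 0" if g: "continuous_on UNIV g" for g :: "pt \<Rightarrow> real"
  proof -
    have gT: "continuous_on torus g" using g continuous_on_subset by blast
    have le: "norm (\<integral>x. of_real (g x) * f x \<partial>torus_measure) \<le> e * (\<integral>x. norm (f x) \<partial>torus_measure)" if e: "e > 0" for e
    proof -
      obtain q where q: "real_polynomial_function q" "\<And>x. x \<in> torus \<Longrightarrow> \<bar>g x - q x\<bar> < e"
        using Stone_Weierstrass_real_polynomial_function[OF compact_torus gT e] by blast
      have qT: "continuous_on torus q"
        using q(1) continuous_on_subset[OF continuous_on_polymonial_function] by (auto simp: real_polynomial_function_eq)
      have int: "integrable torus_measure (\<lambda>x. of_real (g x) * f x)" "integrable torus_measure (\<lambda>x. of_real (q x) * f x)"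
        "integrable torus_measure (\<lambda>x. of_real (g x - q x) * f x)"
        by (intro integrable_mult_continuous f continuous_intros gT qT)+
      have "(\<integral>x. of_real (q x) * f x \<partial>torus_measure) = 0"
        using integral_wave_mult_polynomial[OF q(1) f coeff, of "(0, 0)"] by (simp add: wave_def)
      then have "(\<integral>x. of_real (g x) * f x \<partial>torus_measure) = (\<integral>x. of_real (g x - q x) * f x \<partial>torus_measure)"
        using int by (simp add: algebra_simps)
      also have "norm \<dots> \<le> (\<integral>x. norm (of_real (g x - q x) * f x) \<partial>torus_measure)"
        by (rule integral_norm_bound)
      also have "\<dots> \<le> (\<integral>x. e * norm (f x) \<partial>torus_measure)"
      proof (rule integral_mono)
        show "norm (complex_of_real (g x - q x) * f x) \<le> e * norm (f x)" if "x \<in> space torus_measure" for x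
          unfolding norm_mult norm_of_real using q(2)[of x] that by (intro mult_right_mono) auto
      qed (use f int(3) in simp_all)
      finally show ?thesis by simp
    qed
    define I where "I = (\<integral>x. norm (f x) \<partial>torus_measure)"
    have I0: "I \<ge> 0" by (simp add: I_def)
    have "norm (\<integral>x. of_real (g x) * f x \<partial>torus_measure) \<le> 0 + e" if e: "e > 0" for e
    proof -
      have "e / (I + 1) * I \<le> e" using e I0 by (simp add: field_simps)
      moreover have "e / (I + 1) > 0" using e I0 by simp
      ultimately show ?thesis using le[of "e / (I + 1)", folded I_def] by linarith
    qed
    then have "norm (\<integral>x. of_real (g x) * f x \<partial>torus_measure) \<le> 0" by (rule field_le_epsilon)
    then show ?thesis by simp
  qed
  have Re0: "(\<integral>x. g x * Re (f x) \<partial>torus_measure) = 0" and Im0: "(\<integral>x. g x * Im (f x) \<partial>torus_measure) = 0"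
    if g: "continuous_on UNIV g" for g :: "pt \<Rightarrow> real"
  proof -
    have "integrable torus_measure (\<lambda>x. of_real (g x) * f x)"
      by (intro integrable_mult_continuous f continuous_intros continuous_on_subset[OF g]) auto
    from integral_Re[OF this] integral_Im[OF this] cont0[OF g]
    show "(\<integral>x. g x * Re (f x) \<partial>torus_measure) = 0" "(\<integral>x. g x * Im (f x) \<partial>torus_measure) = 0" by simp_all
  qed
  have "AE x in torus_measure. Re (f x) = 0" "AE x in torus_measure. Im (f x) = 0"
    using AE_zero_if_orthogonal_to_continuous Re0 Im0 f by auto
  then show ?thesis by (auto elim!: AE_mp simp: complex_eq_iff)
qed

lemma square_integrable_imp_integrable:
  assumes "square_integrable f"
  shows "integrable torus_measure f"
proof (rule Bochner_Integration.integrable_bound)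
  show "integrable torus_measure (\<lambda>x. 1 + (norm (f x))\<^sup>2)"
    using assms by (simp add: square_integrable_def)
  show "f \<in> borel_measurable torus_measure" using assms by (simp add: square_integrable_def)
  have "t \<le> 1 + t\<^sup>2" for t :: real 
    using zero_le_power2[of "t - 1/2"] unfolding power2_eq_square by (simp add: algebra_simps)
  then show "AE x in torus_measure. norm (f x) \<le> norm (1 + (norm (f x))\<^sup>2)"
    by (intro AE_I2) auto
qed

text \<open>
  The dual pair \<open>\<pi>\<close>, \<open>\<epsilon>\<close> isolates one coefficient of the form.  Testing with the amplitudes \<open>1\<close>
  and \<open>- \<i>\<close> gives the real and the imaginary part of its Fourier coefficients.
\<close>

lemma component_zero_if_orthogonal_to_modes:
  fixes \<pi> :: "fibre \<Rightarrow> su2" and \<epsilon> :: "complex \<Rightarrow> cfibre"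
  assumes f: "square_integrable f" and orth: "\<And>b k v. abs_l2_form f \<bullet> mode_l2 b k v = 0"
    and \<pi>: "bounded_linear \<pi>"
    and dual: "\<And>w b z. w \<bullet> slot_fibre b (\<epsilon> z) = \<pi> w \<bullet> slot b z"
    and eq: "\<And>c z. cscale c (\<epsilon> z) = \<epsilon> (c * z)"
  shows "AE x in torus_measure. \<pi> (f x) = 0"
proof -
  have int: "integrable torus_measure (\<lambda>x. \<pi> (f x))"
    by (rule integrable_bounded_linear[OF \<pi> square_integrable_imp_integrable[OF f]])
  have z: "(\<integral>x. \<pi> (f x) \<bullet> slot b (wave k x * z) \<partial>torus_measure) = 0" for b k z
    using orth[of b k "\<epsilon> z"]
    by (simp add: mode_l2_def inner_abs_l2_form f square_integrable_mode mode_def eq dual)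
  have "AE x in torus_measure. cnj (snd (\<pi> (f x))) = 0"
  proof (rule Fourier_uniqueness)
    show i: "integrable torus_measure (\<lambda>x. cnj (snd (\<pi> (f x))))"
      by (intro integrable_bounded_linear[OF bounded_linear_cnj] integrable_bounded_linear[OF bounded_linear_snd] int)
    fix k
    have i: "integrable torus_measure (\<lambda>x. wave k x * cnj (snd (\<pi> (f x))))"
      by (rule integrable_mult_continuous[OF continuous_on_wave i])
    show "(\<integral>x. wave k x * cnj (snd (\<pi> (f x))) \<partial>torus_measure) = 0"
      using z[of True k 1] z[of True k "- \<i>"]
      by (simp add: complex_eq_iff integral_Re[OF i, symmetric] integral_Im[OF i, symmetric]
          slot_def inner_prod_def inner_complex_def algebra_simps)
  qed
  moreover have "AE x in torus_measure. complex_of_real (fst (\<pi> (f x))) = 0"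
  proof (rule Fourier_uniqueness)
    show i: "integrable torus_measure (\<lambda>x. complex_of_real (fst (\<pi> (f x))))"
      by (intro integrable_of_real integrable_bounded_linear[OF bounded_linear_fst] int)
    fix k
    have i: "integrable torus_measure (\<lambda>x. wave k x * complex_of_real (fst (\<pi> (f x))))"
      by (rule integrable_mult_continuous[OF continuous_on_wave i])
    show "(\<integral>x. wave k x * complex_of_real (fst (\<pi> (f x))) \<partial>torus_measure) = 0"
      using z[of False k 1] z[of False k "- \<i>"]
      by (simp add: complex_eq_iff integral_Re[OF i, symmetric] integral_Im[OF i, symmetric]
          slot_def inner_prod_def algebra_simps)
  qed
  ultimately show ?thesis by (auto elim!: AE_mp simp: prod_eq_iff)
qed

lemma zero_if_orthogonal_to_modes:
  assumes "\<And>b k v. u \<bullet> mode_l2 b k v = 0"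
  shows "u = 0"
proof -
  obtain f where f: "square_integrable f" "u = abs_l2_form f" by (rule l2_form_cases)
  note C = component_zero_if_orthogonal_to_modes[OF f(1) assms[unfolded f(2)]]
  have lin: "bounded_linear (\<lambda>w::fibre. fst w)" "bounded_linear (\<lambda>w::fibre. fst (fst (snd w)))"
    "bounded_linear (\<lambda>w::fibre. snd (fst (snd w)))" "bounded_linear (\<lambda>w::fibre. snd (snd w))"
    by (intro bounded_linear_fst_comp bounded_linear_snd_comp bounded_linear_ident)+
  have "AE x in torus_measure. fst (f x) = 0"
    by (rule C[where \<epsilon> = "\<lambda>z. (z, (0, 0), 0)"])
      (auto simp: slot_fibre_def slot_def cscale_def inner_prod_def lin)
  moreover have "AE x in torus_measure. fst (fst (snd (f x))) = 0"
    by (rule C[where \<epsilon> = "\<lambda>z. (0, (z, 0), 0)"])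
      (auto simp: slot_fibre_def slot_def cscale_def inner_prod_def lin)
  moreover have "AE x in torus_measure. snd (fst (snd (f x))) = 0"
    by (rule C[where \<epsilon> = "\<lambda>z. (0, (0, z), 0)"])
      (auto simp: slot_fibre_def slot_def cscale_def inner_prod_def lin)
  moreover have "AE x in torus_measure. snd (snd (f x)) = 0"
    by (rule C[where \<epsilon> = "\<lambda>z. (0, (0, 0), z)"])
      (auto simp: slot_fibre_def slot_def cscale_def inner_prod_def lin)
  ultimately have "AE x in torus_measure. f x = 0" by (auto elim!: AE_mp simp: prod_eq_iff)
  then have "abs_l2_form f = abs_l2_form (\<lambda>x. 0)"
    by (simp add: abs_l2_form_eq_iff f square_integrable_zero)
  then show ?thesis using f by (simp add: zero_l2_form_def)
qed

definition all_modes :: "l2_form set" where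
  "all_modes = {mode_l2 b k v | b k v. True}"

lemma closure_span_modes: "closure (span all_modes) = UNIV"
proof -
  have sub: "subspace (closure (span all_modes))" by (intro subspace_closure subspace_span)
  have "x \<in> closure (span all_modes)" for x
  proof -
    obtain y where y: "y \<in> closure (span all_modes)" "x - y \<in> (closure (span all_modes))\<^sup>\<bottom>"
      using Hilbert_projection_exists[OF sub closed_closure] by blast
    have "(x - y) \<bullet> mode_l2 b k v = 0" for b k v
    proof -
      have "mode_l2 b k v \<in> all_modes" unfolding all_modes_def by blast
      then have "mode_l2 b k v \<in> closure (span all_modes)"
        using closure_subset span_superset by blast
      then have "mode_l2 b k v \<bullet> (x - y) = 0" using y(2) unfolding orthogonal_comp_iff by blast
      then show ?thesis by (subst inner_commute)
    qed
    then have "x - y = 0" by (rule zero_if_orthogonal_to_modes)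
    then show ?thesis using y(1) by simp
  qed
  then show ?thesis by auto
qed

lemma bounded_linear_eq_on_modes:
  fixes f g :: "l2_form \<Rightarrow> 'b::real_normed_vector"
  assumes f: "bounded_linear f" and g: "bounded_linear g"
    and eq: "\<And>b k v. f (mode_l2 b k v) = g (mode_l2 b k v)"
  shows "f = g"
proof
  fix x
  have "closed {x. f x = g x}"
    by (intro closed_Collect_eq linear_continuous_on f g)
  moreover have "span all_modes \<subseteq> {x. f x = g x}"
    by (rule span_minimal)
      (use eq in \<open>auto simp: all_modes_def subspace_def linear_simps[OF f] linear_simps[OF g]\<close>)
  ultimately have "closure (span all_modes) \<subseteq> {x. f x = g x}" by (rule closure_minimal[rotated])
  then show "f x = g x" using closure_span_modes by auto
qed


section \<open>Spectral projections on the Fourier modes\<close>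

lemma J_fibre_linear: "J_fibre (u + v) = J_fibre u + J_fibre v" "J_fibre (r *\<^sub>R u) = r *\<^sub>R J_fibre u"
  "J_fibre (J_fibre u) = - u"
  by (auto simp: J_fibre_def star0_def star1_def star2_def split_beta prod_eq_iff)

lemma bounded_linear_J_l2: "bounded_linear J_l2"
proof (rule bounded_linear_intro[where K = 1])
  fix u v :: l2_form and r :: real
  obtain f g where f: "square_integrable f" "u = abs_l2_form f" and g: "square_integrable g" "v = abs_l2_form g"
    using l2_form_cases by metis
  show "J_l2 (u + v) = J_l2 u + J_l2 v"
    using f(1) g(1) by (simp add: f(2) g(2) abs_l2_form_add abs_l2_form_J square_integrable_add square_integrable_J J_fibre_linear)
  show "J_l2 (r *\<^sub>R u) = r *\<^sub>R J_l2 u"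
    using f(1) by (simp add: f(2) abs_l2_form_scaleR abs_l2_form_J square_integrable_scaleR square_integrable_J J_fibre_linear)
  have "(norm (J_l2 u))\<^sup>2 = (norm u)\<^sup>2"
    using f(1) by (simp add: f(2) abs_l2_form_J norm_abs_l2_form square_integrable_J J_fibre_norm)
  then show "norm (J_l2 u) \<le> norm u * 1" by (simp add: power2_eq_iff_nonneg)
qed

lemma J_l2_J_l2: "J_l2 (J_l2 u) = - u"
proof -
  obtain f where f: "square_integrable f" "u = abs_l2_form f" by (rule l2_form_cases)
  have "- u = (- 1) *\<^sub>R u" by simp
  also have "\<dots> = J_l2 (J_l2 u)"
    using f(1) by (simp only: f(2) abs_l2_form_J abs_l2_form_scaleR square_integrable_J J_fibre_linear) simp
  finally show ?thesis ..
qed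

text \<open>
  With \<open>Q\<close> the projection onto \<open>\<Lambda>\<close>, the operator \<open>- J Q J\<close> is the projection onto \<open>J \<Lambda>\<close>, so
  the Lagrangian condition is the operator identity below.
\<close>

lemma lagrangian_in_UNIV_I:
  assumes Q: "is_orth_proj Q \<Lambda>" "subspace \<Lambda>"
    and id: "\<And>x. blinfun_apply Q x - J_l2 (blinfun_apply Q (J_l2 x)) = x"
  shows "lagrangian_in UNIV \<Lambda>"
  unfolding lagrangian_in_def
proof (intro conjI)
  note J = linear_simps[OF bounded_linear_J_l2]
  show "J_l2 ` \<Lambda> = UNIV \<inter> \<Lambda>\<^sup>\<bottom>"
  proof (intro set_eqI iffI)
    fix y assume "y \<in> J_l2 ` \<Lambda>"
    then obtain x where x: "x \<in> \<Lambda>" "y = J_l2 x" by blast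
    then have "blinfun_apply Q x = x" using is_orth_proj_fixes[OF Q] by blast
    then have "J_l2 (blinfun_apply Q y) = 0" using id[of x] x(2) by simp
    then have "J_l2 (J_l2 (blinfun_apply Q y)) = 0" by (simp add: J)
    then have "blinfun_apply Q y = 0" by (simp add: J_l2_J_l2)
    then show "y \<in> UNIV \<inter> \<Lambda>\<^sup>\<bottom>" using is_orth_proj_kernel[OF Q] by blast
  next
    fix y assume "y \<in> UNIV \<inter> \<Lambda>\<^sup>\<bottom>"
    then have "blinfun_apply Q y = 0" using is_orth_proj_kernel[OF Q] by blast
    then have "y = J_l2 (- blinfun_apply Q (J_l2 y))" using id[of y] by (simp add: J)
    moreover have "- blinfun_apply Q (J_l2 y) \<in> \<Lambda>"
      using Q by (simp add: is_orth_proj_def subspace_neg)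
    ultimately show "y \<in> J_l2 ` \<Lambda>" by blast
  qed
qed (use Q is_orth_proj_closed[OF Q] in auto)

lemma subspace_P_spec: "subspace (P_spec s p)"
  unfolding P_spec_def by (intro subspace_closure subspace_span)

lemma closed_P_spec: "closed (P_spec s p)"
  unfolding P_spec_def by (rule closed_closure)

lemma orth_proj_P_spec: "is_orth_proj (orth_proj (P_spec s p)) (P_spec s p)"
  using is_orth_proj_exists[OF subspace_P_spec closed_P_spec] orth_proj_eq[OF _ subspace_P_spec] by metis

lemma mode_in_P_spec:
  assumes "freq b p k \<noteq> 0"
  shows "mode_l2 b k (pol s (sgn (freq b p k)) v) \<in> P_spec s p"
proof -
  let ?w = "pol s (sgn (freq b p k)) v"
  show ?thesis
  proof (cases "\<exists>x\<in>torus. mode b k ?w x \<noteq> 0")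
    case True
    then have "eigenform (conn p) (sgn_of s * norm (freq b p k)) (mode b k ?w)"
      by (simp add: eigenform_def smooth_mode mode_eigen(1)[OF _ assms])
    then have "mode_l2 b k ?w \<in> {abs_l2_form \<omega> | \<omega> \<mu>. has_sign s \<mu> \<and> eigenform (conn p) \<mu> \<omega>}"
      unfolding mode_l2_def using has_sign_sgn_of(1)[of "norm (freq b p k)" s] assms by auto
    then show ?thesis unfolding P_spec_def by (intro subsetD[OF closure_subset] span_base)
  next
    case False
    then have "mode_l2 b k ?w = abs_l2_form (\<lambda>x. 0)"
      unfolding mode_l2_def
      by (subst abs_l2_form_eq_iff) (auto simp: square_integrable_mode square_integrable_zero intro!: AE_I2)
    then have "mode_l2 b k ?w = 0" by (simp add: zero_l2_form_def)
    then show ?thesis by (simp add: subspace_0[OF subspace_P_spec])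
  qed
qed

text \<open>
  This covers the eigenforms of the opposite sign as well as the zero modes.
\<close>

lemma eigenform_orthogonal_P_spec:
  assumes g: "smooth_torus g" "AE x in torus_measure. S_op (conn p) g x = \<nu> *\<^sub>R g x"
    and \<nu>: "\<not> has_sign s \<nu>"
  shows "abs_l2_form g \<in> (P_spec s p)\<^sup>\<bottom>"
proof -
  have "span {abs_l2_form \<omega> | \<omega> \<mu>. has_sign s \<mu> \<and> eigenform (conn p) \<mu> \<omega>} \<subseteq> {u. u \<bullet> abs_l2_form g = 0}"
  proof (rule span_minimal)
    show "subspace {u. u \<bullet> abs_l2_form g = 0}" by (auto simp: subspace_def inner_add_left)
    show "{abs_l2_form \<omega> | \<omega> \<mu>. has_sign s \<mu> \<and> eigenform (conn p) \<mu> \<omega>} \<subseteq> {u. u \<bullet> abs_l2_form g = 0}"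
    proof safe
      fix \<omega> \<mu> assume "has_sign s \<mu>" "eigenform (conn p) \<mu> \<omega>"
      then show "abs_l2_form \<omega> \<bullet> abs_l2_form g = 0"
        using \<nu> by (intro S_eigen_orthogonal[OF _ g(1) _ g(2)]) (auto simp: eigenform_def intro!: AE_I2)
    qed
  qed
  moreover have "closed {u. u \<bullet> abs_l2_form g = 0}"
    by (intro closed_Collect_eq continuous_intros)
  ultimately have "P_spec s p \<subseteq> {u. u \<bullet> abs_l2_form g = 0}"
    unfolding P_spec_def by (intro closure_minimal)
  then show ?thesis by (auto simp: orthogonal_comp_iff)
qed

lemma mode_orthogonal_P_spec:
  shows "freq b p k \<noteq> 0 \<Longrightarrow> mode_l2 b k (pol (flip s) (sgn (freq b p k)) v) \<in> (P_spec s p)\<^sup>\<bottom>"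
    and "freq b p k = 0 \<Longrightarrow> mode_l2 b k v \<in> (P_spec s p)\<^sup>\<bottom>"
proof -
  assume f: "freq b p k \<noteq> 0"
  then show "mode_l2 b k (pol (flip s) (sgn (freq b p k)) v) \<in> (P_spec s p)\<^sup>\<bottom>"
    unfolding mode_l2_def
    by (intro eigenform_orthogonal_P_spec[where \<nu> = "- (sgn_of s * norm (freq b p k))"] AE_I2)
      (auto simp: smooth_mode mode_eigen(1) has_sign_sgn_of)
next
  assume f: "freq b p k = 0"
  then show "mode_l2 b k v \<in> (P_spec s p)\<^sup>\<bottom>"
    unfolding mode_l2_def
    by (intro eigenform_orthogonal_P_spec[where \<nu> = 0] AE_I2)
      (auto simp: smooth_mode mode_eigen(2) has_sign_sgn_of)
qed

lemma mode_l2_split: "mode_l2 b k v = mode_l2 b k (pol s d v) + mode_l2 b k (pol (flip s) d v)"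
  by (simp add: linear_add[OF mode_l2_linear, symmetric] pol_flip_add)

lemma P_spec_proj_mode:
  "blinfun_apply (orth_proj (P_spec s p)) (mode_l2 b k v) =
    (if freq b p k = 0 then 0 else mode_l2 b k (pol s (sgn (freq b p k)) v))"
proof (cases "freq b p k = 0")
  case True
  then show ?thesis
    using is_orth_proj_kernel[OF orth_proj_P_spec subspace_P_spec] mode_orthogonal_P_spec(2) by simp
next
  case False
  have "blinfun_apply (orth_proj (P_spec s p)) (mode_l2 b k v) = mode_l2 b k (pol s (sgn (freq b p k)) v)"
  proof (rule is_orth_proj_apply[OF orth_proj_P_spec subspace_P_spec mode_in_P_spec[OF False]])
    have "mode_l2 b k v - mode_l2 b k (pol s (sgn (freq b p k)) v) = mode_l2 b k (pol (flip s) (sgn (freq b p k)) v)"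
      using mode_l2_split[of b k v s "sgn (freq b p k)"] by simp
    then show "mode_l2 b k v - mode_l2 b k (pol s (sgn (freq b p k)) v) \<in> (P_spec s p)\<^sup>\<bottom>"
      using mode_orthogonal_P_spec(1)[OF False] by simp
  qed
  then show ?thesis using False by simp
qed

lemma lattice_pt_inject: "lattice_pt k = lattice_pt l \<longleftrightarrow> k = l"
  by (auto simp: lattice_pt_def complex_eq_iff prod_eq_iff)

text \<open>
  For the parameter \<open>k / 2\<close> the first mode is a zero mode, while the second is a sum of two
  eigenforms with nonzero eigenvalues.
\<close>

lemma mode_l2_True_orthogonal:
  assumes "k \<noteq> l"
  shows "mode_l2 True k v \<bullet> mode_l2 True l w = 0"
proof -
  define p where "p = lattice_pt k / 2"
  have k: "freq True p k = 0" by (simp add: freq_def p_def)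
  have l: "freq True p l \<noteq> 0" using assms by (simp add: freq_def p_def lattice_pt_inject[of l k])
  have "mode_l2 True l (pol s (sgn (freq True p l)) w) \<bullet> mode_l2 True k v = 0" for s
    using mode_orthogonal_P_spec(2)[OF k] mode_in_P_spec[OF l] unfolding orthogonal_comp_iff by blast
  then show ?thesis
    by (subst inner_commute, subst mode_l2_split[of True l w Plus "sgn (freq True p l)"])
      (simp add: inner_add_left)
qed

lemma inner_mode_l2_True: "mode_l2 True k v \<bullet> mode_l2 True k w = 2 * (2 * pi)\<^sup>2 * (v \<bullet> w)"
proof -
  have "(z * a) \<bullet> (z * b) = a \<bullet> b" if "norm z = 1" for z a b :: complex
  proof -
    have "(z * a) \<bullet> (z * b) = ((Re z)\<^sup>2 + (Im z)\<^sup>2) * (a \<bullet> b)"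
      by (simp add: inner_complex_def power2_eq_square algebra_simps)
    then show ?thesis using that by (simp add: cmod_power2[symmetric])
  qed
  then have "(\<integral>x. mode True k v x \<bullet> mode True k w x \<partial>torus_measure) = (\<integral>x. v \<bullet> w \<partial>torus_measure)"
    by (intro Bochner_Integration.integral_cong[OF refl])
      (auto simp: mode_def slot_fibre_def slot_def cscale_def split_beta inner_prod_def norm_wave)
  then show ?thesis
    by (simp add: mode_l2_def inner_abs_l2_form square_integrable_mode measure_torus)
qed

section \<open>The finite dimensional correction at half lattice points\<close>

text \<open>
  At most the frequency \<open>k = 2 p\<close> contributes, and the space is zero off the half lattice.  The
  sign of \<open>\<theta>\<close> comes from \<open>k - 2 (p + t \<theta>) = - 2 t \<theta>\<close>.
\<close>

definition corner_space :: "sign \<Rightarrow> complex \<Rightarrow> complex \<Rightarrow> l2_form set" where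
  "corner_space s p \<theta> = span {mode_l2 True k (pol s (- \<theta>) v) | k v. freq True p k = 0}"

lemma freq_zero_unique: "freq True p k = 0 \<Longrightarrow> freq True p l = 0 \<longleftrightarrow> l = k"
  unfolding freq_def by (simp add: lattice_pt_inject[of l k, symmetric])

lemma subspace_corner: "subspace (corner_space s p \<theta>)"
  unfolding corner_space_def by (rule subspace_span)

lemma corner_space_empty: "(\<And>k. freq True p k \<noteq> 0) \<Longrightarrow> corner_space s p \<theta> = {0}"
  by (simp add: corner_space_def)

lemma corner_space_range:
  assumes "freq True p k = 0"
  shows "corner_space s p \<theta> = mode_l2 True k ` range (pol s (- \<theta>))"
proof -
  have "{mode_l2 True l (pol s (- \<theta>) v) | l v. freq True p l = 0} = mode_l2 True k ` range (pol s (- \<theta>))"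
  proof (intro set_eqI iffI)
    fix u assume "u \<in> {mode_l2 True l (pol s (- \<theta>) v) | l v. freq True p l = 0}"
    then obtain l v where "u = mode_l2 True l (pol s (- \<theta>) v)" "freq True p l = 0" by blast
    then have "u = mode_l2 True k (pol s (- \<theta>) v)" using freq_zero_unique[OF assms] by simp
    then show "u \<in> mode_l2 True k ` range (pol s (- \<theta>))" by blast
  next
    fix u assume "u \<in> mode_l2 True k ` range (pol s (- \<theta>))"
    then obtain v where "u = mode_l2 True k (pol s (- \<theta>) v)" by blast
    then show "u \<in> {mode_l2 True l (pol s (- \<theta>) v) | l v. freq True p l = 0}" using assms by blast
  qed
  then show ?thesis
    unfolding corner_space_def
    by (simp add: span_eq_iff linear_subspace_image mode_l2_linear linear_pol)
qed

text \<open>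
  Up to a constant factor, the off-diagonal modes of one frequency form an isometric copy of the
  finite dimensional space of amplitudes.
\<close>

lemma closed_corner: "closed (corner_space s p \<theta>)"
proof (cases "\<exists>k. freq True p k = 0")
  case True
  then obtain k where k: "freq True p k = 0" by blast
  have sub: "subspace (range (pol s (- \<theta>)))" by (simp add: linear_subspace_image linear_pol)
  have "complete (mode_l2 True k ` range (pol s (- \<theta>)))"
  proof (rule complete_isometric_image[OF _ sub])
    show "sqrt 2 * (2 * pi) > 0" by simp
    show "bounded_linear (mode_l2 True k)" using mode_l2_linear by (simp add: linear_conv_bounded_linear)
    show "\<forall>x\<in>range (pol s (- \<theta>)). sqrt 2 * (2 * pi) * norm x \<le> norm (mode_l2 True k x)"
      by (simp add: norm_mode_l2_True)
    show "complete (range (pol s (- \<theta>)))" by (rule complete_subspace[OF sub])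
  qed
  then show ?thesis by (simp add: corner_space_range[OF k] complete_imp_closed)
next
  case False
  then have "corner_space s p \<theta> = {0}" by (intro corner_space_empty) blast
  then show ?thesis by simp
qed

lemma orth_proj_corner: "is_orth_proj (orth_proj (corner_space s p \<theta>)) (corner_space s p \<theta>)"
  using is_orth_proj_exists[OF subspace_corner closed_corner] orth_proj_eq[OF _ subspace_corner] by metis

lemma corner_orthogonalI:
  assumes "\<And>k v. freq True p k = 0 \<Longrightarrow> mode_l2 True k (pol s (- \<theta>) v) \<bullet> u = 0"
  shows "u \<in> (corner_space s p \<theta>)\<^sup>\<bottom>"
proof -
  have "corner_space s p \<theta> \<subseteq> {x. x \<bullet> u = 0}"
    unfolding corner_space_def
    by (rule span_minimal) (use assms in \<open>auto simp: subspace_def inner_add_left\<close>)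
  then show ?thesis by (auto simp: orthogonal_comp_iff)
qed

lemma corner_orthogonal_P_spec: "x \<in> P_spec s p \<Longrightarrow> y \<in> corner_space s p \<theta> \<Longrightarrow> x \<bullet> y = 0"
proof -
  have "corner_space s p \<theta> \<subseteq> (P_spec s p)\<^sup>\<bottom>"
    unfolding corner_space_def
    by (rule span_minimal[OF _ subspace_orthogonal_comp]) (use mode_orthogonal_P_spec(2) in blast)
  then show "x \<in> P_spec s p \<Longrightarrow> y \<in> corner_space s p \<theta> \<Longrightarrow> x \<bullet> y = 0"
    by (auto simp: orthogonal_comp_iff)
qed

lemma corner_proj_mode:
  assumes "norm \<theta> = 1"
  shows "blinfun_apply (orth_proj (corner_space s p \<theta>)) (mode_l2 b k v) =
    (if b \<and> freq True p k = 0 then mode_l2 True k (pol s (- \<theta>) v) else 0)"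
proof (cases "b \<and> freq True p k = 0")
  case True
  have "blinfun_apply (orth_proj (corner_space s p \<theta>)) (mode_l2 True k v) = mode_l2 True k (pol s (- \<theta>) v)"
  proof (rule is_orth_proj_apply[OF orth_proj_corner subspace_corner])
    show "mode_l2 True k (pol s (- \<theta>) v) \<in> corner_space s p \<theta>"
      using True by (auto simp: corner_space_range)
    have "mode_l2 True k v - mode_l2 True k (pol s (- \<theta>) v) = mode_l2 True k (pol (flip s) (- \<theta>) v)"
      using mode_l2_split[of True k v s "- \<theta>"] by simp
    moreover have "mode_l2 True k (pol (flip s) (- \<theta>) v) \<in> (corner_space s p \<theta>)\<^sup>\<bottom>"
    proof (rule corner_orthogonalI)
      fix l w assume "freq True p l = 0"
      then have "l = k" using True freq_zero_unique by blast
      then show "mode_l2 True l (pol s (- \<theta>) w) \<bullet> mode_l2 True k (pol (flip s) (- \<theta>) v) = 0"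
        using assms by (simp add: inner_mode_l2_True pol_orthogonal)
    qed
    ultimately show "mode_l2 True k v - mode_l2 True k (pol s (- \<theta>) v) \<in> (corner_space s p \<theta>)\<^sup>\<bottom>" by simp
  qed
  then show ?thesis using True by simp
next
  case False
  have "mode_l2 b k v \<in> (corner_space s p \<theta>)\<^sup>\<bottom>"
  proof (rule corner_orthogonalI)
    fix l w assume "freq True p l = 0"
    then show "mode_l2 True l (pol s (- \<theta>) w) \<bullet> mode_l2 b k v = 0"
      using False by (cases b) (auto intro: mode_l2_True_orthogonal mode_l2_slots_orthogonal)
  qed
  then have "blinfun_apply (orth_proj (corner_space s p \<theta>)) (mode_l2 b k v) = 0"
    using is_orth_proj_kernel[OF orth_proj_corner subspace_corner] by blast
  then show ?thesis by (simp only: if_not_P[OF False])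
qed

definition direction :: "complex \<Rightarrow> complex \<Rightarrow> int \<times> int \<Rightarrow> complex" where
  "direction p \<theta> k = (if freq True p k = 0 then - \<theta> else sgn (freq True p k))"

definition limit_space :: "sign \<Rightarrow> complex \<Rightarrow> complex \<Rightarrow> l2_form set" where
  "limit_space s p \<theta> = P_spec s p \<oplus>\<^sub>L corner_space s p \<theta>"

definition limit_proj :: "sign \<Rightarrow> complex \<Rightarrow> complex \<Rightarrow> l2_form \<Rightarrow>\<^sub>L l2_form" where
  "limit_proj s p \<theta> = orth_proj (P_spec s p) + orth_proj (corner_space s p \<theta>)"

lemma subspace_limit_space: "subspace (limit_space s p \<theta>)"
  unfolding limit_space_def by (intro subspace_dsum subspace_P_spec subspace_corner)

lemma is_orth_proj_limit: "is_orth_proj (limit_proj s p \<theta>) (limit_space s p \<theta>)"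
  unfolding limit_proj_def limit_space_def dsum_def
  by (rule is_orth_proj_sum[OF orth_proj_P_spec subspace_P_spec orth_proj_corner subspace_corner
        corner_orthogonal_P_spec])

lemma freq_False: "freq False p k = lattice_pt k" "lattice_pt k = 0 \<longleftrightarrow> k = (0, 0)"
  by (auto simp: freq_def lattice_pt_def complex_eq_iff prod_eq_iff)

lemma limit_proj_mode:
  assumes "norm \<theta> = 1"
  shows "blinfun_apply (limit_proj s p \<theta>) (mode_l2 True k v) = mode_l2 True k (pol s (direction p \<theta> k) v)"
    and "blinfun_apply (limit_proj s p \<theta>) (mode_l2 False k v) =
      (if k = (0, 0) then 0 else mode_l2 False k (pol s (sgn (lattice_pt k)) v))"
  by (simp_all add: limit_proj_def plus_blinfun.rep_eq P_spec_proj_mode corner_proj_mode[OF assms]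
      direction_def freq_False)

text \<open>
  Only the direction field depends on the parameters, so its uniform oscillation controls the
  gap distance.
\<close>

lemma limit_proj_diff_le:
  assumes \<theta>: "norm \<theta> = 1" "norm \<theta>' = 1"
    and d: "\<And>k. norm (direction p \<theta> k - direction p' \<theta>' k) \<le> \<delta>" and \<delta>: "\<delta> \<ge> 0"
  shows "norm (limit_proj s p \<theta> - limit_proj s p' \<theta>') \<le> \<delta>"
proof -
  define E where "E i = (case i of None \<Rightarrow> span {mode_l2 False k v | k v. True}
    | Some k \<Rightarrow> range (mode_l2 True k))" for i
  let ?T = "limit_proj s p \<theta> - limit_proj s p' \<theta>'"
  have FT: "x \<bullet> mode_l2 True k v = 0" if "x \<in> span {mode_l2 False k v | k v. True}" for x k v
  proof -
    have "span {mode_l2 False k v | k v. True} \<subseteq> {x. x \<bullet> mode_l2 True k v = 0}"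
      by (rule span_minimal) (auto simp: subspace_def inner_add_left intro: mode_l2_slots_orthogonal)
    then show ?thesis using that by blast
  qed
  have T0: "blinfun_apply ?T x = 0" if "x \<in> span {mode_l2 False k v | k v. True}" for x
  proof -
    have "span {mode_l2 False k v | k v. True} \<subseteq> {x. blinfun_apply ?T x = 0}"
      by (rule span_minimal)
        (auto simp: subspace_def minus_blinfun.rep_eq limit_proj_mode \<theta> blinfun.add_right blinfun.scaleR_right)
    then show ?thesis using that by blast
  qed
  have T1: "blinfun_apply ?T (mode_l2 True k v) =
      mode_l2 True k (pol s (direction p \<theta> k) v - pol s (direction p' \<theta>' k) v)" for k v
    by (simp add: minus_blinfun.rep_eq limit_proj_mode \<theta> linear_diff[OF mode_l2_linear])
  show ?thesis
  proof (rule block_operator_norm_le[where E = E, OF _ _ _ _ _ \<delta>])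
    show "subspace (E i)" for i
      by (cases i) (simp_all add: E_def linear_subspace_image mode_l2_linear)
    show "x \<bullet> y = 0" if ij: "i \<noteq> j" and xi: "x \<in> E i" and yj: "y \<in> E j" for i j x y
    proof -
      consider l where "i = None" "j = Some l" | k where "i = Some k" "j = None"
        | k l where "i = Some k" "j = Some l" "k \<noteq> l"
        using ij by (cases i; cases j) blast+
      then show ?thesis
      proof cases
        case 1
        then obtain w where "y = mode_l2 True l w" using yj by (auto simp: E_def)
        then show ?thesis using FT[of x l w] xi 1 by (simp add: E_def)
      next
        case 2
        then obtain w where "x = mode_l2 True k w" using xi by (auto simp: E_def)
        then show ?thesis using FT[of y k w] yj 2 by (simp add: E_def inner_commute)
      next
        case 3
        then show ?thesis using xi yj mode_l2_True_orthogonal[OF 3(3)] by (auto simp: E_def)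
      qed
    qed
    have "mode_l2 b k v \<in> (\<Union>i. E i)" for b k v
    proof (cases b)
      case True
      then have "mode_l2 b k v \<in> E (Some k)" by (simp add: E_def)
      then show ?thesis by blast
    next
      case False
      have "mode_l2 False k v \<in> span {mode_l2 False k v | k v. True}" by (rule span_base) blast
      then have "mode_l2 b k v \<in> E None" using False by (simp add: E_def)
      then show ?thesis by blast
    qed
    then have "all_modes \<subseteq> (\<Union>i. E i)" unfolding all_modes_def by blast
    then have "closure (span all_modes) \<subseteq> closure (span (\<Union>i. E i))" by (intro closure_mono span_mono)
    then show "closure (span (\<Union>i. E i)) = UNIV" using closure_span_modes by blast
    show "blinfun_apply ?T x \<in> E i" if "x \<in> E i" for i x
      using that T0[of x] by (auto simp: E_def T1 span_zero split: option.splits)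
    show "norm (blinfun_apply ?T x) \<le> \<delta> * norm x" if xi: "x \<in> E i" for i x
    proof (cases i)
      case None
      then show ?thesis using xi T0[of x] \<delta> by (simp add: E_def)
    next
      case (Some k)
      then obtain v where v: "x = mode_l2 True k v" using xi by (auto simp: E_def)
      have "norm (direction p \<theta> k - direction p' \<theta>' k) * norm v / 2 \<le> \<delta> * norm v"
      proof -
        have "norm (direction p \<theta> k - direction p' \<theta>' k) * norm v \<le> \<delta> * norm v"
          using d by (rule mult_right_mono) simp
        moreover have "\<delta> * norm v \<ge> 0" using \<delta> by simp
        ultimately show ?thesis by linarith
      qed
      then have "sqrt 2 * (2 * pi) * (norm (direction p \<theta> k - direction p' \<theta>' k) * norm v / 2)
          \<le> sqrt 2 * (2 * pi) * (\<delta> * norm v)"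
        by (rule mult_left_mono) simp
      then show ?thesis
        by (simp add: v T1 norm_mode_l2_True norm_pol_diff mult_ac)
    qed
  qed
qed


section \<open>Limits of the spectral subspaces\<close>

text \<open>
  The decisive point is that the bound involves the length of one of the two vectors only.
\<close>

lemma norm_sgn_diff_le:
  fixes a b :: "'a::real_normed_vector"
  assumes "a \<noteq> 0"
  shows "norm (sgn a - sgn b) \<le> 2 * norm (a - b) / norm a"
proof -
  have eq: "norm a *\<^sub>R (sgn a - sgn b) = (a - b) + (norm b - norm a) *\<^sub>R sgn b"
    by (cases "b = 0") (simp_all add: sgn_div_norm algebra_simps assms)
  have "norm a * norm (sgn a - sgn b) = norm (norm a *\<^sub>R (sgn a - sgn b))" by simp
  also have "\<dots> \<le> norm (a - b) + \<bar>norm b - norm a\<bar> * norm (sgn b)"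
    unfolding eq by (rule order_trans[OF norm_triangle_ineq]) simp
  also have "\<dots> \<le> norm (a - b) + \<bar>norm b - norm a\<bar> * 1"
    by (intro add_left_mono mult_left_mono) (auto simp: norm_sgn)
  also have "\<dots> \<le> 2 * norm (a - b)"
    using norm_triangle_ineq3[of a b] by (simp add: abs_minus_commute)
  finally show ?thesis using assms by (simp add: field_simps)
qed

lemma freq_gap: "\<exists>m>0. \<forall>k. freq True p k \<noteq> 0 \<longrightarrow> norm (freq True p k) \<ge> m"
proof -
  define F where "F = {k. norm (freq True p k) < 1}"
  have h: "\<lfloor>y - 1\<rfloor> \<le> a \<and> a \<le> \<lceil>y + 1\<rceil>" if "\<bar>real_of_int a - y\<bar> < 1" for a y
    unfolding floor_le_iff le_ceiling_iff using that by linarith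
  have "F \<subseteq> {\<lfloor>2 * Re p - 1\<rfloor>..\<lceil>2 * Re p + 1\<rceil>} \<times> {\<lfloor>2 * Im p - 1\<rfloor>..\<lceil>2 * Im p + 1\<rceil>}"
  proof
    fix k assume "k \<in> F"
    then have "\<bar>Re (freq True p k)\<bar> < 1" "\<bar>Im (freq True p k)\<bar> < 1"
      using abs_Re_le_cmod[of "freq True p k"] abs_Im_le_cmod[of "freq True p k"] by (auto simp: F_def)
    then show "k \<in> {\<lfloor>2 * Re p - 1\<rfloor>..\<lceil>2 * Re p + 1\<rceil>} \<times> {\<lfloor>2 * Im p - 1\<rfloor>..\<lceil>2 * Im p + 1\<rceil>}"
      using h[of "fst k" "2 * Re p"] h[of "snd k" "2 * Im p"]
      by (simp add: mem_Times_iff freq_def lattice_pt_def)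
  qed
  then have fin: "finite F" by (rule finite_subset) auto
  define N where "N = insert 1 (norm ` freq True p ` (F - {k. freq True p k = 0}))"
  have N: "finite N" "N \<noteq> {}" using fin by (auto simp: N_def)
  have "Min N > 0" using N by (auto simp: N_def)
  moreover have "Min N \<le> norm (freq True p k)" if "freq True p k \<noteq> 0" for k
  proof (cases "k \<in> F")
    case True
    then have "norm (freq True p k) \<in> N" using that by (auto simp: N_def)
    then show ?thesis using N by simp
  next
    case False
    moreover have "Min N \<le> 1" using N by (simp add: N_def)
    ultimately show ?thesis by (simp add: F_def)
  qed
  ultimately show ?thesis by blast
qed

lemma limit_proj_off_lattice:
  "(\<And>k. freq True p k \<noteq> 0) \<Longrightarrow> limit_proj s p \<theta> = orth_proj (P_spec s p)"
  using is_orth_proj_range[OF orth_proj_corner subspace_corner, of s p \<theta>] corner_space_empty[of p s \<theta>]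
  unfolding limit_proj_def by (intro blinfun_eqI) (auto simp: plus_blinfun.rep_eq)

text \<open>
  Approaching \<open>p\<close> along \<open>\<theta>\<close>, the frequency that vanishes at \<open>p\<close> has constant direction \<open>- \<theta>\<close>,
  and the others stay away from zero, so that their directions converge uniformly.
\<close>

lemma P_spec_radial_limit:
  assumes \<theta>: "norm \<theta> = 1"
  shows "((\<lambda>t. orth_proj (P_spec s (p + of_real t * \<theta>))) \<longlongrightarrow> limit_proj s p \<theta>) (at_right 0)"
proof -
  obtain m where m: "m > 0" "\<And>k. freq True p k \<noteq> 0 \<Longrightarrow> norm (freq True p k) \<ge> m"
    using freq_gap by blast
  have est: "norm (orth_proj (P_spec s (p + of_real t * \<theta>)) - limit_proj s p \<theta>) \<le> 4 * t / m"
    if t: "0 < t" "t < m / 2" for t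
  proof -
    let ?q = "p + of_real t * \<theta>"
    have fq: "freq True ?q k = freq True p k - 2 * of_real t * \<theta>" for k
      by (simp add: freq_def algebra_simps)
    have nt: "norm (2 * of_real t * \<theta>) = 2 * t" using t \<theta> by (simp add: norm_mult)
    have ne: "freq True ?q k \<noteq> 0" for k
    proof (cases "freq True p k = 0")
      case True
      then show ?thesis using t \<theta> by (auto simp: fq)
    next
      case False
      then have "norm (2 * of_real t * \<theta>) < norm (freq True p k)" using m(2)[OF False] nt t by linarith
      then show ?thesis unfolding fq by auto
    qed
    have "norm (direction ?q \<theta> k - direction p \<theta> k) \<le> 4 * t / m" for k
    proof (cases "freq True p k = 0")
      case True
      have "sgn (freq True ?q k) = - \<theta>"
        using t \<theta> by (simp add: fq True sgn_div_norm norm_mult scaleR_conv_of_real)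
      then show ?thesis using True ne[of k] t m by (simp add: direction_def)
    next
      case False
      have "norm (direction ?q \<theta> k - direction p \<theta> k) = norm (sgn (freq True p k) - sgn (freq True ?q k))"
        using False ne[of k] by (simp add: direction_def norm_minus_commute)
      also have "\<dots> \<le> 2 * norm (freq True p k - freq True ?q k) / norm (freq True p k)"
        by (rule norm_sgn_diff_le[OF False])
      also have "\<dots> = 4 * t / norm (freq True p k)" using nt by (simp add: fq)
      also have "\<dots> \<le> 4 * t / m" using m(1) m(2)[OF False] t by (intro divide_left_mono mult_pos_pos) auto
      finally show ?thesis .
    qed
    then have "norm (limit_proj s ?q \<theta> - limit_proj s p \<theta>) \<le> 4 * t / m"
      using t m by (intro limit_proj_diff_le \<theta>) auto
    then show ?thesis by (simp add: limit_proj_off_lattice[OF ne])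
  qed
  have "((\<lambda>t. orth_proj (P_spec s (p + of_real t * \<theta>)) - limit_proj s p \<theta>) \<longlongrightarrow> 0) (at_right 0)"
  proof (rule Lim_null_comparison)
    show "\<forall>\<^sub>F t in at_right 0. norm (orth_proj (P_spec s (p + of_real t * \<theta>)) - limit_proj s p \<theta>) \<le> 4 * t / m"
      unfolding eventually_at_right_field using est m by (intro exI[of _ "m / 2"]) auto
    have "((\<lambda>t. 4 * t / m) \<longlongrightarrow> 4 * 0 / m) (at_right 0)" by (intro tendsto_intros) (use m in auto)
    then show "((\<lambda>t. 4 * t / m) \<longlongrightarrow> 0) (at_right 0)" by simp
  qed
  then show ?thesis by (simp add: LIM_zero_iff)
qed

lemma gap_Lim_P_spec:
  assumes "norm \<theta> = 1"
  shows "gap_Lim (at_right 0) (\<lambda>t. P_spec s (p + of_real t * \<theta>)) = limit_space s p \<theta>"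
proof -
  have "Lim (at_right 0) (\<lambda>t. orth_proj (P_spec s (p + of_real t * \<theta>))) = limit_proj s p \<theta>"
    by (rule tendsto_Lim[OF _ P_spec_radial_limit[OF assms]]) simp
  then show ?thesis
    unfolding gap_Lim_def by (simp add: is_orth_proj_range[OF is_orth_proj_limit subspace_limit_space])
qed

lemma K_spec_eq_corner:
  assumes "norm \<theta> = 1"
  shows "K_spec s p \<theta> = corner_space s p \<theta>"
proof -
  have "x \<in> corner_space s p \<theta>" if x: "x \<in> limit_space s p \<theta>" "x \<in> (P_spec s p)\<^sup>\<bottom>" for x
  proof -
    obtain a c where ac: "x = a + c" "a \<in> P_spec s p" "c \<in> corner_space s p \<theta>"
      using x(1) by (auto simp: limit_space_def dsum_def)
    have "a \<bullet> x = 0" using x(2) ac(2) by (auto simp: orthogonal_comp_iff)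
    then have "a \<bullet> a = 0" using corner_orthogonal_P_spec[OF ac(2,3)] by (simp add: ac(1) inner_add_right)
    then show ?thesis using ac by simp
  qed
  moreover have "corner_space s p \<theta> \<subseteq> limit_space s p \<theta>"
    unfolding limit_space_def dsum_def using subspace_0[OF subspace_P_spec] by force
  moreover have "corner_space s p \<theta> \<subseteq> (P_spec s p)\<^sup>\<bottom>"
    using corner_orthogonal_P_spec by (auto simp: orthogonal_comp_iff)
  ultimately show ?thesis
    unfolding K_spec_def gap_Lim_P_spec[OF assms] by blast
qed

section \<open>The diagonal and off-diagonal parts\<close>

definition Ri_fibre :: "fibre \<Rightarrow> fibre" where
  "Ri_fibre w = ((fst (fst w), 0), ((fst (fst (fst (snd w))), 0), (fst (snd (fst (snd w))), 0)), (fst (snd (snd w)), 0))"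

lemma bounded_linear_Ri_fibre: "bounded_linear Ri_fibre"
  by (rule linear_conv_bounded_linear[THEN iffD1], rule linearI) (auto simp: Ri_fibre_def)

lemma norm_Ri_fibre_le: "norm (Ri_fibre w) \<le> norm w"
  by (auto simp: Ri_fibre_def norm_prod_def intro!: real_sqrt_le_mono add_mono)

lemma square_integrable_Ri:
  assumes "square_integrable f"
  shows "square_integrable (\<lambda>x. Ri_fibre (f x))"
  unfolding square_integrable_def
proof
  have "Ri_fibre \<in> borel_measurable borel"
    by (intro borel_measurable_continuous_onI linear_continuous_on bounded_linear_Ri_fibre)
  then show m: "(\<lambda>x. Ri_fibre (f x)) \<in> borel_measurable torus_measure"
    using assms unfolding square_integrable_def by (blast intro: measurable_compose)
  show "integrable torus_measure (\<lambda>x. (norm (Ri_fibre (f x)))\<^sup>2)"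
  proof (rule Bochner_Integration.integrable_bound)
    show "integrable torus_measure (\<lambda>x. (norm (f x))\<^sup>2)" using assms by (simp add: square_integrable_def)
    show "AE x in torus_measure. norm ((norm (Ri_fibre (f x)))\<^sup>2) \<le> norm ((norm (f x))\<^sup>2)"
      by (intro AE_I2) (simp add: power_mono norm_Ri_fibre_le)
  qed (use m in measurable)
qed

lift_definition Ri_l2 :: "l2_form \<Rightarrow> l2_form" is "\<lambda>f x. Ri_fibre (f x)"
  by (auto simp: l2_rel_def square_integrable_Ri)

lemma abs_l2_form_Ri: "square_integrable f \<Longrightarrow> Ri_l2 (abs_l2_form f) = abs_l2_form (\<lambda>x. Ri_fibre (f x))"
  by (intro Ri_l2.abs_eq l2_rel_refl)

lemma bounded_linear_Ri_l2: "bounded_linear Ri_l2"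
proof (rule bounded_linear_intro[where K = 1])
  note L = linear_simps[OF bounded_linear_Ri_fibre]
  fix u v :: l2_form and r :: real
  obtain f g where f: "square_integrable f" "u = abs_l2_form f" and g: "square_integrable g" "v = abs_l2_form g"
    using l2_form_cases by metis
  show "Ri_l2 (u + v) = Ri_l2 u + Ri_l2 v"
    using f(1) g(1) by (simp add: f(2) g(2) abs_l2_form_add abs_l2_form_Ri square_integrable_add square_integrable_Ri L)
  show "Ri_l2 (r *\<^sub>R u) = r *\<^sub>R Ri_l2 u"
    using f(1) by (simp add: f(2) abs_l2_form_scaleR abs_l2_form_Ri square_integrable_scaleR square_integrable_Ri L)
  have "(\<integral>x. (norm (Ri_fibre (f x)))\<^sup>2 \<partial>torus_measure) \<le> (\<integral>x. (norm (f x))\<^sup>2 \<partial>torus_measure)"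
    using f(1) square_integrable_Ri[OF f(1)] unfolding square_integrable_def
    by (intro integral_mono power_mono norm_Ri_fibre_le) auto
  then have "(norm (Ri_l2 u))\<^sup>2 \<le> (norm u)\<^sup>2"
    using f(1) by (simp add: f(2) abs_l2_form_Ri norm_abs_l2_form square_integrable_Ri)
  then have "norm (Ri_l2 u) \<le> norm u" by (rule power2_le_imp_le) simp
  then show "norm (Ri_l2 u) \<le> norm u * 1" by simp
qed

lemma Ri_mode_l2: "Ri_l2 (mode_l2 b k v) = (if b then 0 else mode_l2 b k v)"
proof -
  have "Ri_fibre (mode b k v x) = (if b then 0 else mode b k v x)" for x
    by (auto simp: Ri_fibre_def mode_def slot_fibre_def slot_def split_beta prod_eq_iff)
  then show ?thesis
    by (simp add: mode_l2_def abs_l2_form_Ri square_integrable_mode zero_l2_form_def)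
qed

lemma l2_valued_abs: "square_integrable f \<Longrightarrow> l2_valued V (abs_l2_form f) \<longleftrightarrow> (AE x in torus_measure. f x \<in> valued_in V)"
  by (intro l2_valued.abs_eq l2_rel_refl)

lemma Ri_l2_valued: "l2_valued Ri (Ri_l2 u)" "l2_valued Cj (u - Ri_l2 u)"
proof -
  obtain f where f: "square_integrable f" "u = abs_l2_form f" by (rule l2_form_cases)
  have v: "Ri_fibre w \<in> valued_in Ri" "w - Ri_fibre w \<in> valued_in Cj" for w
    by (simp_all add: valued_in_def Ri_def Cj_def Ri_fibre_def mem_Times_iff)
  show "l2_valued Ri (Ri_l2 u)" "l2_valued Cj (u - Ri_l2 u)"
    using f(1) v by (simp_all add: f(2) abs_l2_form_Ri abs_l2_form_diff l2_valued_abs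
        square_integrable_Ri square_integrable_diff)
qed

text \<open>
  The spectral projection commutes with the projection onto diagonal forms, because each mode is
  either diagonal or off-diagonal and stays so.
\<close>

lemma P_spec_split: "P_spec s p = P_spec_Ri s p \<oplus>\<^sub>L P_spec_Cj s p"
proof
  let ?Q = "orth_proj (P_spec s p)"
  show "P_spec s p \<subseteq> P_spec_Ri s p \<oplus>\<^sub>L P_spec_Cj s p"
  proof
    fix u assume u: "u \<in> P_spec s p"
    have "(\<lambda>x. blinfun_apply ?Q (Ri_l2 x)) = (\<lambda>x. Ri_l2 (blinfun_apply ?Q x))"
      by (rule bounded_linear_eq_on_modes)
        (auto simp: P_spec_proj_mode Ri_mode_l2 linear_simps(3)[OF bounded_linear_Ri_l2]
          intro: bounded_linear_compose[OF blinfun.bounded_linear_right bounded_linear_Ri_l2]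
          bounded_linear_compose[OF bounded_linear_Ri_l2 blinfun.bounded_linear_right])
    then have "blinfun_apply ?Q (Ri_l2 u) = Ri_l2 (blinfun_apply ?Q u)" by (rule fun_cong)
    then have R: "Ri_l2 u \<in> P_spec s p"
      using u is_orth_proj_fixes[OF orth_proj_P_spec subspace_P_spec] by metis
    then have "u - Ri_l2 u \<in> P_spec s p" using u by (simp add: subspace_diff subspace_P_spec)
    then have "Ri_l2 u \<in> P_spec_Ri s p" "u - Ri_l2 u \<in> P_spec_Cj s p"
      using R Ri_l2_valued by (auto simp: P_spec_Ri_def P_spec_Cj_def)
    moreover have "u = Ri_l2 u + (u - Ri_l2 u)" by simp
    ultimately show "u \<in> P_spec_Ri s p \<oplus>\<^sub>L P_spec_Cj s p" unfolding dsum_def by blast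
  qed
  show "P_spec_Ri s p \<oplus>\<^sub>L P_spec_Cj s p \<subseteq> P_spec s p"
    by (auto simp: dsum_def P_spec_Ri_def P_spec_Cj_def subspace_add subspace_P_spec)
qed

lemma dsum_assoc: "(A \<oplus>\<^sub>L B) \<oplus>\<^sub>L C = A \<oplus>\<^sub>L (B \<oplus>\<^sub>L C)"
  unfolding dsum_def by (auto simp: add.assoc) (metis add.assoc)+

lemma dsum_commute: "A \<oplus>\<^sub>L B = B \<oplus>\<^sub>L A"
  unfolding dsum_def by (auto simp: add.commute) (metis add.commute)+

lemma rep_blowup_norm: "norm (snd (rep_blowup x)) = 1"
  using Quotient_rep_reflp[OF Quotient_blowup, of x] by (simp add: blowup_rel_def)

text \<open>
  Regrouping the summands: the two parts of the spectral subspace reassemble \<open>P_spec\<close>, and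
  adding \<open>K_spec\<close> gives the radial limit.
\<close>

lemma curly_P_eq:
  "curly_P s L x = limit_space s (fst (rep_blowup x)) (snd (rep_blowup x)) \<oplus>\<^sub>L L x"
proof -
  obtain p \<theta> where r: "rep_blowup x = (p, \<theta>)" by fastforce
  have "norm \<theta> = 1" using rep_blowup_norm[of x] by (simp add: r)
  then have "curly_P s L x = (P_spec_Ri s p \<oplus>\<^sub>L L x) \<oplus>\<^sub>L (P_spec_Cj s p \<oplus>\<^sub>L corner_space s p \<theta>)"
    by (simp add: curly_P_def r K_spec_eq_corner)
  also have "\<dots> = ((P_spec_Ri s p \<oplus>\<^sub>L P_spec_Cj s p) \<oplus>\<^sub>L corner_space s p \<theta>) \<oplus>\<^sub>L L x"
    by (metis dsum_assoc dsum_commute)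
  finally show ?thesis by (simp add: r limit_space_def P_spec_split[symmetric])
qed

section \<open>Harmonic forms and Lagrangians\<close>

lemma C1_ext_d_codiff:
  assumes "Ck_torus (Suc (Suc 0)) \<omega>"
  shows "C1_torus (ext_d \<omega>)" "C1_torus (codiff \<omega>)"
proof -
  have C: "C1_torus \<omega>" "C1_torus (pd_m \<omega>)" "C1_torus (pd_l \<omega>)" using assms by auto
  show "C1_torus (ext_d \<omega>)"
    by (rule C1_torus_cong(1)[OF C1_torus_linear_combination[OF linear_mats(3,4) C(2,3)]])
      (rule ext_d_matrix[OF C(1)])
  show "C1_torus (codiff \<omega>)"
    by (rule C1_torus_cong(1)[OF C1_torus_linear_combination[OF
          bounded_linear_minus[OF linear_mats(5)] bounded_linear_minus[OF linear_mats(6)] C(2,3)]])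
      (simp add: codiff_matrix[OF C(1)])
qed

lemma continuous_ext_d_codiff:
  assumes "C1_torus \<omega>"
  shows "continuous_on torus (ext_d \<omega>)" "continuous_on torus (codiff \<omega>)"
proof -
  note cont = linear_mats[THEN bounded_linear.continuous_on]
  have c: "continuous_on torus (pd_m \<omega>)" "continuous_on torus (pd_l \<omega>)" using assms by auto
  have "continuous_on torus (\<lambda>x. d_mat_m (pd_m \<omega> x) + d_mat_l (pd_l \<omega> x))"
    "continuous_on torus (\<lambda>x. - d_adj_m (pd_m \<omega> x) - d_adj_l (pd_l \<omega> x))"
    by (intro continuous_intros cont c)+
  then show "continuous_on torus (ext_d \<omega>)" "continuous_on torus (codiff \<omega>)"
    using ext_d_matrix[OF assms] codiff_matrix[OF assms] by (simp_all cong: continuous_on_cong)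
qed

text \<open>
  Pairing the Laplacian of \<open>\<omega>\<close> with \<open>\<omega>\<close> itself gives the sum of the squared norms of \<open>d \<omega>\<close> and of
  its codifferential.
\<close>

lemma harmonic_ext_d_codiff_zero:
  assumes \<omega>: "smooth_torus \<omega>" and lap: "\<And>x. x \<in> torus \<Longrightarrow> laplacian \<omega> x = 0"
  shows "AE x in torus_measure. ext_d \<omega> x = 0 \<and> codiff \<omega> x = 0"
proof -
  have C2: "Ck_torus (Suc (Suc 0)) \<omega>" using \<omega> unfolding smooth_torus_def by blast
  have C1: "C1_torus \<omega>" by (rule smooth_torus_C1[OF \<omega>])
  note D1 = C1_ext_d_codiff[OF C2]
  have c: "continuous_on torus \<omega>" "continuous_on torus (ext_d \<omega>)" "continuous_on torus (codiff \<omega>)"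
    "continuous_on torus (ext_d (codiff \<omega>))" "continuous_on torus (codiff (ext_d \<omega>))"
    using C1_continuous[OF C1] C1_continuous[OF D1(1)] C1_continuous[OF D1(2)]
      continuous_ext_d_codiff[OF D1(1)] continuous_ext_d_codiff[OF D1(2)] by blast+
  have "0 = (\<integral>x. laplacian \<omega> x \<bullet> \<omega> x \<partial>torus_measure)"
  proof -
    have "(\<integral>x. laplacian \<omega> x \<bullet> \<omega> x \<partial>torus_measure) = (\<integral>x. 0 \<partial>torus_measure)"
      by (rule Bochner_Integration.integral_cong[OF refl]) (simp add: lap)
    then show ?thesis by simp
  qed
  also have "\<dots> = (\<integral>x. ext_d (codiff \<omega>) x \<bullet> \<omega> x \<partial>torus_measure) + (\<integral>x. codiff (ext_d \<omega>) x \<bullet> \<omega> x \<partial>torus_measure)"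
    unfolding laplacian_def inner_add_left
    by (intro Bochner_Integration.integral_add integrable_torusI continuous_intros c)
  also have "\<dots> = (\<integral>x. codiff \<omega> x \<bullet> codiff \<omega> x \<partial>torus_measure) + (\<integral>x. ext_d \<omega> x \<bullet> ext_d \<omega> x \<partial>torus_measure)"
    using ext_d_codiff_adjoint[OF D1(2) C1] ext_d_codiff_adjoint[OF C1 D1(1)] by (simp add: inner_commute)
  also have "\<dots> = (\<integral>x. codiff \<omega> x \<bullet> codiff \<omega> x + ext_d \<omega> x \<bullet> ext_d \<omega> x \<partial>torus_measure)"
    by (intro Bochner_Integration.integral_add[symmetric] integrable_torusI continuous_intros c)
  finally have "AE x in torus_measure. codiff \<omega> x \<bullet> codiff \<omega> x + ext_d \<omega> x \<bullet> ext_d \<omega> x = 0"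
    by (subst (asm) eq_commute, subst (asm) integral_nonneg_eq_0_iff_AE)
      (auto intro!: integrable_torusI continuous_intros c)
  then show ?thesis
    by (rule AE_mp) (auto intro!: AE_I2 simp: add_nonneg_eq_0_iff)
qed

text \<open>
  A diagonal form commutes with every diagonal connection, so the operator sees only its exterior
  derivative and codifferential: a diagonal harmonic form is a zero mode for every \<open>p\<close>.
\<close>

lemma harmonic_orthogonal_P_spec:
  assumes "h \<in> harmonic_Ri"
  shows "h \<in> (P_spec s p)\<^sup>\<bottom>"
proof -
  obtain \<omega> where \<omega>: "smooth_torus \<omega>" "\<And>x. x \<in> torus \<Longrightarrow> \<omega> x \<in> valued_in Ri"
    "\<And>x. x \<in> torus \<Longrightarrow> laplacian \<omega> x = 0" "h = abs_l2_form \<omega>"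
    using assms by (auto simp: harmonic_Ri_def)
  note C1 = smooth_torus_C1[OF \<omega>(1)]
  have S0: "S_op (conn p) \<omega> x = 0 *\<^sub>R \<omega> x" if x: "x \<in> torus" and 0: "ext_d \<omega> x = 0" "codiff \<omega> x = 0" for x
  proof -
    have "ad_fibre t (\<omega> x) = 0" for t
      using \<omega>(2)[OF x] by (auto simp: valued_in_def Ri_def ad_fibre_def bracket_su2_i zero_prod_def)
    then have "S_op (conn p) \<omega> x = S_mat_m (pd_m \<omega> x) + S_mat_l (pd_l \<omega> x)"
      by (simp add: S_op_matrix[OF C1 x])
    also have "\<dots> = 0"
      using 0 unfolding ext_d_matrix[OF C1 x] codiff_matrix[OF C1 x]
      by (simp add: mat_defs split_beta prod_eq_iff algebra_simps add_eq_0_iff neg_eq_iff_add_eq_0 add.commute)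
    finally show ?thesis by simp
  qed
  have "AE x in torus_measure. S_op (conn p) \<omega> x = 0 *\<^sub>R \<omega> x"
    using harmonic_ext_d_codiff_zero[OF \<omega>(1,3)]
    by (rule AE_mp) (use S0 in \<open>auto intro!: AE_I2\<close>)
  then show ?thesis
    unfolding \<omega>(4) using has_sign_sgn_of(3) by (rule eigenform_orthogonal_P_spec[OF \<omega>(1)])
qed

lemma harmonic_orthogonal_mode:
  assumes h: "h \<in> harmonic_Ri" and ne: "b \<or> k \<noteq> (0, 0)"
  shows "h \<bullet> mode_l2 b k v = 0"
proof (cases b)
  case True
  obtain \<omega> where \<omega>: "smooth_torus \<omega>" "\<And>x. x \<in> torus \<Longrightarrow> \<omega> x \<in> valued_in Ri" "h = abs_l2_form \<omega>"
    using h by (auto simp: harmonic_Ri_def)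
  have "\<omega> x \<bullet> mode True k v x = 0" if "x \<in> torus" for x
    using \<omega>(2)[OF that] by (auto simp: valued_in_def Ri_def mode_def slot_fibre_def slot_def split_beta inner_prod_def)
  then show ?thesis
    unfolding mode_l2_def \<omega>(3) using True
    by (intro pointwise_orthogonal_l2)
      (auto simp: square_integrable_mode intro!: square_integrable_continuous C1_continuous smooth_torus_C1 \<omega>)
next
  case False
  then have f: "freq False 0 k \<noteq> 0" using ne by (simp add: freq_False)
  have "mode_l2 False k (pol s (sgn (freq False 0 k)) v) \<bullet> h = 0" for s
    using harmonic_orthogonal_P_spec[OF h] mode_in_P_spec[OF f] unfolding orthogonal_comp_iff by blast
  then show ?thesis
    using False by (subst inner_commute, subst mode_l2_split[of b k v Plus "sgn (freq False 0 k)"])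
      (simp add: inner_add_left)
qed

lemma constant_mode_harmonic: "mode_l2 False (0, 0) v \<in> harmonic_Ri"
proof -
  let ?m = "mode False (0, 0) v"
  note C1 = smooth_torus_C1[OF smooth_mode[of False "(0, 0)" v]]
  have z: "cscale 0 v = 0" by (auto simp: cscale_def zero_prod_def split: prod.splits)
  have pd: "pd_m ?m x = 0" "pd_l ?m x = 0" for x
    by (simp_all add: pd_mode z linear_0[OF linear_mode])
  have mat0: "d_mat_m 0 = 0" "d_mat_l 0 = 0" "d_adj_m 0 = 0" "d_adj_l 0 = 0"
    by (auto simp: mat_defs split_beta prod_eq_iff)
  have d0: "ext_d f x = 0" "codiff f x = 0" if "x \<in> torus" "C1_torus f" "pd_m f x = 0" "pd_l f x = 0" for f x
    using that by (simp_all add: ext_d_matrix codiff_matrix mat0)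
  have "ext_d ?m x = 0" "codiff ?m x = 0" if "x \<in> torus" for x
    by (intro d0 that C1 pd)+
  then have "laplacian ?m x = 0" if "x \<in> torus" for x
    unfolding laplacian_def using that C1_torus_zero[of "ext_d ?m"] C1_torus_zero[of "codiff ?m"] d0[OF that]
    by simp
  moreover have "?m x \<in> valued_in Ri" for x
    by (auto simp: mode_def slot_fibre_def slot_def valued_in_def Ri_def split_beta)
  ultimately show ?thesis
    unfolding harmonic_Ri_def mode_l2_def using smooth_mode by blast
qed

text \<open>Harmonic forms on the flat torus are constant: they are orthogonal to all other modes.\<close>

lemma harmonic_Ri_eq_constants: "harmonic_Ri = range (mode_l2 False (0, 0))"
proof
  define K where "K w = abs_l2_form (\<lambda>x. w)" for w
  have sq: "square_integrable (\<lambda>x. w)" for w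
    by (intro square_integrable_continuous continuous_intros)
  have normK: "norm (K w) = sqrt 2 * (2 * pi) * norm w" for w
  proof -
    have "(norm (K w))\<^sup>2 = (sqrt 2 * (2 * pi) * norm w)\<^sup>2"
      by (simp add: K_def norm_abs_l2_form sq measure_torus power_mult_distrib)
    then show ?thesis by (rule power2_eq_imp_eq) auto
  qed
  have linK: "linear K"
    by (rule linearI) (simp_all add: K_def abs_l2_form_add abs_l2_form_scaleR sq)
  have "mode_l2 False (0, 0) v = K (slot_fibre False v)" for v
    unfolding mode_l2_def K_def
    by (subst abs_l2_form_eq_iff) (auto simp: square_integrable_mode sq mode_False_constant intro!: AE_I2)
  then have rng: "range (mode_l2 False (0, 0)) = K ` range (slot_fibre False)" by auto
  have sub: "subspace (range (slot_fibre False))" by (simp add: linear_subspace_image linear_slot_fibre)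
  have "complete (K ` range (slot_fibre False))"
  proof (rule complete_isometric_image[OF _ sub])
    show "sqrt 2 * (2 * pi) > 0" by simp
    show "bounded_linear K" using linK by (simp add: linear_conv_bounded_linear)
    show "complete (range (slot_fibre False))" by (rule complete_subspace[OF sub])
  qed (simp add: normK)
  then have cl: "closed (range (mode_l2 False (0, 0)))" by (simp add: rng complete_imp_closed)
  have sub: "subspace (range (mode_l2 False (0, 0)))" by (simp add: linear_subspace_image mode_l2_linear)
  show "harmonic_Ri \<subseteq> range (mode_l2 False (0, 0))"
  proof
    fix h assume h: "h \<in> harmonic_Ri"
    obtain y where y: "y \<in> range (mode_l2 False (0, 0))" "h - y \<in> (range (mode_l2 False (0, 0)))\<^sup>\<bottom>"
      using Hilbert_projection_exists[OF sub cl] by blast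
    have yh: "y \<in> harmonic_Ri" using y(1) constant_mode_harmonic by auto
    have "(h - y) \<bullet> mode_l2 b k v = 0" for b k v
    proof (cases "b \<or> k \<noteq> (0, 0)")
      case True
      then show ?thesis by (simp add: inner_diff_left harmonic_orthogonal_mode[OF h] harmonic_orthogonal_mode[OF yh])
    next
      case False
      then have "mode_l2 b k v \<in> range (mode_l2 False (0, 0))" by simp
      then have "mode_l2 b k v \<bullet> (h - y) = 0" using y(2) unfolding orthogonal_comp_iff by blast
      then show ?thesis by (subst inner_commute)
    qed
    then have "h - y = 0" by (rule zero_if_orthogonal_to_modes)
    then show "h \<in> range (mode_l2 False (0, 0))" using y(1) by simp
  qed
  show "range (mode_l2 False (0, 0)) \<subseteq> harmonic_Ri" using constant_mode_harmonic by blast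
qed

lemma limit_space_orthogonal_harmonic:
  assumes x: "x \<in> limit_space s p \<theta>" and h: "h \<in> harmonic_Ri"
  shows "x \<bullet> h = 0"
proof -
  obtain a c where ac: "x = a + c" "a \<in> P_spec s p" "c \<in> corner_space s p \<theta>"
    using x by (auto simp: limit_space_def dsum_def)
  have "h \<in> (corner_space s p \<theta>)\<^sup>\<bottom>"
    by (rule corner_orthogonalI) (use harmonic_orthogonal_mode[OF h, of True] in \<open>simp add: inner_commute\<close>)
  then show ?thesis
    using ac harmonic_orthogonal_P_spec[OF h, of s p] by (simp add: orthogonal_comp_iff inner_add_left)
qed

text \<open>
  Since \<open>J\<close> carries the eigenspace of \<open>s\<close> to that of \<open>flip s\<close>, the left hand side is the sum of the
  two eigenprojections.
\<close>

lemma limit_proj_identity_mode: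
  assumes \<theta>: "norm \<theta> = 1" and ne: "b \<or> k \<noteq> (0, 0)"
  shows "blinfun_apply (limit_proj s p \<theta>) (mode_l2 b k v)
    - J_l2 (blinfun_apply (limit_proj s p \<theta>) (J_l2 (mode_l2 b k v))) = mode_l2 b k v"
proof -
  have *: "mode_l2 b k (pol s d v) - J_l2 (mode_l2 b k (pol s d (J_cfibre v))) = mode_l2 b k v" for d
  proof -
    have "J_l2 (mode_l2 b k (pol s d (J_cfibre v))) = - mode_l2 b k (pol (flip s) d v)"
      by (simp add: J_mode_l2 J_pol J_J_cfibre linear_neg[OF linear_pol] linear_neg[OF mode_l2_linear])
    then show ?thesis using mode_l2_split[of b k v s d] by simp
  qed
  show ?thesis
  proof (cases b)
    case True
    then show ?thesis using * by (simp add: J_mode_l2[of True] limit_proj_mode(1)[OF \<theta>])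
  next
    case False
    then show ?thesis using * ne by (simp add: J_mode_l2[of False k v] limit_proj_mode(2)[OF \<theta>])
  qed
qed

text \<open>
  Adding a Lagrangian of the harmonic space fills the one gap left by the spectral part, namely
  the constant diagonal modes.
\<close>

lemma lagrangian_limit_space_plus:
  assumes \<theta>: "norm \<theta> = 1" and \<Lambda>: "lagrangian_in harmonic_Ri \<Lambda>"
  shows "lagrangian_in UNIV (limit_space s p \<theta> \<oplus>\<^sub>L \<Lambda>)"
    and "orth_proj (limit_space s p \<theta> \<oplus>\<^sub>L \<Lambda>) = limit_proj s p \<theta> + orth_proj \<Lambda>"
proof -
  let ?R = "limit_proj s p \<theta>" and ?Q = "orth_proj \<Lambda>"
  note J = linear_simps[OF bounded_linear_J_l2]
  have L: "subspace \<Lambda>" "closed \<Lambda>" "\<Lambda> \<subseteq> harmonic_Ri" "J_l2 ` \<Lambda> = harmonic_Ri \<inter> \<Lambda>\<^sup>\<bottom>"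
    using \<Lambda> by (auto simp: lagrangian_in_def)
  have Q: "is_orth_proj ?Q \<Lambda>" using is_orth_proj_exists[OF L(1,2)] orth_proj_eq[OF _ L(1)] by metis
  note R = is_orth_proj_limit[of s p \<theta>]
  have sum: "is_orth_proj (?R + ?Q) (limit_space s p \<theta> \<oplus>\<^sub>L \<Lambda>)"
    unfolding dsum_def
    by (rule is_orth_proj_sum[OF R subspace_limit_space Q L(1)]) (use limit_space_orthogonal_harmonic L(3) in blast)
  have sub: "subspace (limit_space s p \<theta> \<oplus>\<^sub>L \<Lambda>)" by (intro subspace_dsum subspace_limit_space L(1))
  show "orth_proj (limit_space s p \<theta> \<oplus>\<^sub>L \<Lambda>) = ?R + ?Q" by (rule orth_proj_eq[OF sum sub])
  have Q0: "blinfun_apply ?Q (mode_l2 b k v) = 0" if "b \<or> k \<noteq> (0, 0)" for b k v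
  proof -
    have "mode_l2 b k v \<in> \<Lambda>\<^sup>\<bottom>"
      using harmonic_orthogonal_mode[OF _ that] L(3) unfolding orthogonal_comp_iff by blast
    then show ?thesis using is_orth_proj_kernel[OF Q L(1)] by blast
  qed
  have harm: "blinfun_apply ?Q h - J_l2 (blinfun_apply ?Q (J_l2 h)) = h" if h: "h \<in> harmonic_Ri" for h
  proof -
    let ?l = "blinfun_apply ?Q h"
    have l: "?l \<in> \<Lambda>" "h - ?l \<in> \<Lambda>\<^sup>\<bottom>" using Q by (auto simp: is_orth_proj_def)
    have "h - ?l \<in> harmonic_Ri"
      using h l(1) L(3) unfolding harmonic_Ri_eq_constants
      by (intro subspace_diff linear_subspace_image mode_l2_linear subspace_UNIV) auto
    \<comment> \<open>A harmonic form is \<open>l + J m\<close> with \<open>l\<close> and \<open>m\<close> in \<open>\<Lambda>\<close>, so the projection sends its image \<open>J l - m\<close> to \<open>- m\<close>.\<close>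
    then obtain m where m: "m \<in> \<Lambda>" "h - ?l = J_l2 m" using l(2) L(4) by blast
    have "J_l2 ?l \<in> \<Lambda>\<^sup>\<bottom>" using l(1) L(4) by blast
    then have "blinfun_apply ?Q (J_l2 ?l) = 0" using is_orth_proj_kernel[OF Q L(1)] by blast
    moreover have "blinfun_apply ?Q m = m" using is_orth_proj_fixes[OF Q L(1)] m(1) by blast
    moreover have "J_l2 h = J_l2 ?l - m"
      using arg_cong[OF m(2), of J_l2] by (simp add: J J_l2_J_l2 algebra_simps)
    ultimately have "blinfun_apply ?Q (J_l2 h) = - m" by (simp add: blinfun.diff_right)
    then show ?thesis using m(2) by (simp add: J algebra_simps)
  qed
  have "(\<lambda>x. blinfun_apply (?R + ?Q) x - J_l2 (blinfun_apply (?R + ?Q) (J_l2 x))) = (\<lambda>x. x)"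
  proof (rule bounded_linear_eq_on_modes)
    show "bounded_linear (\<lambda>x. blinfun_apply (?R + ?Q) x - J_l2 (blinfun_apply (?R + ?Q) (J_l2 x)))"
      by (intro bounded_linear_sub blinfun.bounded_linear_right
          bounded_linear_compose[OF bounded_linear_J_l2]
          bounded_linear_compose[OF blinfun.bounded_linear_right bounded_linear_J_l2])
    fix b k v
    show "blinfun_apply (?R + ?Q) (mode_l2 b k v) - J_l2 (blinfun_apply (?R + ?Q) (J_l2 (mode_l2 b k v))) = mode_l2 b k v"
    proof (cases "b \<or> k \<noteq> (0, 0)")
      case True
      then show ?thesis
        using limit_proj_identity_mode[OF \<theta> True, of s p v]
        by (simp only: plus_blinfun.rep_eq J_mode_l2 Q0[OF True] add_0_right)
    next
      case False
      then have "b = False" "k = (0, 0)" by auto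
      then show ?thesis
        using harm[OF constant_mode_harmonic[of v]]
        by (simp add: plus_blinfun.rep_eq J_mode_l2 limit_proj_mode(2)[OF \<theta>])
    qed
  qed (rule bounded_linear_ident)
  then show "lagrangian_in UNIV (limit_space s p \<theta> \<oplus>\<^sub>L \<Lambda>)"
    by (intro lagrangian_in_UNIV_I[OF sum sub]) (rule fun_cong)
qed


section \<open>The blown up parameter plane\<close>

lemma half_lattice_iff: "c \<in> half_lattice \<longleftrightarrow> (\<exists>k. c = lattice_pt k / 2)"
proof
  assume "c \<in> half_lattice"
  then obtain a b where "2 * Re c = of_int a" "2 * Im c = of_int b"
    by (auto simp: half_lattice_def elim!: Ints_cases)
  then have "c = lattice_pt (a, b) / 2" by (simp add: lattice_pt_def complex_eq_iff)
  then show "\<exists>k. c = lattice_pt k / 2" ..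
next
  assume "\<exists>k. c = lattice_pt k / 2"
  then obtain k where k: "c = lattice_pt k / 2" by blast
  have "2 * Re c = of_int (fst k)" "2 * Im c = of_int (snd k)" unfolding k lattice_pt_def by simp_all
  then show "c \<in> half_lattice" by (simp add: half_lattice_def)
qed

lemma half_lattice_dist:
  assumes "c \<in> half_lattice" "d \<in> half_lattice" "c \<noteq> d"
  shows "dist c d \<ge> 1/2"
proof -
  obtain k l where k: "c = lattice_pt k / 2" and l: "d = lattice_pt l / 2"
    using assms half_lattice_iff by metis
  have "k \<noteq> l" using k l assms(3) by metis
  then have "\<bar>real_of_int (fst k - fst l)\<bar> \<ge> 1 \<or> \<bar>real_of_int (snd k - snd l)\<bar> \<ge> 1"
    by (auto simp: prod_eq_iff simp flip: of_int_diff of_int_abs)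
  moreover have "Re (c - d) = real_of_int (fst k - fst l) / 2" "Im (c - d) = real_of_int (snd k - snd l) / 2"
    by (simp_all add: k l lattice_pt_def diff_divide_distrib)
  moreover have "\<bar>x / 2\<bar> \<ge> 1/2" if "\<bar>x\<bar> \<ge> 1" for x :: real using that by simp
  ultimately have "\<bar>Re (c - d)\<bar> \<ge> 1/2 \<or> \<bar>Im (c - d)\<bar> \<ge> 1/2" by metis
  then show ?thesis
    using abs_Re_le_cmod[of "c - d"] abs_Im_le_cmod[of "c - d"] by (auto simp: dist_norm)
qed

lemma half_lattice_disk_unique:
  assumes "c \<in> half_lattice" "d \<in> half_lattice" "dist z c < 1/4" "dist z d < 1/4"
  shows "c = d"
proof (rule ccontr)
  assume "c \<noteq> d"
  then have "dist c d \<ge> 1/2" using assms half_lattice_dist by blast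
  then show False using dist_triangle[of c d z] assms(3,4) by (simp add: dist_commute)
qed

text \<open>
  The coordinates of the chosen representative of the class.  The direction is determined by the
  class only over the half lattice, which is where \<open>direction\<close> uses it.
\<close>

definition base_pt :: "(real \<Rightarrow> real) \<Rightarrow> complex \<Rightarrow> complex" where
  "base_pt \<eta> z = fst (rep_blowup (h_map \<eta> z))"

definition base_dir :: "(real \<Rightarrow> real) \<Rightarrow> complex \<Rightarrow> complex" where
  "base_dir \<eta> z = snd (rep_blowup (h_map \<eta> z))"

lemma rep_abs_blowup:
  assumes "norm \<theta> = 1"
  shows "fst (rep_blowup (abs_blowup (p, \<theta>))) = p"
    and "p \<in> half_lattice \<Longrightarrow> snd (rep_blowup (abs_blowup (p, \<theta>))) = \<theta>"
proof -
  have "blowup_rel (p, \<theta>) (p, \<theta>)" using assms by (simp add: blowup_rel_def)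
  then have "blowup_rel (rep_blowup (abs_blowup (p, \<theta>))) (p, \<theta>)"
    by (rule rep_abs_rsp_left[OF Quotient3_blowup])
  then show "fst (rep_blowup (abs_blowup (p, \<theta>))) = p"
    and "p \<in> half_lattice \<Longrightarrow> snd (rep_blowup (abs_blowup (p, \<theta>))) = \<theta>"
    by (auto simp: blowup_rel_def)
qed

lemma h_map_in_disk:
  assumes "c \<in> half_lattice" "dist z c < 1/4"
  shows "h_map \<eta> z = abs_blowup (c + of_real (\<eta> (norm (z - c))) * (z - c), (z - c) / of_real (norm (z - c)))"
proof -
  have "(THE c. c \<in> half_lattice \<and> dist z c < 1/4) = c"
    using assms half_lattice_disk_unique by (intro the_equality) blast+
  then show ?thesis using assms by (auto simp: h_map_def Let_def)
qed

lemma base_in_disk: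
  assumes z: "z \<in> dotted_plane" and c: "c \<in> half_lattice" "dist z c < 1/4"
  shows "base_pt \<eta> z = c + of_real (\<eta> (norm (z - c))) * (z - c)"
    and "base_pt \<eta> z \<in> half_lattice \<Longrightarrow> base_dir \<eta> z = sgn (z - c)"
proof -
  have "z \<noteq> c" using z c by (auto simp: dotted_plane_def)
  then have n: "norm ((z - c) / of_real (norm (z - c))) = 1" by (simp add: norm_divide)
  show 1: "base_pt \<eta> z = c + of_real (\<eta> (norm (z - c))) * (z - c)"
    unfolding base_pt_def h_map_in_disk[OF c] by (rule rep_abs_blowup(1)[OF n])
  show "base_pt \<eta> z \<in> half_lattice \<Longrightarrow> base_dir \<eta> z = sgn (z - c)"
    unfolding 1 unfolding base_dir_def h_map_in_disk[OF c] sgn_eq by (rule rep_abs_blowup(2)[OF n])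
qed

lemma base_off_disks: "\<not> (\<exists>c\<in>half_lattice. dist z c < 1/4) \<Longrightarrow> base_pt \<eta> z = z"
  by (simp add: base_pt_def h_map_def rep_abs_blowup(1))

lemma cutoff_bounds: "smooth_cutoff \<eta> \<Longrightarrow> 0 \<le> \<eta> t \<and> \<eta> t \<le> 1"
  by (simp add: smooth_cutoff_def)

lemma cutoff_continuous: "smooth_cutoff \<eta> \<Longrightarrow> isCont \<eta> t"
proof -
  assume "smooth_cutoff \<eta>"
  then have "((deriv ^^ 0) \<eta>) differentiable (at t)" unfolding smooth_cutoff_def by blast
  then show ?thesis by (simp add: differentiable_imp_continuous_within)
qed

lemma base_in_disk_dist:
  assumes \<eta>: "smooth_cutoff \<eta>" and z: "z \<in> dotted_plane" and c: "c \<in> half_lattice" "dist z c < 1/4"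
  shows "dist (base_pt \<eta> z) c < 1/4"
proof -
  have "dist (base_pt \<eta> z) c = \<eta> (norm (z - c)) * norm (z - c)"
    using cutoff_bounds[OF \<eta>, of "norm (z - c)"]
    by (simp add: base_in_disk(1)[OF z c] dist_norm norm_mult)
  also have "\<dots> \<le> 1 * norm (z - c)"
    using cutoff_bounds[OF \<eta>] by (intro mult_right_mono) auto
  finally show ?thesis using c by (simp add: dist_norm)
qed

text \<open>
  Seen from the lattice point \<open>c\<close>, the direction is read off at \<open>z\<close> itself inside the disk around
  \<open>c\<close> and at the image point outside of it.  In both cases the distance from \<open>c\<close> is at
  least \<open>1/8\<close>.
\<close>

definition sight_pt :: "(real \<Rightarrow> real) \<Rightarrow> complex \<Rightarrow> complex \<Rightarrow> complex" where
  "sight_pt \<eta> c z = (if dist z c < 1/4 then z else base_pt \<eta> z)"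

lemma sight_pt_dist:
  assumes \<eta>: "smooth_cutoff \<eta>" and z: "z \<in> dotted_plane" and c: "c \<in> half_lattice"
  shows "dist (sight_pt \<eta> c z) c \<ge> 1/8"
proof (cases "dist z c < 1/4")
  case True
  then show ?thesis using z c by (simp add: sight_pt_def dotted_plane_def)
next
  case False
  have "dist (base_pt \<eta> z) c \<ge> 1/4"
  proof (cases "\<exists>d\<in>half_lattice. dist z d < 1/4")
    case True
    then obtain d where d: "d \<in> half_lattice" "dist z d < 1/4" by blast
    then have "d \<noteq> c" using False by blast
    then have "dist d c \<ge> 1/2" using half_lattice_dist d c by blast
    then show ?thesis
      using dist_triangle[of d c "base_pt \<eta> z"] base_in_disk_dist[OF \<eta> z d] by (simp add: dist_commute)
  next
    case no: False
    then show ?thesis using False by (simp add: base_off_disks)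
  qed
  then show ?thesis using False by (simp add: sight_pt_def)
qed

lemma sgn_of_real_mult: "r > 0 \<Longrightarrow> sgn (of_real r * z) = sgn z" for z :: complex
  by (simp add: sgn_mult sgn_of_real)

lemma direction_eq_sight:
  assumes \<eta>: "smooth_cutoff \<eta>" and z: "z \<in> dotted_plane"
  shows "direction (base_pt \<eta> z) (base_dir \<eta> z) k
    = - sgn (sight_pt \<eta> (lattice_pt k / 2) z - lattice_pt k / 2)"
proof -
  let ?p = "base_pt \<eta> z"
  define c where c_def: "c = lattice_pt k / 2"
  have c: "c \<in> half_lattice" unfolding c_def using half_lattice_iff by blast
  have fr: "freq True ?p k = of_real 2 * (- (?p - c))" by (simp add: freq_def c_def)
  have far: "direction ?p (base_dir \<eta> z) k = - sgn (?p - c)" if "?p \<noteq> c"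
  proof -
    define y where "y = ?p - c"
    have y: "freq True ?p k = of_real 2 * (- y)" "y \<noteq> 0" using that unfolding fr y_def by auto
    have "sgn (of_real 2 * (- y)) = - sgn y"
      by (subst sgn_of_real_mult) (simp_all add: sgn_minus)
    then show ?thesis using y by (simp add: direction_def y_def[symmetric])
  qed
  have "direction ?p (base_dir \<eta> z) k = - sgn (sight_pt \<eta> c z - c)"
  proof (cases "dist z c < 1/4")
    case True
    let ?e = "\<eta> (norm (z - c))"
    have p: "?p - c = of_real ?e * (z - c)" using base_in_disk(1)[OF z c True, of \<eta>] by simp
    have "direction ?p (base_dir \<eta> z) k = - sgn (z - c)"
    proof (cases "?e = 0")
      case e0: True
      then have pc: "?p = c" using p by simp
      then have "base_dir \<eta> z = sgn (z - c)" using base_in_disk(2)[OF z c True, of \<eta>] c by simp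
      moreover have "freq True ?p k = 0" unfolding fr using pc by simp
      ultimately show ?thesis by (simp add: direction_def)
    next
      case False
      then have "?e > 0" using cutoff_bounds[OF \<eta>] by (simp add: less_le)
      moreover have "z \<noteq> c" using z c by (auto simp: dotted_plane_def)
      ultimately have "?p \<noteq> c" "sgn (?p - c) = sgn (z - c)"
        using p by (auto simp: sgn_of_real_mult)
      then show ?thesis using far by simp
    qed
    then show ?thesis using True by (simp add: sight_pt_def)
  next
    case False
    then have s: "sight_pt \<eta> c z = ?p" by (simp add: sight_pt_def)
    then have "?p \<noteq> c" using sight_pt_dist[OF \<eta> z c] by auto
    then show ?thesis using far s by simp
  qed
  then show ?thesis by (simp only: c_def)
qed

lemma direction_diff_le:
  assumes \<eta>: "smooth_cutoff \<eta>" and z: "z \<in> dotted_plane" and w: "w \<in> dotted_plane"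
  shows "norm (direction (base_pt \<eta> z) (base_dir \<eta> z) k - direction (base_pt \<eta> w) (base_dir \<eta> w) k)
    \<le> 16 * dist (sight_pt \<eta> (lattice_pt k / 2) z) (sight_pt \<eta> (lattice_pt k / 2) w)"
proof -
  let ?c = "lattice_pt k / 2"
  let ?a = "sight_pt \<eta> ?c w - ?c" and ?b = "sight_pt \<eta> ?c z - ?c"
  have "?c \<in> half_lattice" using half_lattice_iff by blast
  then have a: "norm ?a \<ge> 1/8" using sight_pt_dist[OF \<eta> w] by (simp add: dist_norm)
  then have "?a \<noteq> 0" by (metis norm_zero not_le zero_less_divide_1_iff zero_less_numeral)
  have "norm (direction (base_pt \<eta> z) (base_dir \<eta> z) k - direction (base_pt \<eta> w) (base_dir \<eta> w) k) = norm (sgn ?a - sgn ?b)"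
    by (simp add: direction_eq_sight[OF \<eta>] z w)
  also have "\<dots> \<le> 2 * norm (?a - ?b) / norm ?a" by (rule norm_sgn_diff_le[OF \<open>?a \<noteq> 0\<close>])
  also have "\<dots> \<le> 2 * norm (?a - ?b) / (1/8)"
    by (rule divide_left_mono[OF a]) (use \<open>?a \<noteq> 0\<close> in simp_all)
  finally show ?thesis by (simp add: dist_norm norm_minus_commute)
qed

text \<open>
  Inside a disk this is continuity of the cutoff.  At the other points the image is the point
  itself, and nearby points in a disk are moved little since the cutoff is close to \<open>1\<close> near the
  boundary circle.
\<close>

lemma base_pt_continuous_at:
  assumes \<eta>: "smooth_cutoff \<eta>" and w: "w \<in> dotted_plane" and e: "e > 0"
  shows "\<exists>\<delta>>0. \<forall>z\<in>dotted_plane. dist z w < \<delta> \<longrightarrow> dist (base_pt \<eta> z) (base_pt \<eta> w) < e"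
proof (cases "\<exists>c\<in>half_lattice. dist w c < 1/4")
  case True
  then obtain c where c: "c \<in> half_lattice" "dist w c < 1/4" by blast
  define g where "g z = c + of_real (\<eta> (norm (z - c))) * (z - c)" for z
  have "isCont (\<lambda>z. \<eta> (norm (z - c))) w"
    by (rule isCont_o2[OF _ cutoff_continuous[OF \<eta>]]) (intro continuous_intros)
  then have "isCont g w" unfolding g_def by (intro continuous_intros)
  then obtain d where d: "d > 0" "\<And>z. dist z w < d \<Longrightarrow> dist (g z) (g w) < e"
    using e unfolding continuous_at_eps_delta by blast
  show ?thesis
  proof (intro exI[of _ "min d (1/4 - dist w c)"] conjI ballI impI)
    fix z assume z: "z \<in> dotted_plane" "dist z w < min d (1/4 - dist w c)"
    then have "dist z c < 1/4" using dist_triangle[of z c w] by simp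
    then show "dist (base_pt \<eta> z) (base_pt \<eta> w) < e"
      using d(2)[of z] z base_in_disk(1)[OF w c, of \<eta>] base_in_disk(1)[OF z(1) c(1), of \<eta>] by (simp add: g_def)
  qed (use d c in auto)
next
  case False
  then have pw: "base_pt \<eta> w = w" by (rule base_off_disks)
  have "\<eta> (1/4) = 1" using \<eta> by (simp add: smooth_cutoff_def)
  then obtain d where d: "d > 0" "\<And>t. dist t (1/4) < d \<Longrightarrow> dist (\<eta> t) 1 < e / 2"
    using cutoff_continuous[OF \<eta>, of "1/4"] e unfolding continuous_at_eps_delta
    by (metis half_gt_zero)
  show ?thesis
  proof (intro exI[of _ "min d (e/2)"] conjI ballI impI)
    fix z assume z: "z \<in> dotted_plane" "dist z w < min d (e/2)"
    have "dist (base_pt \<eta> z) z \<le> e / 2"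
    proof (cases "\<exists>c\<in>half_lattice. dist z c < 1/4")
      case True
      then obtain c where c: "c \<in> half_lattice" "dist z c < 1/4" by blast
      let ?t = "norm (z - c)"
      have "dist w c \<ge> 1/4" using False c by force
      then have "?t > 1/4 - d" using dist_triangle[of w c z] z by (simp add: dist_norm norm_minus_commute)
      then have "dist ?t (1/4) < d" using c d(1) by (simp add: dist_norm)
      then have "\<bar>\<eta> ?t - 1\<bar> < e / 2" using d(2) by (simp add: dist_norm)
      moreover have "dist (base_pt \<eta> z) z = \<bar>\<eta> ?t - 1\<bar> * ?t"
      proof -
        have "base_pt \<eta> z - z = of_real (\<eta> ?t - 1) * (z - c)"
          by (simp add: base_in_disk(1)[OF z(1) c] algebra_simps)
        then show ?thesis by (simp only: dist_norm norm_mult norm_of_real)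
      qed
      moreover have "\<bar>\<eta> ?t - 1\<bar> * ?t \<le> \<bar>\<eta> ?t - 1\<bar> * 1"
        using c by (intro mult_left_mono) (auto simp: dist_norm)
      ultimately show ?thesis by simp
    next
      case no: False
      then show ?thesis using e by (simp add: base_off_disks)
    qed
    then show "dist (base_pt \<eta> z) (base_pt \<eta> w) < e"
      using z dist_triangle[of "base_pt \<eta> z" w z] by (simp add: pw)
  qed (use d e in auto)
qed

text \<open>
  Uniformity in \<open>c\<close> is possible because the point lies in at most one disk.  If it lies in one,
  so do all nearby points, and every \<open>c\<close> uses the same branch for all of them; if it lies in none,
  both branches give the point itself.
\<close>

lemma sight_pt_equicontinuous_at:
  assumes \<eta>: "smooth_cutoff \<eta>" and w: "w \<in> dotted_plane" and e: "e > 0"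
  shows "\<exists>\<delta>>0. \<forall>z\<in>dotted_plane. dist z w < \<delta> \<longrightarrow>
    (\<forall>c\<in>half_lattice. dist (sight_pt \<eta> c z) (sight_pt \<eta> c w) < e)"
proof -
  obtain d where d: "d > 0" "\<And>z. z \<in> dotted_plane \<Longrightarrow> dist z w < d \<Longrightarrow> dist (base_pt \<eta> z) (base_pt \<eta> w) < e"
    using base_pt_continuous_at[OF assms] by blast
  show ?thesis
  proof (cases "\<exists>c\<in>half_lattice. dist w c < 1/4")
    case True
    then obtain c where c: "c \<in> half_lattice" "dist w c < 1/4" by blast
    show ?thesis
    proof (intro exI[of _ "min (min d e) (1/4 - dist w c)"] conjI ballI impI)
      fix z b assume z: "z \<in> dotted_plane" "dist z w < min (min d e) (1/4 - dist w c)" and b: "b \<in> half_lattice"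
      have zc: "dist z c < 1/4" using dist_triangle[of z c w] z by simp
      show "dist (sight_pt \<eta> b z) (sight_pt \<eta> b w) < e"
      proof (cases "b = c")
        case True
        then show ?thesis using zc c z by (simp add: sight_pt_def)
      next
        case False
        then have "\<not> dist z b < 1/4" "\<not> dist w b < 1/4"
          using half_lattice_disk_unique[OF b c(1)] zc c(2) by blast+
        then show ?thesis using d(2)[OF z(1)] z by (simp add: sight_pt_def)
      qed
    qed (use d e c in auto)
  next
    case False
    then have pw: "base_pt \<eta> w = w" by (rule base_off_disks)
    show ?thesis
    proof (intro exI[of _ "min d e"] conjI ballI impI)
      fix z b assume z: "z \<in> dotted_plane" "dist z w < min d e" and b: "b \<in> half_lattice"
      have "sight_pt \<eta> b w = w" by (simp add: sight_pt_def pw)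
      then show "dist (sight_pt \<eta> b z) (sight_pt \<eta> b w) < e"
        using d(2)[OF z(1)] z pw by (simp add: sight_pt_def)
    qed (use d e in auto)
  qed
qed

lemma continuous_on_limit_proj_base:
  assumes \<eta>: "smooth_cutoff \<eta>"
  shows "continuous_on dotted_plane (\<lambda>z. limit_proj s (base_pt \<eta> z) (base_dir \<eta> z))"
  unfolding continuous_on_iff
proof (intro ballI allI impI)
  fix w and e :: real
  assume w: "w \<in> dotted_plane" and e: "e > 0"
  obtain d where d: "d > 0" "\<And>z c. z \<in> dotted_plane \<Longrightarrow> dist z w < d \<Longrightarrow> c \<in> half_lattice \<Longrightarrow>
      dist (sight_pt \<eta> c z) (sight_pt \<eta> c w) < e / 32"
    using sight_pt_equicontinuous_at[OF \<eta> w, of "e / 32"] e by auto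
  have n: "norm (base_dir \<eta> z) = 1" for z
    by (simp add: base_dir_def rep_blowup_norm)
  have "dist (limit_proj s (base_pt \<eta> z) (base_dir \<eta> z)) (limit_proj s (base_pt \<eta> w) (base_dir \<eta> w)) < e"
    if z: "z \<in> dotted_plane" "dist z w < d" for z
  proof -
    have "norm (direction (base_pt \<eta> z) (base_dir \<eta> z) k - direction (base_pt \<eta> w) (base_dir \<eta> w) k) \<le> e / 2" for k
    proof -
      have "lattice_pt k / 2 \<in> half_lattice" using half_lattice_iff by blast
      from d(2)[OF z this] direction_diff_le[OF \<eta> z(1) w, of k] show ?thesis by simp
    qed
    then have "norm (limit_proj s (base_pt \<eta> z) (base_dir \<eta> z) - limit_proj s (base_pt \<eta> w) (base_dir \<eta> w)) \<le> e / 2"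
      using e by (intro limit_proj_diff_le n) auto
    then show ?thesis using e by (simp add: dist_norm)
  qed
  then show "\<exists>d>0. \<forall>z\<in>dotted_plane. dist z w < d \<longrightarrow>
      dist (limit_proj s (base_pt \<eta> z) (base_dir \<eta> z)) (limit_proj s (base_pt \<eta> w) (base_dir \<eta> w)) < e"
    using d(1) by blast
qed

lemma topspace_blowup: "topspace (blowup_topology \<eta>) = UNIV"
proof -
  have "openin (blowup_topology \<eta>) UNIV" by (simp add: openin_blowup_topology)
  then show ?thesis using openin_subset by blast
qed

text \<open>
  The topology is the final one with respect to \<open>h_map\<close> on the dotted plane.
\<close>

lemma continuous_map_blowup_iff:
  fixes f :: "blowup \<Rightarrow> 'b::topological_space"
  shows "continuous_map (blowup_topology \<eta>) euclidean f \<longleftrightarrow> continuous_on dotted_plane (\<lambda>z. f (h_map \<eta> z))"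
proof -
  have "{z \<in> dotted_plane. h_map \<eta> z \<in> {x. f x \<in> U}} = dotted_plane \<inter> (\<lambda>z. f (h_map \<eta> z)) -` U" for U
    by auto
  then show ?thesis
    by (simp add: continuous_map_def topspace_blowup openin_blowup_topology continuous_openin_preimage_eq)
qed

theorem theorem3p2p5:
  fixes \<eta> :: "real \<Rightarrow> real" and L :: "blowup \<Rightarrow> l2_form set" and s :: sign
  assumes "smooth_cutoff \<eta>"
    and "lagrangian_family (blowup_topology \<eta>) harmonic_Ri L"
  shows "lagrangian_family (blowup_topology \<eta>) UNIV (curly_P s L)"
proof -
  have L: "lagrangian_in harmonic_Ri (L x)" for x
    using assms(2) by (simp add: lagrangian_family_def)
  have Lc: "continuous_on dotted_plane (\<lambda>z. orth_proj (L (h_map \<eta> z)))"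
    using assms(2) by (simp add: lagrangian_family_def continuous_map_blowup_iff)
  note P = lagrangian_limit_space_plus[OF rep_blowup_norm L]
  have "continuous_on dotted_plane (\<lambda>z. orth_proj (curly_P s L (h_map \<eta> z)))"
    unfolding curly_P_eq P(2)
    using continuous_on_add[OF continuous_on_limit_proj_base[OF assms(1)] Lc]
    by (simp add: base_pt_def base_dir_def)
  then show ?thesis
    using P(1) by (simp add: lagrangian_family_def continuous_map_blowup_iff curly_P_eq)
qed


end
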